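(* Let $t$ be an indeterminate over the field $\mathbb{F}_3$ with three elements. The Galois group over $\mathbb{F}_3(t)$ of the polynomial $x^{11}+tx^{2}-1\in \mathbb{F}_3(t)[x]$, as a permutation group on its $11$ roots, is the Mathieu group $M_{11}$.
   Context: The Galois group of a separable polynomial over a field is the Galois group of its splitting field over that field, regarded as a permutation group on the roots. $M_{11}$ is the Mathieu group in its natural action on $11$ points. *)

theory Defs
  imports
    "HOL-Algebra.Algebra"
    "HOL-Algebra.Algebraic_Closure_Type"
    "HOL-Computational_Algebra.Computational_Algebra"
    "HOL-Combinatorics.Combinatorics"
    "HOL-Library.Cardinality"
begin

definition roots_ac :: "'k::field poly \<Rightarrow> 'k alg_closure set" where
  "roots_ac p = {z. poly (map_poly to_ac p) z = 0}"

definition splitting_field :: "'k::field poly \<Rightarrow> 'k alg_closure ring" where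
  "splitting_field p =
     (ring_of_type_algebra :: 'k alg_closure ring)
       \<lparr>carrier := generate_field ring_of_type_algebra (range to_ac \<union> roots_ac p)\<rparr>"

text \<open>
  Automorphisms are taken to be extensional functions, as in \<^const>\<open>BijGroup\<close>, so that
  two automorphisms are equal if and only if they agree on the splitting field.
\<close>

definition galois_group ::
    "'k::field poly \<Rightarrow> ('k alg_closure \<Rightarrow> 'k alg_closure) monoid" where
  "galois_group p =
     (let L = splitting_field p in
      BijGroup (carrier L)
        \<lparr>carrier := {\<sigma> \<in> Bij (carrier L). \<sigma> \<in> ring_iso L L \<and> (\<forall>a. \<sigma> (to_ac a) = to_ac a)}\<rparr>)"

definition galois_perms ::
    "'k::field poly \<Rightarrow> ('k alg_closure \<Rightarrow> 'k alg_closure) set" where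
  "galois_perms p = (\<lambda>\<sigma>. restrict_id \<sigma> (roots_ac p)) ` carrier (galois_group p)"

text \<open>
  \<open>perm_isomorphic A G B H\<close>: the permutation groups \<open>G\<close> on \<open>A\<close> and \<open>H\<close> on \<open>B\<close> coincide
  after relabelling points by a bijection. Elements of \<open>G\<close> and \<open>H\<close> are functions that are
  the identity outside \<open>A\<close> and \<open>B\<close>, respectively, as for \<^const>\<open>permutes\<close>.
\<close>

definition perm_isomorphic ::
    "'a set \<Rightarrow> ('a \<Rightarrow> 'a) set \<Rightarrow> 'b set \<Rightarrow> ('b \<Rightarrow> 'b) set \<Rightarrow> bool" where
  "perm_isomorphic A G B H \<longleftrightarrow> (\<exists>\<phi>. bij_betw \<phi> A B \<and> map_permutation A \<phi> ` G = H)"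

text \<open>
  The Mathieu group in its natural (sharply 4-transitive) action on \<open>{1..11}\<close>, of order
  \<open>7920\<close>, given by the standard generators
  \<open>(1 2 3 4 5 6 7 8 9 10 11)\<close> and \<open>(3 7 11 8)(4 10 5 6)\<close>.
\<close>

definition M11 :: "(nat \<Rightarrow> nat) set" where
  "M11 = generate (sym_group 11)
     {cycle_of_list [1, 2, 3, 4, 5, 6, 7, 8, 9, 10, 11],
      cycle_of_list [3, 7, 11, 8] \<circ> cycle_of_list [4, 10, 5, 6]}"

definition ratfun_var :: "'a::field poly fract" where
  "ratfun_var = Fract [:0, 1:] 1"

end

theory Submission
  imports Defs "HOL-Library.Product_Plus" "HOL-Library.Sublist"
begin

text \<open>
  The trinomial \<open>x ^ 11 + t x ^ 2 - 1\<close> hides a linear structure. If \<open>y ^ 2\<close> is one of its roots, then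
  \<open>y ^ 22 + t y ^ 4 = 1\<close>, and repeated cubing shows that \<open>y\<close> is a zero of an additive polynomial of
  degree \<open>3 ^ 5\<close> (lemma \<open>additive_op_root\<close>). Hence the square roots of the eleven roots lie in a vector
  space of dimension at most five over the prime field, and automorphisms preserve the linear relations
  between them up to signs.
  
  These relations are made explicit by specialising \<open>t\<close>. The trinomial has distinct roots for
  every value \<open>e\<close> of \<open>t\<close>, so the splitting field embeds into Laurent series over the algebraic closure of
  the base field in such a way that \<open>t\<close> becomes \<open>e + X\<close> and the roots become power series
  (\<open>realisation_exists\<close>). Relations can be read off from constant coefficients
  (\<open>additive_op_kernel_small\<close>), and cubing coefficients is an automorphism over the rational functions,
  which yields elements of the Galois group (\<open>automorphism_from_series\<close>). At \<open>e = 1\<close> the constant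
  coefficients are the iterated cubes of one element and satisfy a linear recurrence of period 11 with
  irreducible characteristic polynomial of degree five. So the roots are labelled by \<open>1, ..., 11\<close>
  such that the Galois group contains the 11-cycle and the relations form the ternary Golay code.
  
  Upper bound: the Galois group preserves the supports of the code words of weight five, the 66 blocks
  of the Steiner system \<open>S(4, 5, 11)\<close>. A search shows that a permutation with this property that fixes
  four points is the identity, and explicit words show that the Mathieu group, which has the property,
  is 4-transitive. Therefore the group of all such permutations is the Mathieu group, of
  order 7920 (\<open>aut_eq_M11\<close>, \<open>card_M11\<close>).
  
  Lower bound: specialising at 0 and at -1 gives elements of orders 5 and 8 in the Galois group. A
  subgroup of the Mathieu group that contains the 11-cycle and has order divisible by 40 is the whole
  group, by counting the cosets of the group of order 11 modulo 11 (\<open>G_eq_M11\<close>).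
\<close>

unbundle fps_syntax

section \<open>Extending field homomorphisms\<close>

text \<open>
  Subfields are subsets of a field type, and homomorphisms are functions on the type that are
  constrained on such a subset only, so that a homomorphism can be extended step by step
  without a change of types.
\<close>

definition subfield_set :: "'b::field set \<Rightarrow> bool" where
  "subfield_set E \<longleftrightarrow> 1 \<in> E \<and> (\<forall>x\<in>E. \<forall>y\<in>E. x - y \<in> E \<and> x * y \<in> E \<and> x / y \<in> E)"

definition hom_on :: "'b::field set \<Rightarrow> ('b \<Rightarrow> 'c::field) \<Rightarrow> bool" where
  "hom_on E \<phi> \<longleftrightarrow> \<phi> 1 = 1 \<and> (\<forall>x\<in>E. \<forall>y\<in>E. \<phi> (x + y) = \<phi> x + \<phi> y \<and> \<phi> (x * y) = \<phi> x * \<phi> y)"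

lemma subfield_setD:
  assumes "subfield_set E"
  shows "0 \<in> E" "1 \<in> E" "x \<in> E \<Longrightarrow> y \<in> E \<Longrightarrow> x + y \<in> E" "x \<in> E \<Longrightarrow> y \<in> E \<Longrightarrow> x - y \<in> E"
    "x \<in> E \<Longrightarrow> y \<in> E \<Longrightarrow> x * y \<in> E" "x \<in> E \<Longrightarrow> y \<in> E \<Longrightarrow> x / y \<in> E" "x \<in> E \<Longrightarrow> - x \<in> E"
    "x \<in> E \<Longrightarrow> inverse x \<in> E" "x \<in> E \<Longrightarrow> x ^ n \<in> E"
proof -
  show 0: "0 \<in> E" and 1: "1 \<in> E"
    using assms by (auto simp: subfield_set_def) (metis cancel_comm_monoid_add_class.diff_cancel)
  show m: "x \<in> E \<Longrightarrow> y \<in> E \<Longrightarrow> x - y \<in> E" "x \<in> E \<Longrightarrow> y \<in> E \<Longrightarrow> x * y \<in> E"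
    "x \<in> E \<Longrightarrow> y \<in> E \<Longrightarrow> x / y \<in> E" for x y
    using assms by (auto simp: subfield_set_def)
  show n: "x \<in> E \<Longrightarrow> - x \<in> E" for x using m(1)[OF 0] by simp
  show "x \<in> E \<Longrightarrow> y \<in> E \<Longrightarrow> x + y \<in> E" using m(1)[of x "- y"] n by simp
  show "x \<in> E \<Longrightarrow> inverse x \<in> E" using m(3)[OF 1] by (simp add: field_simps)
  show "x \<in> E \<Longrightarrow> x ^ n \<in> E" by (induction n) (auto intro: 1 m)
qed

lemma subfield_sum: "subfield_set E \<Longrightarrow> (\<And>i. i \<in> A \<Longrightarrow> f i \<in> E) \<Longrightarrow> sum f A \<in> E"
  by (induction A rule: infinite_finite_induct) (auto intro: subfield_setD)

lemma hom_onD: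
  assumes "subfield_set E" "hom_on E \<phi>"
  shows "\<phi> 0 = 0" "\<phi> 1 = 1" "x \<in> E \<Longrightarrow> y \<in> E \<Longrightarrow> \<phi> (x + y) = \<phi> x + \<phi> y"
    "x \<in> E \<Longrightarrow> y \<in> E \<Longrightarrow> \<phi> (x - y) = \<phi> x - \<phi> y"
    "x \<in> E \<Longrightarrow> y \<in> E \<Longrightarrow> \<phi> (x * y) = \<phi> x * \<phi> y" "x \<in> E \<Longrightarrow> y \<in> E \<Longrightarrow> \<phi> (x / y) = \<phi> x / \<phi> y"
    "x \<in> E \<Longrightarrow> \<phi> (- x) = - \<phi> x" "x \<in> E \<Longrightarrow> \<phi> (x ^ n) = \<phi> x ^ n" "x \<in> E \<Longrightarrow> \<phi> x = 0 \<longleftrightarrow> x = 0"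
proof -
  note E = subfield_setD[OF assms(1)]
  show 1: "\<phi> 1 = 1" and a: "x \<in> E \<Longrightarrow> y \<in> E \<Longrightarrow> \<phi> (x + y) = \<phi> x + \<phi> y"
    and m: "x \<in> E \<Longrightarrow> y \<in> E \<Longrightarrow> \<phi> (x * y) = \<phi> x * \<phi> y" for x y
    using assms(2) by (auto simp: hom_on_def)
  show 0: "\<phi> 0 = 0" using a[OF E(1) E(1)] by (metis add.right_neutral add_left_cancel)
  show n: "x \<in> E \<Longrightarrow> \<phi> (- x) = - \<phi> x" for x
    using a[of x "- x"] E(7)[of x] 0 by (simp add: eq_neg_iff_add_eq_0 add.commute)
  show "x \<in> E \<Longrightarrow> y \<in> E \<Longrightarrow> \<phi> (x - y) = \<phi> x - \<phi> y"
    using a[of x "- y"] E(7)[of y] n[of y] by simp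
  have z: "\<phi> x \<noteq> 0" if "x \<in> E" "x \<noteq> 0" for x
  proof
    assume "\<phi> x = 0"
    then have "\<phi> (x * inverse x) = 0" using m[OF that(1) E(8)[OF that(1)]] by simp
    then show False using that 1 by simp
  qed
  show "x \<in> E \<Longrightarrow> \<phi> x = 0 \<longleftrightarrow> x = 0" using z 0 by auto
  show "x \<in> E \<Longrightarrow> y \<in> E \<Longrightarrow> \<phi> (x / y) = \<phi> x / \<phi> y"
  proof (cases "y = 0")
    case False
    assume xy: "x \<in> E" "y \<in> E"
    have "\<phi> (x / y) * \<phi> y = \<phi> x" using m[OF E(6)[OF xy] xy(2)] False by simp
    then show ?thesis using z[OF xy(2) False] by (simp add: field_simps)
  qed (simp add: 0)
  show "\<phi> (x ^ n) = \<phi> x ^ n" if "x \<in> E"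
    by (induction n) (simp_all add: 1 m[OF that E(9)[OF that]])
qed

lemma hom_on_inj:
  assumes "subfield_set E" "hom_on E \<phi>"
  shows "inj_on \<phi> E"
proof (rule inj_onI)
  fix x y assume xy: "x \<in> E" "y \<in> E" "\<phi> x = \<phi> y"
  then have "\<phi> (x - y) = 0" using hom_onD(4)[OF assms, of x y] by simp
  then have "x - y = 0" using hom_onD(9)[OF assms subfield_setD(4)[OF assms(1) xy(1,2)]] by blast
  then show "x = y" by simp
qed

lemma hom_on_sum:
  assumes "subfield_set E" "hom_on E \<phi>" "\<And>i. i \<in> A \<Longrightarrow> f i \<in> E"
  shows "\<phi> (sum f A) = (\<Sum>i\<in>A. \<phi> (f i))"
  using assms(3)
proof (induction A rule: infinite_finite_induct)
  case (insert x F)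
  then show ?case using hom_onD(3)[OF assms(1,2), of "f x" "sum f F"] subfield_sum[OF assms(1), of F f] by simp
qed (auto simp: hom_onD(1)[OF assms(1,2)])

lemma subfield_image:
  assumes "subfield_set E" "hom_on E \<phi>"
  shows "subfield_set (\<phi> ` E)"
  unfolding subfield_set_def
proof (intro conjI ballI)
  show "1 \<in> \<phi> ` E" using hom_onD(2)[OF assms] subfield_setD(2)[OF assms(1)] by (metis imageI)
next
  fix x y assume "x \<in> \<phi> ` E" "y \<in> \<phi> ` E"
  then obtain a b where ab: "a \<in> E" "b \<in> E" "x = \<phi> a" "y = \<phi> b" by blast
  show "x - y \<in> \<phi> ` E" "x * y \<in> \<phi> ` E" "x / y \<in> \<phi> ` E"
    using ab hom_onD(4-6)[OF assms ab(1,2)] subfield_setD(4-6)[OF assms(1) ab(1,2)] by (metis imageI)+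
qed

lemma hom_on_inv:
  assumes "subfield_set E" "hom_on E \<phi>"
  shows "hom_on (\<phi> ` E) (inv_into E \<phi>)"
proof -
  note E = subfield_setD[OF assms(1)] and h = hom_onD[OF assms] and i = inv_into_f_f[OF hom_on_inj[OF assms]]
  show ?thesis unfolding hom_on_def
  proof (intro conjI ballI)
    show "inv_into E \<phi> 1 = 1" using i[OF E(2)] h(2) by simp
  next
    fix x y assume "x \<in> \<phi> ` E" "y \<in> \<phi> ` E"
    then obtain a b where ab: "a \<in> E" "b \<in> E" "x = \<phi> a" "y = \<phi> b" by blast
    show "inv_into E \<phi> (x + y) = inv_into E \<phi> x + inv_into E \<phi> y"
      using h(3)[OF ab(1,2)] i[OF E(3)[OF ab(1,2)]] i[OF ab(1)] i[OF ab(2)] ab by simp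
    show "inv_into E \<phi> (x * y) = inv_into E \<phi> x * inv_into E \<phi> y"
      using h(5)[OF ab(1,2)] i[OF E(5)[OF ab(1,2)]] i[OF ab(1)] i[OF ab(2)] ab by simp
  qed
qed

lemma hom_on_comp: "hom_on E \<phi> \<Longrightarrow> hom_on (\<phi> ` E) \<psi> \<Longrightarrow> hom_on E (\<lambda>x. \<psi> (\<phi> x))"
  by (auto simp: hom_on_def)

definition polys_on :: "'b::field set \<Rightarrow> 'b poly set" where
  "polys_on E = {p. \<forall>i. coeff p i \<in> E}"

lemma polys_on_ops:
  assumes "subfield_set E"
  shows "p \<in> polys_on E \<Longrightarrow> q \<in> polys_on E \<Longrightarrow> p + q \<in> polys_on E"
    "p \<in> polys_on E \<Longrightarrow> q \<in> polys_on E \<Longrightarrow> p - q \<in> polys_on E"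
    "p \<in> polys_on E \<Longrightarrow> q \<in> polys_on E \<Longrightarrow> p * q \<in> polys_on E"
    "c \<in> E \<Longrightarrow> monom c n \<in> polys_on E" "c \<in> E \<Longrightarrow> [:c:] \<in> polys_on E" "0 \<in> polys_on E" "1 \<in> polys_on E"
  using subfield_setD[OF assms]
  by (auto simp: polys_on_def coeff_mult coeff_pCons split: nat.splits intro!: subfield_sum[OF assms])

text \<open>
  Quotient and remainder must again have coefficients in the subfield, which the division of
  polynomials over the whole type does not provide.
\<close>

lemma polys_on_division:
  assumes E: "subfield_set E" and p: "p \<in> polys_on E" and m: "m \<in> polys_on E" "m \<noteq> 0"
  shows "\<exists>q\<in>polys_on E. \<exists>r\<in>polys_on E. p = q * m + r \<and> (r = 0 \<or> degree r < degree m)"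
  using p
proof (induction "degree p" arbitrary: p rule: less_induct)
  case less
  note pe = polys_on_ops[OF E] and E' = subfield_setD[OF E]
  show ?case
  proof (cases "p = 0 \<or> degree p < degree m")
    case True
    then show ?thesis using less.prems pe(6) by (intro bexI[of _ 0] bexI[of _ p]) auto
  next
    case False
    define t where "t = monom (lead_coeff p / lead_coeff m) (degree p - degree m)"
    define p' where "p' = p - t * m"
    have tE: "t \<in> polys_on E" unfolding t_def using less.prems m E'(6) by (intro pe(4)) (auto simp: polys_on_def)
    have p'E: "p' \<in> polys_on E" unfolding p'_def using tE less.prems m pe by blast
    have c: "lead_coeff p / lead_coeff m \<noteq> 0" using False m by auto
    have t0: "t \<noteq> 0" using c by (simp add: t_def)
    have dt: "degree (t * m) = degree p" using False m t0 c
      by (simp add: degree_mult_eq t_def degree_monom_eq)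
    have lt: "lead_coeff (t * m) = lead_coeff p" 
      using m lead_coeff_monom[of "lead_coeff p / lead_coeff m" "degree p - degree m"]
      unfolding lead_coeff_mult t_def by simp
    have *: "p' = 0 \<or> degree p' < degree p"
    proof (cases "degree p = 0")
      case True
      then have "degree m = 0" using False by auto
      have "p' = 0" unfolding p'_def using True dt lt by (metis degree_0_id right_minus_eq)
      then show ?thesis by simp
    next
      case F: False
      have "degree p' \<le> degree p" unfolding p'_def using dt by (metis degree_diff_le order_refl)
      moreover have "coeff p' (degree p) = 0" unfolding p'_def using dt lt by simp
      ultimately show ?thesis using F by (metis leading_coeff_0_iff le_neq_implies_less)
    qed
    then obtain q r where qr: "q \<in> polys_on E" "r \<in> polys_on E" "p' = q * m + r" "r = 0 \<or> degree r < degree m"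
    proof
      assume "p' = 0" then show ?thesis using that[of 0 0] pe(6) by auto
    next
      assume "degree p' < degree p" then show ?thesis using less.hyps[OF _ p'E] that by blast
    qed
    have "p = (t + q) * m + r" using qr(3) unfolding p'_def by (simp add: algebra_simps)
    then show ?thesis using qr pe(1)[OF tE qr(1)] by blast
  qed
qed

lemma map_poly_hom_on:
  assumes E: "subfield_set E" and h: "hom_on E \<phi>" and p: "p \<in> polys_on E" and q: "q \<in> polys_on E"
  shows "map_poly \<phi> (p + q) = map_poly \<phi> p + map_poly \<phi> q"
    "map_poly \<phi> (p - q) = map_poly \<phi> p - map_poly \<phi> q"
    "map_poly \<phi> (p * q) = map_poly \<phi> p * map_poly \<phi> q"
proof -
  note hh = hom_onD[OF E h] and E' = subfield_setD[OF E]
  have pq: "coeff p i \<in> E" "coeff q i \<in> E" for i using p q by (auto simp: polys_on_def)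
  show "map_poly \<phi> (p + q) = map_poly \<phi> p + map_poly \<phi> q"
    "map_poly \<phi> (p - q) = map_poly \<phi> p - map_poly \<phi> q"
    by (rule poly_eqI; simp add: coeff_map_poly hh pq)+
  show "map_poly \<phi> (p * q) = map_poly \<phi> p * map_poly \<phi> q"
    by (rule poly_eqI) (simp add: coeff_map_poly hh coeff_mult hom_on_sum[OF E h] pq E')
qed

lemma map_poly_hom_on_degree:
  assumes E: "subfield_set E" and h: "hom_on E \<phi>" and p: "p \<in> polys_on E"
  shows "degree (map_poly \<phi> p) = degree p" "map_poly \<phi> p = 0 \<longleftrightarrow> p = 0"
proof -
  note hh = hom_onD[OF E h]
  have z: "\<phi> (coeff p i) = 0 \<longleftrightarrow> coeff p i = 0" for i using p hh(9) by (auto simp: polys_on_def)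
  show 1: "degree (map_poly \<phi> p) = degree p"
    using z[of "degree p"] by (cases "p = 0") (auto intro: map_poly_degree_eq)
  show "map_poly \<phi> p = 0 \<longleftrightarrow> p = 0"
    using z by (auto simp: poly_eq_iff coeff_map_poly hh(1))
qed

text \<open>
  The full number of roots stands for "splits into distinct linear factors": the other factor
  cannot absorb all of the roots.
\<close>

lemma factor_has_root:
  fixes p :: "'c::field poly"
  assumes "p \<noteq> 0" "card {z. poly p z = 0} = degree p" "p = m * q" "degree m > 0"
  shows "\<exists>z. poly m z = 0"
proof (rule ccontr)
  assume "\<nexists>z. poly m z = 0"
  then have "{z. poly p z = 0} = {z. poly q z = 0}" using assms(3) by auto
  moreover have "q \<noteq> 0" "m \<noteq> 0" using assms by auto
  moreover have "card {z. poly q z = 0} \<le> degree q" using \<open>q \<noteq> 0\<close> by (rule card_poly_roots_bound)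
  ultimately show False using assms by (simp add: degree_mult_eq)
qed

lemma minimal_poly_exists:
  assumes "\<exists>p. p \<noteq> 0 \<and> P (p :: 'b::field poly)"
  obtains m where "m \<noteq> 0" "P m" "\<And>p. p \<noteq> 0 \<Longrightarrow> P p \<Longrightarrow> degree m \<le> degree p"
proof -
  define d where "d = (LEAST d. \<exists>p. p \<noteq> 0 \<and> P p \<and> degree p = d)"
  have "\<exists>d. \<exists>p. p \<noteq> 0 \<and> P p \<and> degree p = d" using assms by blast
  then have "\<exists>p. p \<noteq> 0 \<and> P p \<and> degree p = d" unfolding d_def by (rule LeastI_ex)
  moreover have "p \<noteq> 0 \<Longrightarrow> P p \<Longrightarrow> d \<le> degree p" for p unfolding d_def by (rule Least_le) blast
  ultimately show ?thesis using that by blast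
qed

text \<open>
  Adjoining one root. With \<open>m\<close> the minimal polynomial of \<open>a\<close> and \<open>b\<close> a root of its image,
  the extension sends \<open>q(a)\<close> to the value at \<open>b\<close> of the image of \<open>q\<close>; such a root exists because
  \<open>m\<close> divides a polynomial whose image has all its roots.
\<close>

lemma hom_extend_root:
  fixes \<phi> :: "'b::field \<Rightarrow> 'c::field"
  assumes E: "subfield_set E" and h: "hom_on E \<phi>"
    and p: "p \<in> polys_on E" "p \<noteq> 0" "poly p a = 0"
    and full: "card {z. poly (map_poly \<phi> p) z = 0} = degree p"
  shows "\<exists>E' \<phi>'. subfield_set E' \<and> hom_on E' \<phi>' \<and> E \<subseteq> E' \<and> a \<in> E' \<and> (\<forall>x\<in>E. \<phi>' x = \<phi> x)"
proof -
  note pe = polys_on_ops[OF E] and E' = subfield_setD[OF E] and hh = hom_onD[OF E h]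
  note mp = map_poly_hom_on[OF E h]
  obtain m where m0: "m \<noteq> 0" and m1: "m \<in> polys_on E \<and> poly m a = 0"
    and mmin: "\<And>q. q \<noteq> 0 \<Longrightarrow> q \<in> polys_on E \<and> poly q a = 0 \<Longrightarrow> degree m \<le> degree q"
    using minimal_poly_exists[of "\<lambda>q. q \<in> polys_on E \<and> poly q a = 0"] p by blast
  have mE: "m \<in> polys_on E" and ma: "poly m a = 0" using m1 by auto
  have dvd: "\<exists>u\<in>polys_on E. q = u * m" if q: "q \<in> polys_on E" "poly q a = 0" for q
  proof -
    obtain u r where ur: "u \<in> polys_on E" "r \<in> polys_on E" "q = u * m + r" "r = 0 \<or> degree r < degree m"
      using polys_on_division[OF E q(1) mE m0] by blast
    have "poly r a = 0" using ur(3) q(2) ma by simp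
    then have "r = 0" using mmin[of r] ur(2,4) by (metis linorder_not_le)
    then show ?thesis using ur by auto
  qed
  have dm: "degree m > 0"
  proof (rule ccontr)
    assume "\<not> degree m > 0"
    then obtain c where "m = [:c:]" by (metis degree_eq_zeroE neq0_conv)
    then show False using ma m0 by simp
  qed
  obtain u where u: "u \<in> polys_on E" "p = m * u" using dvd[OF p(1,3)] by (auto simp: mult.commute)
  have "\<exists>b. poly (map_poly \<phi> m) b = 0"
  proof (rule factor_has_root)
    show "map_poly \<phi> p \<noteq> 0" using map_poly_hom_on_degree[OF E h p(1)] p(2) by simp
    show "card {z. poly (map_poly \<phi> p) z = 0} = degree (map_poly \<phi> p)"
      using map_poly_hom_on_degree[OF E h p(1)] full by simp
    show "map_poly \<phi> p = map_poly \<phi> m * map_poly \<phi> u" using u mp(3)[OF mE u(1)] by simp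
    show "degree (map_poly \<phi> m) > 0" using map_poly_hom_on_degree[OF E h mE] dm by simp
  qed
  then obtain b where b: "poly (map_poly \<phi> m) b = 0" by blast
  define L where "L = (\<lambda>q. poly q a) ` polys_on E"
  define \<psi> where "\<psi> y = poly (map_poly \<phi> (SOME q. q \<in> polys_on E \<and> poly q a = y)) b" for y
  have \<psi>: "\<psi> (poly q a) = poly (map_poly \<phi> q) b" if q: "q \<in> polys_on E" for q
  proof -
    define q' where "q' = (SOME r. r \<in> polys_on E \<and> poly r a = poly q a)"
    have q': "q' \<in> polys_on E" "poly q' a = poly q a"
      using someI[of "\<lambda>r. r \<in> polys_on E \<and> poly r a = poly q a" q] q unfolding q'_def by auto
    obtain v where v: "v \<in> polys_on E" "q' - q = v * m" using dvd[OF pe(2)[OF q'(1) q]] q' by auto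
    have "map_poly \<phi> q' - map_poly \<phi> q = map_poly \<phi> v * map_poly \<phi> m"
      using v mp(2)[OF q'(1) q] mp(3)[OF v(1) mE] by simp
    then have "poly (map_poly \<phi> q' - map_poly \<phi> q) b = 0" using b by simp
    then show ?thesis unfolding \<psi>_def q'_def[symmetric] by simp
  qed
  have inv: "\<exists>q\<in>polys_on E. poly q a = inverse (poly w a)" if w: "w \<in> polys_on E" "poly w a \<noteq> 0" for w
  proof -
    \<comment> \<open>The values of members of \<open>?I\<close> at \<open>a\<close> are multiples of \<open>poly w a\<close>; its generator \<open>g\<close> is constant.\<close>
    let ?I = "\<lambda>v. v \<in> polys_on E \<and> (\<exists>q\<in>polys_on E. poly v a = poly w a * poly q a)"
    have Iw: "?I w" using w pe(7) by (metis mult.right_neutral poly_1)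
    have Im: "?I m" using mE ma pe(6) by (metis mult_zero_right poly_0)
    obtain g where g0: "g \<noteq> 0" and g1: "?I g" and gmin: "\<And>v. v \<noteq> 0 \<Longrightarrow> ?I v \<Longrightarrow> degree g \<le> degree v"
      using minimal_poly_exists[of ?I] Im m0 by blast
    have gE: "g \<in> polys_on E" using g1 by blast
    have gd: "\<exists>k\<in>polys_on E. v = k * g" if v: "?I v" for v
    proof -
      obtain k r where kr: "k \<in> polys_on E" "r \<in> polys_on E" "v = k * g + r" "r = 0 \<or> degree r < degree g"
        using polys_on_division[OF E _ gE g0] v by blast
      obtain q1 q2 where q12: "q1 \<in> polys_on E" "q2 \<in> polys_on E" "poly v a = poly w a * poly q1 a"
        "poly g a = poly w a * poly q2 a" using v g1 by blast
      have "poly v a = poly k a * poly g a + poly r a" unfolding kr(3) by simp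
      then have "poly r a = poly w a * poly (q1 - k * q2) a"
        using q12 by (simp add: algebra_simps)
      then have "?I r" using kr pe(2)[OF q12(1) pe(3)[OF kr(1) q12(2)]] by blast
      then have "r = 0" using gmin[of r] kr(4) by (metis linorder_not_le)
      then show ?thesis using kr by auto
    qed
    obtain k where k: "k \<in> polys_on E" "m = k * g" using gd[OF Im] by blast
    have ga: "poly g a \<noteq> 0" using gd[OF Iw] w by auto
    then have ka: "poly k a = 0" using k(2) ma by auto
    have "k \<noteq> 0" using k m0 by auto
    then have "degree m \<le> degree k" using mmin[of k] k ka by auto
    then have "degree g = 0" using k(2) \<open>k \<noteq> 0\<close> g0 by (simp add: degree_mult_eq)
    then obtain c where c: "g = [:c:]" by (metis degree_eq_zeroE)
    then have cE: "c \<in> E" "c \<noteq> 0" using gE g0 by (auto simp: polys_on_def) (metis coeff_pCons_0)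
    obtain q where q: "q \<in> polys_on E" "poly g a = poly w a * poly q a" using g1 by blast
    then have "inverse (poly w a) = poly ([:inverse c:] * q) a" using c cE w(2) by (simp add: field_simps)
    then show ?thesis using pe(3)[OF pe(5)[OF E'(8)[OF cE(1)]] q(1)] by (intro bexI) auto
  qed
  have Lsub: "subfield_set L"
    unfolding subfield_set_def
  proof (intro conjI ballI)
    show "1 \<in> L" unfolding L_def using pe(7) by (metis imageI poly_1)
  next
    fix x y assume "x \<in> L" "y \<in> L"
    then obtain q r where qr: "q \<in> polys_on E" "r \<in> polys_on E" "x = poly q a" "y = poly r a"
      unfolding L_def by blast
    show "x - y \<in> L" using qr pe(2)[OF qr(1,2)] unfolding L_def by (metis imageI poly_diff)
    show "x * y \<in> L" using qr pe(3)[OF qr(1,2)] unfolding L_def by (metis imageI poly_mult)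
    show "x / y \<in> L"
    proof (cases "y = 0")
      case True
      then show ?thesis unfolding L_def using pe(6) by (metis div_by_0 imageI poly_0)
    next
      case False
      then obtain s where "s \<in> polys_on E" "poly s a = inverse y" using inv[OF qr(2)] qr by auto
      then show ?thesis unfolding L_def using pe(3)[OF qr(1)] qr(3) by (metis field_class.field_divide_inverse imageI poly_mult)
    qed
  qed
  have const: "x \<in> L \<and> \<psi> x = \<phi> x" if "x \<in> E" for x
    using \<psi>[OF pe(5)[OF that]] pe(5)[OF that] unfolding L_def
    by (auto simp: map_poly_pCons hh(1) intro!: image_eqI[of _ _ "[:x:]"])
  have "hom_on L \<psi>"
    unfolding hom_on_def
  proof (intro conjI ballI)
    show "\<psi> 1 = 1" using const[OF E'(2)] hh(2) by simp
  next
    fix x y assume "x \<in> L" "y \<in> L"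
    then obtain q r where qr: "q \<in> polys_on E" "r \<in> polys_on E" "x = poly q a" "y = poly r a"
      unfolding L_def by blast
    show "\<psi> (x + y) = \<psi> x + \<psi> y" 
      using \<psi>[OF qr(1)] \<psi>[OF qr(2)] \<psi>[OF pe(1)[OF qr(1,2)]] mp(1)[OF qr(1,2)] qr(3,4) by simp
    show "\<psi> (x * y) = \<psi> x * \<psi> y"
      using \<psi>[OF qr(1)] \<psi>[OF qr(2)] \<psi>[OF pe(3)[OF qr(1,2)]] mp(3)[OF qr(1,2)] qr(3,4) by simp
  qed
  moreover have "a \<in> L" unfolding L_def using pe(4)[OF E'(2), of 1]
    by (auto intro!: image_eqI[of _ _ "monom 1 1"] simp: poly_monom)
  ultimately show ?thesis using Lsub const by blast
qed

lemma hom_extend: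
  fixes \<phi> :: "'b::field \<Rightarrow> 'c::field"
  assumes E: "subfield_set E" and h: "hom_on E \<phi>" and "finite A"
    and "\<And>a. a \<in> A \<Longrightarrow> \<exists>p. p \<in> polys_on E \<and> p \<noteq> 0 \<and> poly p a = 0 \<and>
           card {z. poly (map_poly \<phi> p) z = 0} = degree p"
  shows "\<exists>E' \<phi>'. subfield_set E' \<and> hom_on E' \<phi>' \<and> E \<subseteq> E' \<and> A \<subseteq> E' \<and> (\<forall>x\<in>E. \<phi>' x = \<phi> x)"
  using assms(3,4)
proof (induction A rule: finite_induct)
  case empty
  then show ?case using E h by blast
next
  case (insert a A)
  then obtain E' \<phi>' where E': "subfield_set E'" "hom_on E' \<phi>'" "E \<subseteq> E'" "A \<subseteq> E'" "\<forall>x\<in>E. \<phi>' x = \<phi> x"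
    by (metis insert_iff)
  obtain p where p: "p \<in> polys_on E" "p \<noteq> 0" "poly p a = 0" "card {z. poly (map_poly \<phi> p) z = 0} = degree p"
    using insert.prems by blast
  have "map_poly \<phi>' p = map_poly \<phi> p"
    using p(1) E'(5) hom_onD(1)[OF E h] hom_onD(1)[OF E'(1,2)]
    by (intro poly_eqI) (auto simp: coeff_map_poly polys_on_def)
  moreover have "p \<in> polys_on E'" using p(1) E'(3) by (auto simp: polys_on_def)
  ultimately obtain E'' \<phi>'' where "subfield_set E''" "hom_on E'' \<phi>''" "E' \<subseteq> E''" "a \<in> E''" "\<forall>x\<in>E'. \<phi>'' x = \<phi>' x"
    using hom_extend_root[OF E'(1,2), of p a] p by auto
  then show ?case using E' by (intro exI[of _ E''] exI[of _ \<phi>'']) auto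
qed

section \<open>Eleven points over the field with three elements\<close>

text \<open>
  The prime field as an enumeration with \<open>Z\<close>, \<open>P\<close>, \<open>N\<close> for 0, 1, -1: sums of signed points are
  computed many thousand times below, and a table keeps each of them short.
\<close>

datatype f3 = Z | P | N

instantiation f3 :: ab_group_add
begin
definition zero_f3 :: f3 where [code]: "0 = Z"
fun uminus_f3 :: "f3 \<Rightarrow> f3" where "- Z = Z" | "- P = N" | "- N = P"
fun plus_f3 :: "f3 \<Rightarrow> f3 \<Rightarrow> f3" where
  "Z + y = y" | "P + Z = P" | "P + P = N" | "P + N = Z" | "N + Z = N" | "N + P = Z" | "N + N = P"
definition minus_f3 :: "f3 \<Rightarrow> f3 \<Rightarrow> f3" where [code]: "x - y = x + - (y :: f3)"
instance
proof
  fix a b c :: f3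
  show "a + b + c = a + (b + c)" by (cases a; cases b; cases c) simp_all
  show "a + b = b + a" by (cases a; cases b) simp_all
  show "0 + a = a" by (simp add: zero_f3_def)
  show "- a + a = 0" by (cases a) (simp_all add: zero_f3_def)
  show "a - b = a + - b" by (simp add: minus_f3_def)
qed
end

type_synonym vec = "f3 \<times> f3 \<times> f3 \<times> f3 \<times> f3"

text \<open>
  The point with label \<open>i\<close> is the residue of \<open>X ^ i\<close> modulo \<open>X ^ 5 + X ^ 4 - X ^ 3 + X ^ 2 - 1\<close>, a divisor
  of \<open>X ^ 11 - 1\<close>, written in the basis \<open>1, X, ..., X ^ 4\<close>. Its linear relations are the words of the
  ternary Golay code of length 11.
\<close>

definition points :: "vec list" where
  "points = [
   (Z, P, Z, Z, Z), (Z, Z, P, Z, Z), (Z, Z, Z, P, Z), (Z, Z, Z, Z, P),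
   (P, Z, N, P, N), (N, P, P, P, N), (N, N, N, Z, N), (N, N, Z, P, P),
   (P, N, P, P, Z), (Z, P, N, P, P), (P, Z, Z, Z, Z)]"

definition pt :: "nat \<Rightarrow> vec" where "pt i = points ! (i - 1)"

text \<open>
  The 66 blocks of the Steiner system \<open>S(4, 5, 11)\<close>: the supports of the Golay code words of
  weight five.
\<close>

definition block_list :: "nat list list" where
  "block_list = [
   [1, 2, 3, 4, 10], [1, 2, 3, 5, 8], [1, 2, 3, 6, 7], [1, 2, 3, 9, 11], [1, 2, 4, 5, 9], [1, 2, 4, 6, 8],
   [1, 2, 4, 7, 11], [1, 2, 5, 6, 11], [1, 2, 5, 7, 10], [1, 2, 6, 9, 10], [1, 2, 7, 8, 9], [1, 2, 8, 10, 11],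
   [1, 3, 4, 5, 6], [1, 3, 4, 7, 9], [1, 3, 4, 8, 11], [1, 3, 5, 7, 11], [1, 3, 5, 9, 10], [1, 3, 6, 8, 9],
   [1, 3, 6, 10, 11], [1, 3, 7, 8, 10], [1, 4, 5, 7, 8], [1, 4, 5, 10, 11], [1, 4, 6, 7, 10], [1, 4, 6, 9, 11],
   [1, 4, 8, 9, 10], [1, 5, 6, 7, 9], [1, 5, 6, 8, 10], [1, 5, 8, 9, 11], [1, 6, 7, 8, 11], [1, 7, 9, 10, 11],
   [2, 3, 4, 5, 11], [2, 3, 4, 6, 9], [2, 3, 4, 7, 8], [2, 3, 5, 6, 10], [2, 3, 5, 7, 9], [2, 3, 6, 8, 11],
   [2, 3, 7, 10, 11], [2, 3, 8, 9, 10], [2, 4, 5, 6, 7], [2, 4, 5, 8, 10], [2, 4, 6, 10, 11], [2, 4, 7, 9, 10],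
   [2, 4, 8, 9, 11], [2, 5, 6, 8, 9], [2, 5, 7, 8, 11], [2, 5, 9, 10, 11], [2, 6, 7, 8, 10], [2, 6, 7, 9, 11],
   [3, 4, 5, 7, 10], [3, 4, 5, 8, 9], [3, 4, 6, 7, 11], [3, 4, 6, 8, 10], [3, 4, 9, 10, 11], [3, 5, 6, 7, 8],
   [3, 5, 6, 9, 11], [3, 5, 8, 10, 11], [3, 6, 7, 9, 10], [3, 7, 8, 9, 11], [4, 5, 6, 8, 11], [4, 5, 6, 9, 10],
   [4, 5, 7, 9, 11], [4, 6, 7, 8, 9], [4, 7, 8, 10, 11], [5, 6, 7, 10, 11], [5, 7, 8, 9, 10], [6, 8, 9, 10, 11]]"

text \<open>
  Only relations with all coefficients nonzero matter, so that a relation is a choice of signs.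
\<close>

definition signed_sum :: "(nat \<Rightarrow> bool) \<Rightarrow> nat set \<Rightarrow> vec" where
  "signed_sum s T = (\<Sum>i\<in>T. if s i then pt i else - pt i)"

definition dependent :: "nat set \<Rightarrow> bool" where
  "dependent T \<longleftrightarrow> (\<exists>s. signed_sum s T = 0)"

fun zero_sum :: "vec list \<Rightarrow> vec \<Rightarrow> bool" where
  "zero_sum [] a \<longleftrightarrow> a = 0"
| "zero_sum (v # vs) a \<longleftrightarrow> zero_sum vs (a + v) \<or> zero_sum vs (a - v)"

text \<open>
  A search through all signed sums of \<open>k\<close> points, starting from \<open>a\<close>; it lists the supports of those
  that reach 0.
\<close>

fun zero_sums :: "nat \<Rightarrow> (nat \<times> vec) list \<Rightarrow> vec \<Rightarrow> nat list list" where
  "zero_sums 0 xs a = (if a = 0 then [[]] else [])"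
| "zero_sums (Suc k) [] a = []"
| "zero_sums (Suc k) ((i, v) # xs) a =
     map ((#) i) (zero_sums k xs (a + v) @ zero_sums k xs (a - v)) @ zero_sums (Suc k) xs a"

lemma zero_sums_block_list:
  "list_all (\<lambda>B. B \<in> set block_list) (zero_sums 5 (zip [1, 2, 3, 4, 5, 6, 7, 8, 9, 10, 11] points) 0)"
  by code_simp

lemma block_list_zero_sum: "list_all (\<lambda>B. zero_sum (map pt B) 0) block_list"
  by code_simp

lemma block_list_wf:
  "list_all (\<lambda>B. sorted B \<and> distinct B \<and> length B = 5 \<and> hd B \<ge> 1 \<and> last B \<le> 11) block_list"
  by code_simp

text \<open>
  Permutations of \<open>{1..11}\<close> as lists of values: the two generators of the Mathieu group.
\<close>

definition rot :: "nat list" where "rot = [2, 3, 4, 5, 6, 7, 8, 9, 10, 11, 1]"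
definition gen2 :: "nat list" where "gen2 = [1, 2, 7, 10, 6, 4, 11, 3, 9, 5, 8]"

lemma rot_blocks: "list_all (\<lambda>B. zero_sum (map (\<lambda>i. pt (rot ! (i - 1))) B) 0) block_list"
  by code_simp
lemma gen2_blocks: "list_all (\<lambda>B. zero_sum (map (\<lambda>i. pt (gen2 ! (i - 1))) B) 0) block_list"
  by code_simp

text \<open>
  Multiplication by a non-residue modulo 11 moves some block to an independent set: the Golay
  code is a quadratic residue code.
\<close>

lemma mult_blocks: 
  "list_all (\<lambda>k. list_all (\<lambda>B. zero_sum (map (\<lambda>i. pt ((k * i - 1) mod 11 + 1)) B) 0) block_list \<longrightarrow> k \<in> set [1, 3, 4, 5, 9]) [1..<11]"
  by code_simp

text \<open>
  The argument \<open>p\<close> is an initial segment of the list of values of a permutation. Only the blocks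
  with largest element \<open>length p\<close> are tested, as the others were tested for shorter segments
  or are not yet mapped completely.
\<close>

definition consistent :: "nat list \<Rightarrow> bool" where
  "consistent p \<longleftrightarrow> list_all (\<lambda>B. last B = length p \<longrightarrow> zero_sum (map (\<lambda>i. pt (p ! (i - 1))) B) 0) block_list"

fun extensions :: "nat \<Rightarrow> nat list \<Rightarrow> nat list list" where
  "extensions 0 p = [p]"
| "extensions (Suc n) p =
     concat (map (\<lambda>x. if x \<notin> set p \<and> consistent (p @ [x]) then extensions n (p @ [x]) else []) [1..<12])"

text \<open>
  The combinatorial heart of sharp 4-transitivity, by exhaustive search.
\<close>

lemma extensions_1234: "extensions 7 [1, 2, 3, 4] = [[1, 2, 3, 4, 5, 6, 7, 8, 9, 10, 11]]"
  by code_simp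

section \<open>Permutations of the points that preserve dependence\<close>

lemma signed_sum_upd: "x \<notin> T \<Longrightarrow> signed_sum (s(x := b)) T = signed_sum s T"
  unfolding signed_sum_def by (rule sum.cong) auto

lemma zero_sum_iff:
  "distinct xs \<Longrightarrow> zero_sum (map pt xs) a \<longleftrightarrow> (\<exists>s. a + signed_sum s (set xs) = 0)"
proof (induction xs arbitrary: a)
  case Nil
  then show ?case by (simp add: signed_sum_def)
next
  case (Cons x xs)
  have eq: "signed_sum s (set (x # xs)) = (if s x then pt x else - pt x) + signed_sum s (set xs)" for s
    using Cons.prems by (simp add: signed_sum_def)
  show ?case
  proof
    assume "zero_sum (map pt (x # xs)) a"
    then obtain b where "zero_sum (map pt xs) (a + (if b then pt x else - pt x))"
      using that[of True] that[of False] by (auto simp: if_splits)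
    then obtain s where "a + (if b then pt x else - pt x) + signed_sum s (set xs) = 0"
      using Cons by auto
    then have "a + signed_sum (s(x := b)) (set (x # xs)) = 0"
      using Cons.prems unfolding eq by (simp add: signed_sum_upd add.assoc)
    then show "\<exists>s. a + signed_sum s (set (x # xs)) = 0" by blast
  next
    assume "\<exists>s. a + signed_sum s (set (x # xs)) = 0"
    then obtain s where "a + (if s x then pt x else - pt x) + signed_sum s (set xs) = 0"
      unfolding eq by (auto simp: add.assoc)
    then have "zero_sum (map pt xs) (a + (if s x then pt x else - pt x))"
      using Cons by auto
    then show "zero_sum (map pt (x # xs)) a" by (auto split: if_splits)
  qed
qed

lemma dependent_iff_zero_sum: "distinct xs \<Longrightarrow> dependent (set xs) \<longleftrightarrow> zero_sum (map pt xs) 0"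
  by (simp add: zero_sum_iff dependent_def)

lemma zero_sums_complete:
  "subseq ys is \<Longrightarrow> zero_sum (map pt ys) a \<Longrightarrow> ys \<in> set (zero_sums (length ys) (map (\<lambda>i. (i, pt i)) is) a)"
proof (induction "is" arbitrary: ys a)
  case Nil
  then show ?case by (cases ys) auto
next
  case (Cons i "is")
  show ?case
  proof (cases ys)
    case Nil
    then show ?thesis using Cons.prems by simp
  next
    case (Cons j zs)
    show ?thesis
    proof (cases "subseq ys is")
      case True
      then show ?thesis using Cons.IH[OF True Cons.prems(2)] Cons by simp
    next
      case False
      then have j: "j = i" "subseq zs is" using Cons.prems(1) Cons by (auto simp: subseq_Cons2_iff split: if_splits)
      have "zero_sum (map pt zs) (a + pt i) \<or> zero_sum (map pt zs) (a - pt i)"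
        using Cons.prems(2) Cons j by simp
      then show ?thesis
        using Cons.IH[OF j(2), of "a + pt i"] Cons.IH[OF j(2), of "a - pt i"] Cons j(1) by auto
    qed
  qed
qed

text \<open>
  Completeness of the list of blocks, so that a statement about all dependent 5-sets can be
  checked on 66 lists.
\<close>

lemma dependent_block:
  assumes T: "T \<subseteq> {1..11}" "card T = 5" "dependent T"
  shows "\<exists>B\<in>set block_list. set B = T"
proof -
  define ys where "ys = filter (\<lambda>i. i \<in> T) [1..<12]"
  have ys: "set ys = T" "distinct ys" using T by (auto simp: ys_def)
  then have len: "length ys = 5" using T by (metis distinct_card)
  have "subseq ys [1..<12]" unfolding ys_def by (rule subseq_filter_left)
  moreover have "zero_sum (map pt ys) 0" using dependent_iff_zero_sum[OF ys(2)] ys(1) T by simp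
  ultimately have "ys \<in> set (zero_sums (length ys) (map (\<lambda>i. (i, pt i)) [1..<12]) 0)"
    by (rule zero_sums_complete)
  moreover have "map (\<lambda>i. (i, pt i)) [1..<12] = zip [1, 2, 3, 4, 5, 6, 7, 8, 9, 10, 11] points"
    by (simp add: pt_def points_def upt_rec)
  ultimately show ?thesis using zero_sums_block_list len ys(1) by (auto simp: list_all_iff)
qed

lemma block_dependent: 
  assumes "B \<in> set block_list"
  shows "set B \<subseteq> {1..11}" "card (set B) = 5" "dependent (set B)" "distinct B" "i \<in> set B \<Longrightarrow> i \<le> last B"
proof -
  have w: "sorted B" "distinct B" "length B = 5" "hd B \<ge> 1" "last B \<le> 11"
    using block_list_wf assms by (auto simp: list_all_iff)
  obtain a b c d e where B: "B = [a, b, c, d, e]"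
    using w(3) by (auto simp: numeral_eq_Suc length_Suc_conv)
  show "set B \<subseteq> {1..11}" "i \<in> set B \<Longrightarrow> i \<le> last B" using w unfolding B by auto
  show "card (set B) = 5" "distinct B" using w distinct_card[OF w(2)] by auto
  show "dependent (set B)" using block_list_zero_sum assms dependent_iff_zero_sum[OF w(2)]
    by (auto simp: list_all_iff)
qed

text \<open>
  This turns out to be the Mathieu group. Dependence of sets forgets signs, which is what
  makes it accessible: the Galois group permutes square roots of the roots only up to sign.
\<close>

definition aut :: "(nat \<Rightarrow> nat) set" where
  "aut = {p. p permutes {1..11} \<and> (\<forall>T\<subseteq>{1..11}. card T = 5 \<longrightarrow> dependent T \<longrightarrow> dependent (p ` T))}"

lemma autI_blocks:
  assumes "p permutes {1..11}" "list_all (\<lambda>B. zero_sum (map (\<lambda>i. pt (p i)) B) 0) block_list"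
  shows "p \<in> aut"
  unfolding aut_def
proof (clarify, intro conjI allI impI assms(1))
  fix T :: "nat set" assume "T \<subseteq> {1..11}" "card T = 5" "dependent T"
  then obtain B where B: "B \<in> set block_list" "set B = T" using dependent_block by blast
  have "zero_sum (map pt (map p B)) 0" using assms(2) B by (auto simp: list_all_iff comp_def)
  moreover have "distinct (map p B)"
    using block_dependent[OF B(1)] permutes_inj_on[OF assms(1)] by (simp add: distinct_map)
  ultimately show "dependent (p ` T)" using dependent_iff_zero_sum[of "map p B"] B(2) by simp
qed

lemma aut_blocks:
  assumes "p \<in> aut" "B \<in> set block_list"
  shows "zero_sum (map (\<lambda>i. pt (p i)) B) 0"
proof -
  have p: "p permutes {1..11}" using assms by (simp add: aut_def)
  have "distinct (map p B)"
    using block_dependent[OF assms(2)] permutes_inj_on[OF p] by (simp add: distinct_map)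
  moreover have "dependent (set (map p B))" using assms(1) block_dependent(1-3)[OF assms(2)] by (simp add: aut_def)
  ultimately show ?thesis using dependent_iff_zero_sum[of "map p B"] by (simp add: comp_def)
qed

lemma aut_comp:
  assumes "p \<in> aut" "q \<in> aut" shows "p \<circ> q \<in> aut"
  unfolding aut_def
proof (clarify, intro conjI allI impI)
  have pq: "p permutes {1..11}" "q permutes {1..11}" using assms by (auto simp: aut_def)
  show "p \<circ> q permutes {1..11}" using permutes_compose[OF pq(2,1)] .
  fix T :: "nat set" assume T: "T \<subseteq> {1..11}" "card T = 5" "dependent T"
  have "q ` T \<subseteq> {1..11}" using T(1) permutes_image[OF pq(2)] by blast
  moreover have "card (q ` T) = 5" using T(2) permutes_inj_on[OF pq(2)] by (simp add: card_image)
  moreover have "dependent (q ` T)" using assms(2) T by (simp add: aut_def)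
  ultimately have "dependent (p ` q ` T)" using assms(1) by (simp add: aut_def)
  then show "dependent ((p \<circ> q) ` T)" by (simp add: image_comp)
qed

text \<open>
  A permutation that maps the finitely many dependent 5-sets to such sets permutes them.
\<close>

lemma aut_inv:
  assumes "p \<in> aut" shows "inv' p \<in> aut"
  unfolding aut_def
proof (clarify, intro conjI allI impI)
  have p: "p permutes {1..11}" using assms by (auto simp: aut_def)
  show "inv' p permutes {1..11}" using permutes_inv[OF p] .
  define F where "F = {T. T \<subseteq> {1..11} \<and> card T = 5 \<and> dependent T}"
  have fin: "finite F" unfolding F_def by (rule finite_subset[of _ "Pow {1..11}"]) auto
  have sub: "image p ` F \<subseteq> F"
  proof
    fix U assume "U \<in> image p ` F"
    then obtain T where T: "T \<in> F" "U = p ` T" by blast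
    have "U \<subseteq> {1..11}" using T permutes_image[OF p] by (auto simp: F_def)
    moreover have "card U = 5" using T permutes_inj_on[OF p] by (simp add: F_def card_image)
    moreover have "dependent U" using assms T by (simp add: F_def aut_def)
    ultimately show "U \<in> F" by (simp add: F_def)
  qed
  have inj: "inj_on (image p) F"
    by (rule inj_onI) (simp add: inj_image_eq_iff[OF permutes_inj[OF p]])
  have "image p ` F = F" using endo_inj_surj[OF fin sub inj] .
  fix T :: "nat set" assume T: "T \<subseteq> {1..11}" "card T = 5" "dependent T"
  then have "T \<in> image p ` F" using \<open>image p ` F = F\<close> by (simp add: F_def)
  then obtain S where S: "S \<in> F" "T = p ` S" by blast
  then have "inv' p ` T = S" using permutes_inj[OF p] by (simp add: image_inv_f_f)
  then show "dependent (inv' p ` T)" using S(1) by (simp add: F_def)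
qed

lemma extensions_complete:
  assumes "p \<in> aut"
  shows "k + n = 11 \<Longrightarrow> map p [1..<Suc 11] \<in> set (extensions n (map p [1..<Suc k]))"
proof (induction n arbitrary: k)
  case 0
  then show ?case by simp
next
  case (Suc n)
  have p: "p permutes {1..11}" using assms by (simp add: aut_def)
  define x where "x = p (Suc k)"
  have xs: "map p [1..<Suc k] @ [x] = map p [1..<Suc (Suc k)]" by (simp add: x_def)
  have "x \<in> {1..11}" unfolding x_def using Suc.prems permutes_in_image[OF p, of "Suc k"] by auto
  moreover have "x \<notin> set (map p [1..<Suc k])" unfolding x_def using permutes_inj[OF p] by (auto simp: inj_eq)
  moreover have "consistent (map p [1..<Suc (Suc k)])"
    unfolding consistent_def list_all_iff
  proof (intro ballI impI)
    fix B assume B: "B \<in> set block_list" "last B = length (map p [1..<Suc (Suc k)])"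
    have eq: "map (\<lambda>i. pt (map p [1..<Suc (Suc k)] ! (i - 1))) B = map (\<lambda>i. pt (p i)) B"
    proof (rule map_cong[OF refl])
      fix i assume "i \<in> set B"
      then have "1 \<le> i" "i \<le> Suc k" using block_dependent(1,5)[OF B(1)] B(2) by (auto simp del: upt_Suc)
      then show "pt (map p [1..<Suc (Suc k)] ! (i - 1)) = pt (p i)" by (simp del: upt_Suc)
    qed
    show "zero_sum (map (\<lambda>i. pt (map p [1..<Suc (Suc k)] ! (i - 1))) B) 0"
      unfolding eq by (rule aut_blocks[OF assms B(1)])
  qed
  moreover have "map p [1..<Suc 11] \<in> set (extensions n (map p [1..<Suc (Suc k)]))"
    using Suc.IH[of "Suc k"] Suc.prems by simp
  ultimately show ?case unfolding extensions.simps xs[symmetric]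
    by (auto intro!: bexI[of _ x] simp del: upt_Suc map_append)
qed

lemma permutes_eqI_on:
  assumes "p permutes S" "q permutes S" "\<And>x. x \<in> S \<Longrightarrow> p x = q x" shows "p = q"
  using assms by (metis ext permutes_not_in)

lemma map_eq_selfD: "map p xs = xs \<Longrightarrow> x \<in> set xs \<Longrightarrow> p x = x"
  by (induction xs) auto

lemma aut_fix4:
  assumes "p \<in> aut" "map p [1..<5] = [1..<5]"
  shows "p = id"
proof (rule permutes_eqI_on)
  show "p permutes {1..11}" using assms by (simp add: aut_def)
  have *: "[1..<5] = [1, 2, 3, 4::nat]" by (simp add: upt_rec)
  have "map p [1..<Suc 11] \<in> set (extensions 7 (map p [1..<Suc 4]))"
    by (rule extensions_complete[OF assms(1)]) simp
  moreover have "map p [1..<Suc 4] = [1, 2, 3, 4]" using assms(2) * by simp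
  ultimately have "map p [1..<Suc 11] \<in> set [[1, 2, 3, 4, 5, 6, 7, 8, 9, 10, 11]]"
    by (simp only: extensions_1234)
  then have "map p [1..<Suc 11] = [1, 2, 3, 4, 5, 6, 7, 8, 9, 10, 11]" by simp
  also have "\<dots> = [1..<Suc 11]" by (simp add: upt_rec)
  finally show "p x = id x" if "x \<in> {1..11}" for x
    using map_eq_selfD[of p "[1..<Suc 11]" x] that by (simp del: upt_Suc)
qed (rule permutes_id)

section \<open>The Mathieu group acts sharply 4-transitively\<close>

definition perm_of :: "nat list \<Rightarrow> nat \<Rightarrow> nat" where
  "perm_of p i = (if 1 \<le> i \<and> i \<le> 11 then p ! (i - 1) else i)"

definition wf_list :: "nat list \<Rightarrow> bool" where "wf_list p \<longleftrightarrow> length p = 11 \<and> set p = {1..11}"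
definition mul :: "nat list \<Rightarrow> nat list \<Rightarrow> nat list" where "mul p q = map (\<lambda>i. p ! (i - 1)) q"

lemma wf_listD: "wf_list p \<Longrightarrow> length p = 11" "wf_list p \<Longrightarrow> set p = {1..11}" "wf_list p \<Longrightarrow> distinct p"
  by (auto simp: wf_list_def intro: card_distinct)

lemma perm_of_permutes:
  assumes "wf_list p"
  shows "perm_of p permutes {1..11}"
proof (rule bij_imp_permutes)
  note w = wf_listD[OF assms]
  have "inj_on (perm_of p) {1..11}"
    using w by (auto simp: inj_on_def perm_of_def nth_eq_iff_index_eq)
  moreover have "perm_of p ` {1..11} \<subseteq> {1..11}"
  proof (clarify)
    fix i :: nat assume "i \<in> {1..11}"
    then have "perm_of p i \<in> set p" using w(1) by (auto simp: perm_of_def)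
    then show "perm_of p i \<in> {1..11}" using w by simp
  qed
  ultimately show "bij_betw (perm_of p) {1..11} {1..11}"
    by (metis bij_betw_def endo_inj_surj finite_atLeastAtMost)
qed (auto simp: perm_of_def)

lemma perm_of_mul:
  assumes "wf_list p" "wf_list q"
  shows "perm_of (mul p q) = perm_of p \<circ> perm_of q" "wf_list (mul p q)"
proof -
  have r: "q ! (i - 1) \<in> {1..11}" if "1 \<le> i" "i \<le> 11" for i
  proof -
    have "q ! (i - 1) \<in> set q" using that wf_listD(1)[OF assms(2)] by (intro nth_mem) simp
    then show ?thesis using wf_listD(2)[OF assms(2)] by simp
  qed
  then show eq: "perm_of (mul p q) = perm_of p \<circ> perm_of q"
    using wf_listD(1)[OF assms(2)] by (auto simp: fun_eq_iff perm_of_def mul_def)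
  have "(\<lambda>i. p ! (i - 1)) ` {1..11} = perm_of p ` {1..11}" by (intro image_cong) (auto simp: perm_of_def)
  then show "wf_list (mul p q)"
    using assms permutes_image[OF perm_of_permutes[OF assms(1)]] by (auto simp: wf_list_def mul_def)
qed

abbreviation cyc :: "nat \<Rightarrow> nat" where "cyc \<equiv> perm_of rot"

lemma atLeastAtMost_11: "{1..11} = {1, 2, 3, 4, 5, 6, 7, 8, 9, 10, 11 :: nat}"
proof -
  have "{1..11} = set [1..<12 :: nat]" by auto
  also have "\<dots> = {1, 2, 3, 4, 5, 6, 7, 8, 9, 10, 11}" by (simp add: upt_rec eval_nat_numeral)
  finally show ?thesis .
qed

lemma wf_rot: "wf_list rot" and wf_gen2: "wf_list gen2"
  unfolding wf_list_def atLeastAtMost_11 by (auto simp: rot_def gen2_def)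

lemma generators_eq:
  "cycle_of_list [1, 2, 3, 4, 5, 6, 7, 8, 9, 10, 11] = cyc"
  "cycle_of_list [3, 7, 11, 8] \<circ> cycle_of_list [4, 10, 5, 6] = perm_of gen2"
proof -
  have 1: "cycle_of_list cs permutes {1..11}" if "set cs \<subseteq> {1..11}" for cs :: "nat list"
    using permutes_subset[OF cycle_permutes that] .
  have rotate: "map (cycle_of_list cs) cs = rotate 1 cs" if "distinct cs" for cs :: "nat list"
    using cyclic_rotation[of cs 1] that by simp
  show "cycle_of_list [1, 2, 3, 4, 5, 6, 7, 8, 9, 10, 11] = cyc"
  proof (rule permutes_eqI_on[OF 1 perm_of_permutes[OF wf_rot]])
    fix x :: nat assume "x \<in> {1..11}"
    moreover define cs where "cs = [1, 2, 3, 4, 5, 6, 7, 8, 9, 10, 11 :: nat]"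
    ultimately have "x \<in> set cs" unfolding atLeastAtMost_11 by simp
    moreover have "map (cycle_of_list cs) cs = map cyc cs"
      by (subst rotate) (simp_all add: perm_of_def rot_def cs_def)
    ultimately show "cycle_of_list [1, 2, 3, 4, 5, 6, 7, 8, 9, 10, 11] x = cyc x"
      unfolding map_eq_conv cs_def[symmetric] by blast
  qed auto
  have p: "cycle_of_list [3, 7, 11, 8] \<circ> cycle_of_list [4, 10, 5, 6] permutes {1..11 :: nat}"
    by (intro permutes_compose 1) auto
  show "cycle_of_list [3, 7, 11, 8] \<circ> cycle_of_list [4, 10, 5, 6] = perm_of gen2"
  proof (rule permutes_eqI_on[OF p perm_of_permutes[OF wf_gen2]])
    define f g where "f = cycle_of_list [3, 7, 11, 8 :: nat]" and "g = cycle_of_list [4, 10, 5, 6 :: nat]"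
    have f: "f x = x" if "x \<notin> {3, 7, 11, 8}" for x using that unfolding f_def by (intro id_outside_supp) auto
    have g: "g x = x" if "x \<notin> {4, 10, 5, 6}" for x using that unfolding g_def by (intro id_outside_supp) auto
    have "map f [3, 7, 11, 8] = [7, 11, 8, 3]" "map g [4, 10, 5, 6] = [10, 5, 6, 4]"
      using rotate[of "[3, 7, 11, 8]"] rotate[of "[4, 10, 5, 6]"] unfolding f_def g_def by simp_all
    then show "(cycle_of_list [3, 7, 11, 8] \<circ> cycle_of_list [4, 10, 5, 6]) x = perm_of gen2 x" if "x \<in> {1..11}" for x
      using that unfolding f_def[symmetric] g_def[symmetric] atLeastAtMost_11
      by (elim insertE) (simp_all add: f g perm_of_def gen2_def)
  qed
qed

lemma M11_eq: "M11 = generate (sym_group 11) {cyc, perm_of gen2}"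
  unfolding M11_def generators_eq ..

lemma M11_subgroup: "subgroup M11 (sym_group 11)"
  unfolding M11_eq
  using perm_of_permutes[OF wf_rot] perm_of_permutes[OF wf_gen2]
  by (intro group.generate_is_subgroup[OF sym_group_is_group]) (auto simp: sym_group_carrier)

lemma M11_closed:
  shows "p \<in> M11 \<Longrightarrow> p permutes {1..11}" "p \<in> M11 \<Longrightarrow> q \<in> M11 \<Longrightarrow> p \<circ> q \<in> M11" "id \<in> M11"
    "p \<in> M11 \<Longrightarrow> inv' p \<in> M11" "cyc \<in> M11" "perm_of gen2 \<in> M11"
proof -
  note S = M11_subgroup
  show p: "p \<in> M11 \<Longrightarrow> p permutes {1..11}" for p
    using subgroup.mem_carrier[OF S] by (simp add: sym_group_carrier)
  show "p \<in> M11 \<Longrightarrow> q \<in> M11 \<Longrightarrow> p \<circ> q \<in> M11"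
    using subgroup.m_closed[OF S] by (simp add: sym_group_mult)
  show "id \<in> M11" using subgroup.one_closed[OF S] by (simp add: sym_group_one)
  show "p \<in> M11 \<Longrightarrow> inv' p \<in> M11"
    using subgroup.m_inv_closed[OF S] sym_group_inv_equality p sym_group_carrier by metis
  show "cyc \<in> M11" "perm_of gen2 \<in> M11" unfolding M11_eq by (auto intro: generate.incl)
qed

lemma aut_generators: "cyc \<in> aut" "perm_of gen2 \<in> aut"
proof -
  have *: "perm_of p \<in> aut"
    if "wf_list p" "list_all (\<lambda>B. zero_sum (map (\<lambda>i. pt (p ! (i - 1))) B) 0) block_list" for p
  proof (rule autI_blocks[OF perm_of_permutes[OF that(1)]])
    have "map (\<lambda>i. pt (perm_of p i)) B = map (\<lambda>i. pt (p ! (i - 1))) B" if "B \<in> set block_list" for B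
      using block_dependent(1)[OF that] by (auto simp: perm_of_def)
    then show "list_all (\<lambda>B. zero_sum (map (\<lambda>i. pt (perm_of p i)) B) 0) block_list"
      using that(2) unfolding list_all_iff by metis
  qed
  show "cyc \<in> aut" "perm_of gen2 \<in> aut" using *[OF wf_rot rot_blocks] *[OF wf_gen2 gen2_blocks] .
qed

lemma M11_subset_aut: "M11 \<subseteq> aut"
proof
  fix p assume "p \<in> M11"
  then show "p \<in> aut" unfolding M11_eq
  proof (induction rule: generate.induct)
    case one
    have "id permutes {1..11::nat}" by (rule permutes_id)
    then show ?case by (simp add: sym_group_one aut_def id_def)
  next
    case (incl h)
    then show ?case using aut_generators by auto
  next
    case (inv h)
    then have "h \<in> aut" using aut_generators by auto
    moreover from this have "h \<in> carrier (sym_group 11)" by (simp add: aut_def sym_group_carrier)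
    ultimately show ?case using aut_inv sym_group_inv_equality by metis
  next
    case (eng h1 h2)
    then show ?case using aut_comp unfolding sym_group_mult by blast
  qed
qed

lemma word_M11:
  "set ws \<subseteq> {rot, gen2} \<Longrightarrow> wf_list (foldr mul ws [1..<12]) \<and> perm_of (foldr mul ws [1..<12]) \<in> M11"
proof (induction ws)
  case Nil
  have "perm_of [1..<12] = id" by (auto simp: perm_of_def fun_eq_iff)
  moreover have "wf_list [1..<12]" by (auto simp: wf_list_def)
  ultimately show ?case using M11_closed(3) by (simp add: id_def)
next
  case (Cons w ws)
  then have "wf_list w" "perm_of w \<in> M11" using wf_rot wf_gen2 M11_closed(5,6) by auto
  moreover have "wf_list (foldr mul ws [1..<12])" "perm_of (foldr mul ws [1..<12]) \<in> M11"
    using Cons by auto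
  ultimately show ?case unfolding foldr_Cons comp_apply
    using perm_of_mul[of w "foldr mul ws [1..<12]"] M11_closed(2) by metis
qed

text \<open>
  The orbit of \<open>k + 1\<close> under the pointwise stabiliser of \<open>1, ..., k\<close>.
\<close>

definition stab_images :: "nat \<Rightarrow> nat set" where
  "stab_images k = {p (Suc k) | p. p \<in> M11 \<and> map p [1..<Suc k] = [1..<Suc k]}"

lemma stab_images_step:
  assumes ws: "set ws \<subseteq> {rot, gen2}" "take k (foldr mul ws [1..<12]) = [1..<Suc k]" and k: "k < 11"
    and y: "y \<in> stab_images k"
  shows "foldr mul ws [1..<12] ! (y - 1) \<in> stab_images k"
proof -
  define s where "s = foldr mul ws [1..<12]"
  have s: "wf_list s" "perm_of s \<in> M11" using word_M11[OF ws(1)] by (auto simp: s_def)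
  obtain p where p: "p \<in> M11" "map p [1..<Suc k] = [1..<Suc k]" "y = p (Suc k)"
    using y by (auto simp: stab_images_def)
  have sfix: "perm_of s i = i" if "i \<in> {1..k}" for i
  proof -
    have "s ! (i - 1) = take k s ! (i - 1)"
      by (rule nth_take[symmetric]) (use that in auto)
    also have "\<dots> = i" unfolding s_def ws(2) using that by (simp del: upt_Suc)
    finally show ?thesis by (auto simp: perm_of_def)
  qed
  have pfix: "p i = i" if "i \<in> {1..k}" for i
    using map_eq_selfD[OF p(2), of i] that by (simp del: upt_Suc)
  have "map (perm_of s \<circ> p) [1..<Suc k] = [1..<Suc k]"
    by (rule map_idI) (use sfix pfix in \<open>auto simp del: upt_Suc\<close>)
  moreover have "y \<in> {1..11}" using permutes_in_image[OF M11_closed(1)[OF p(1)], of "Suc k"] k p(3) by auto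
  ultimately show ?thesis using M11_closed(2)[OF s(2) p(1)] p(3) unfolding stab_images_def s_def[symmetric]
    by (intro CollectI exI[of _ "perm_of s \<circ> p"]) (auto simp: perm_of_def)
qed

fun reach :: "nat \<Rightarrow> nat list list \<Rightarrow> nat list \<Rightarrow> nat list" where
  "reach 0 gens ys = ys"
| "reach (Suc n) gens ys = reach n gens (remdups (ys @ concat (map (\<lambda>s. map (\<lambda>y. s ! (y - 1)) ys) gens)))"

text \<open>
  Generators of large enough parts of the stabilisers: for each \<open>k < 4\<close>, words in \<open>rot\<close> and \<open>gen2\<close>
  that fix \<open>1, ..., k\<close> and together move \<open>k + 1\<close> to all remaining points.
\<close>

definition words :: "nat \<Rightarrow> nat list list list" where
  "words k = [[[rot]], [[gen2], [rot, gen2, gen2, rot, rot]],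
     [[gen2], [rot, gen2, rot, rot, rot, rot, rot, gen2, rot]],
     [[gen2, gen2, rot, gen2, rot, rot, rot, rot, rot, gen2, rot],
      [gen2, rot, rot, gen2, gen2, rot, gen2, rot, rot, rot, gen2, rot, rot]]] ! k"

lemma words_reach:
  "list_all (\<lambda>k. list_all (\<lambda>ws. list_all (\<lambda>w. w = rot \<or> w = gen2) ws \<and> take k (foldr mul ws [1..<12]) = [1..<Suc k]) (words k)
     \<and> list_all (\<lambda>y. y \<in> set (reach 10 (map (\<lambda>ws. foldr mul ws [1..<12]) (words k)) [Suc k])) [Suc k..<12]) [0..<4]"
  by code_simp

lemma stab_images_full:
  assumes k: "k < 4"
  shows "{Suc k..11} \<subseteq> stab_images k"
proof
  fix y assume y: "y \<in> {Suc k..11}"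
  have *: "set (reach n (map (\<lambda>ws. foldr mul ws [1..<12]) W) ys) \<subseteq> stab_images k"
    if "set ys \<subseteq> stab_images k" "\<forall>ws\<in>set W. set ws \<subseteq> {rot, gen2} \<and> take k (foldr mul ws [1..<12]) = [1..<Suc k]" for n W ys
    using that(1)
  proof (induction n arbitrary: ys)
    case 0
    then show ?case by simp
  next
    case (Suc n)
    show ?case unfolding reach.simps
    proof (rule Suc.IH)
      show "set (remdups (ys @ concat (map (\<lambda>s. map (\<lambda>y. s ! (y - 1)) ys) (map (\<lambda>ws. foldr mul ws [1..<12]) W)))) \<subseteq> stab_images k"
        using Suc.prems that(2) k stab_images_step[of _ k] by (auto simp del: upt_Suc)
    qed
  qed
  have "list_all (\<lambda>ws. list_all (\<lambda>w. w = rot \<or> w = gen2) ws \<and> take k (foldr mul ws [1..<12]) = [1..<Suc k]) (words k)"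
    and r: "list_all (\<lambda>y. y \<in> set (reach 10 (map (\<lambda>ws. foldr mul ws [1..<12]) (words k)) [Suc k])) [Suc k..<12]"
    using words_reach k by (auto simp: list_all_iff simp del: upt_Suc)
  then have w: "\<forall>ws\<in>set (words k). set ws \<subseteq> {rot, gen2} \<and> take k (foldr mul ws [1..<12]) = [1..<Suc k]"
    by (auto simp: list_all_iff simp del: upt_Suc)
  have "Suc k \<in> stab_images k" unfolding stab_images_def using M11_closed(3) by (intro CollectI exI[of _ id]) simp
  then have "set (reach 10 (map (\<lambda>ws. foldr mul ws [1..<12]) (words k)) [Suc k]) \<subseteq> stab_images k"
    using w by (intro *) auto
  moreover have "y \<in> set (reach 10 (map (\<lambda>ws. foldr mul ws [1..<12]) (words k)) [Suc k])"
    using r y by (auto simp: list_all_iff simp del: upt_Suc)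
  ultimately show "y \<in> stab_images k" by blast
qed

lemma M11_transitive:
  "k \<le> 4 \<Longrightarrow> length ys = k \<Longrightarrow> distinct ys \<Longrightarrow> set ys \<subseteq> {1..11} \<Longrightarrow> \<exists>m\<in>M11. map m [1..<Suc k] = ys"
proof (induction k arbitrary: ys)
  case 0
  then show ?case using M11_closed(3) by auto
next
  case (Suc k)
  obtain zs y where ys: "ys = zs @ [y]" using Suc.prems(2) by (cases ys rule: rev_cases) auto
  then obtain m where m: "m \<in> M11" "map m [1..<Suc k] = zs" using Suc.IH[of zs] Suc.prems by auto
  have mp: "m permutes {1..11}" using M11_closed(1)[OF m(1)] .
  define z where "z = inv' m y"
  have mz: "m z = y" unfolding z_def using permutes_inverses[OF mp] by simp
  have z1: "z \<in> {1..11}" using permutes_in_image[OF mp, of z] mz Suc.prems(4) ys by auto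
  have "z \<notin> {1..k}"
  proof
    assume "z \<in> {1..k}"
    then have "m z \<in> set (map m [1..<Suc k])" by (auto simp del: upt_Suc)
    then show False using mz m(2) Suc.prems(3) ys by auto
  qed
  then have "z \<in> {Suc k..11}" using z1 by auto
  then have "z \<in> stab_images k" using stab_images_full[of k] Suc.prems(1) by auto
  then obtain p where p: "p \<in> M11" "map p [1..<Suc k] = [1..<Suc k]" "z = p (Suc k)"
    by (auto simp: stab_images_def)
  have "map (m \<circ> p) [1..<Suc k] = zs" using p(2) m(2) by (metis map_map)
  then have "map (m \<circ> p) [1..<Suc (Suc k)] = ys" using p(3) mz ys by simp
  then show ?case using M11_closed(2)[OF m(1) p(1)] by blast
qed

lemma aut_eq_if_agree:
  assumes "p \<in> aut" "q \<in> aut" "map p [1..<5] = map q [1..<5]"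
  shows "p = q"
proof -
  have q: "q permutes {1..11}" using assms by (simp add: aut_def)
  have "map (inv' q \<circ> p) [1..<5] = map (inv' q) (map q [1..<5])" using assms(3) by (metis map_map)
  also have "\<dots> = map (\<lambda>x. inv' q (q x)) [1..<5]" by (simp add: comp_def)
  also have "\<dots> = [1..<5]" unfolding permutes_inverses(2)[OF q] by simp
  finally have "inv' q \<circ> p = id" using aut_fix4 aut_comp aut_inv assms by blast
  then have "q \<circ> (inv' q \<circ> p) = q" by simp
  then show ?thesis using permutes_inv_o[OF q] by (metis comp_assoc id_comp)
qed

text \<open>
  A permutation preserving dependence agrees with some element of the 4-transitive Mathieu group
  on the first four points, and then everywhere.
\<close>

lemma aut_eq_M11: "aut = M11"
proof
  show "aut \<subseteq> M11"
  proof
    fix p assume p: "p \<in> aut"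
    then have pp: "p permutes {1..11}" by (simp add: aut_def)
    have "distinct (map p [1..<Suc 4])" unfolding distinct_map using permutes_inj_on[OF pp] distinct_upt by blast
    moreover have "set (map p [1..<Suc 4]) \<subseteq> {1..11}"
    proof
      fix x assume "x \<in> set (map p [1..<Suc 4])"
      then obtain i where "i \<in> set [1..<Suc 4]" "x = p i" unfolding set_map by blast
      moreover from this have "i \<in> {1..11}" by auto
      ultimately show "x \<in> {1..11}" using permutes_in_image[OF pp, of i] by blast
    qed
    moreover have "length (map p [1..<Suc 4]) = 4" by simp
    ultimately obtain m where m: "m \<in> M11" "map m [1..<Suc 4] = map p [1..<Suc 4]"
      using M11_transitive[OF order_refl] by blast
    have "Suc 4 = 5" by simp
    then have "map p [1..<5] = map m [1..<5]" using m(2) by metis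
    then have "p = m" using aut_eq_if_agree[OF p] m(1) M11_subset_aut by blast
    then show "p \<in> M11" using m by simp
  qed
qed (rule M11_subset_aut)

lemma card_M11: "card M11 = 7920"
proof -
  let ?X = "{ys :: nat list. length ys = 4 \<and> distinct ys \<and> set ys \<subseteq> {1..11}}"
  have "bij_betw (\<lambda>m. map m [1..<5]) M11 ?X"
    unfolding bij_betw_def
  proof
    show "inj_on (\<lambda>m. map m [1..<5]) M11"
      using aut_eq_if_agree aut_eq_M11 by (auto intro!: inj_onI)
    show "(\<lambda>m. map m [1..<5]) ` M11 = ?X"
    proof
      show "(\<lambda>m. map m [1..<5]) ` M11 \<subseteq> ?X"
      proof (clarify, intro conjI)
        fix m assume m: "m \<in> M11"
        note mp = M11_closed(1)[OF m]
        show "length (map m [1..<5]) = 4" by simp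
        show "distinct (map m [1..<5])" unfolding distinct_map using permutes_inj_on[OF mp] distinct_upt by blast
        show "set (map m [1..<5]) \<subseteq> {1..11}"
        proof
          fix x assume "x \<in> set (map m [1..<5])"
          then obtain i where "i \<in> set [1..<5]" "x = m i" unfolding set_map by blast
          moreover from this have "i \<in> {1..11}" by auto
          ultimately show "x \<in> {1..11}" using permutes_in_image[OF mp, of i] by blast
        qed
      qed
      show "?X \<subseteq> (\<lambda>m. map m [1..<5]) ` M11"
      proof
        fix ys assume "ys \<in> ?X"
        then obtain m where m: "m \<in> M11" "map m [1..<Suc 4] = ys" using M11_transitive[OF order_refl] by blast
        moreover have "Suc 4 = 5" by simp
        ultimately show "ys \<in> (\<lambda>m. map m [1..<5]) ` M11" by (metis imageI)
      qed
    qed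
  qed
  then have "card M11 = card ?X" by (rule bij_betw_same_card)
  also have "\<dots> = \<Prod>{11 - 4 + 1..11}" using card_lists_distinct_length_eq[of "{1..11::nat}" 4] by simp
  also have "{11 - 4 + 1..11} = {8, 9, 10, 11 :: nat}" by auto
  also have "\<Prod>{8, 9, 10, 11 :: nat} = 7920" by simp
  finally show ?thesis .
qed

section \<open>Subgroups of the Mathieu group containing the 11-cycle\<close>

text \<open>
  Orbits of a map of prime order \<open>p\<close> have 1 or \<open>p\<close> elements; an orbit of the second kind is removed
  in each step of the induction.
\<close>

lemma card_fixed_points_mod_prime:
  fixes f :: "'a \<Rightarrow> 'a" and p :: nat
  assumes p: "normalization_semidom_class.prime p"
  shows "finite S \<Longrightarrow> f ` S \<subseteq> S \<Longrightarrow> (\<And>x. x \<in> S \<Longrightarrow> (f ^^ p) x = x) \<Longrightarrow>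
    card S mod p = card {x \<in> S. f x = x} mod p"
proof (induction "card S" arbitrary: S rule: less_induct)
  case less
  have p0: "p > 0" using p prime_gt_0_nat by blast
  show ?case
  proof (cases "\<forall>x\<in>S. f x = x")
    case True
    then have "{x \<in> S. f x = x} = S" by auto
    then show ?thesis by simp
  next
    case False
    then obtain x where x: "x \<in> S" "f x \<noteq> x" by blast
    have fn: "(f ^^ n) y \<in> S" if "y \<in> S" for n y using that less.prems(2) by (induction n) auto
    have mult: "(f ^^ (p * a + b)) y = (f ^^ b) y" if y: "y \<in> S" for a b y
    proof (induction a)
      case (Suc a)
      have "(f ^^ (p * Suc a + b)) y = (f ^^ (p * a + b)) ((f ^^ p) y)"
        by (simp add: funpow_add[symmetric, unfolded comp_def fun_eq_iff, rule_format] algebra_simps)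
      then show ?case using Suc less.prems(3)[OF y] by simp
    qed simp
    have dmult: "(f ^^ (d * a)) x = x" if "(f ^^ d) x = x" for a d
      by (induction a) (simp_all add: funpow_add that)
    have noper: "(f ^^ d) x \<noteq> x" if "0 < d" "d < p" for d
    proof
      assume d: "(f ^^ d) x = x"
      have "\<not> p dvd d" using that nat_dvd_not_less by blast
      then have "coprime d p" using prime_imp_coprime[OF p] coprime_commute by blast
      then have g: "gcd d p = 1" by simp
      have "\<exists>a b. d * a = p * b + gcd d p" by (rule bezout_nat) (use that in simp)
      then obtain a b where "d * a = p * b + 1" unfolding g by blast
      then have "(f ^^ 1) x = (f ^^ (d * a)) x" using mult[OF x(1), of b 1] by simp
      then show False using dmult[OF d] x(2) by simp
    qed
    \<comment> \<open>The orbit that is removed.\<close>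
    define C where "C = (\<lambda>k. (f ^^ k) x) ` {..<p}"
    have inj: "inj_on (\<lambda>k. (f ^^ k) x) {..<p}"
    proof (rule linorder_inj_onI')
      fix i j assume ij: "i \<in> {..<p}" "j \<in> {..<p}" "i < j"
      show "(f ^^ i) x \<noteq> (f ^^ j) x"
      proof
        assume eq: "(f ^^ i) x = (f ^^ j) x"
        have "(f ^^ (p - j + i)) x = (f ^^ (p - j)) ((f ^^ j) x)" using eq by (simp add: funpow_add)
        also have "\<dots> = (f ^^ (p - j + j)) x" by (simp only: funpow_add comp_apply)
        also have "\<dots> = x" using ij less.prems(3)[OF x(1)] by simp
        finally have "(f ^^ (p - j + i)) x = x" .
        moreover have "0 < p - j + i" "p - j + i < p" using ij by auto
        ultimately show False using noper[of "p - j + i"] by simp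
      qed
    qed
    have cO: "card C = p" unfolding C_def using card_image[OF inj] by simp
    have OS: "C \<subseteq> S" using fn x(1) by (auto simp: C_def)
    have Onofix: "f y \<noteq> y" if "y \<in> C" for y
    proof
      assume fy: "f y = y"
      obtain k where k: "k < p" "y = (f ^^ k) x" using \<open>y \<in> C\<close> by (auto simp: C_def)
      have "(f ^^ n) y = y" for n using fy by (induction n) auto
      then have "y = (f ^^ (p - k)) y" by simp
      also have "\<dots> = (f ^^ (p - k + k)) x" unfolding k(2) by (simp only: funpow_add comp_apply)
      also have "\<dots> = x" using k(1) less.prems(3)[OF x(1)] by simp
      finally show False using fy x(2) by simp
    qed
    have mem_if: "y \<in> C" if "f y \<in> C" "y \<in> S" for y
    proof -
      obtain k where k: "k < p" "f y = (f ^^ k) x" using \<open>f y \<in> C\<close> by (auto simp: C_def)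
      have "y = (f ^^ (p - 1 + 1)) y" using less.prems(3)[OF that(2)] p0 by simp
      also have "\<dots> = (f ^^ (p - 1)) (f y)" by (simp only: funpow_add comp_apply) simp
      also have "\<dots> = (f ^^ (p - 1 + k)) x" unfolding k(2) by (simp only: funpow_add comp_apply)
      also have "\<dots> = (f ^^ ((p - 1 + k) mod p)) x"
        using mult[OF x(1), of "(p - 1 + k) div p" "(p - 1 + k) mod p"] by simp
      finally show ?thesis using p0 by (auto simp: C_def)
    qed
    have finO: "finite C" using OS less.prems(1) finite_subset by blast
    have cS: "card S = card (S - C) + p" using cO OS finO less.prems(1)
      by (metis card_Diff_subset card_mono le_add_diff_inverse2)
    have "card (S - C) mod p = card {x \<in> S - C. f x = x} mod p"
    proof (rule less.hyps)
      show "card (S - C) < card S" using cS p0 by simp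
      show "f ` (S - C) \<subseteq> S - C" using mem_if less.prems(2) by auto
    qed (use less.prems in auto)
    moreover have "{x \<in> S - C. f x = x} = {x \<in> S. f x = x}" using Onofix by auto
    ultimately show ?thesis unfolding cS by simp
  qed
qed

lemma cyc_permutes: "cyc permutes {1..11}"
  by (rule perm_of_permutes[OF wf_rot])

text \<open>Residues modulo 11 have representatives in \<open>{1..11}\<close>, where 11 stands for 0.\<close>

definition res :: "nat \<Rightarrow> nat" where "res n = (n + 10) mod 11 + 1"

lemma res_range [simp]: "res n \<in> {1..11}"
proof -
  have "(n + 10) mod 11 < 11" by simp
  then show ?thesis unfolding res_def by auto
qed

lemma res_mod: "res n mod 11 = n mod 11"
proof -
  have "res n mod 11 = (n + 10 + 1) mod 11" unfolding res_def by (rule mod_add_left_eq)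
  also have "\<dots> = (n + 11) mod 11" by (simp add: add.assoc)
  finally show ?thesis by simp
qed

lemma res_eq_iff: "res m = res n \<longleftrightarrow> m mod 11 = n mod 11"
proof
  assume "m mod 11 = n mod 11"
  then show "res m = res n" unfolding res_def by (metis mod_add_left_eq)
qed (metis res_mod)

lemma res_id: "i \<in> {1..11} \<Longrightarrow> res i = i"
  unfolding atLeastAtMost_11 by (elim insertE) (simp_all add: res_def)

lemma res_eq_iff': "i \<in> {1..11} \<Longrightarrow> res n = i \<longleftrightarrow> n mod 11 = i mod 11"
  using res_eq_iff[of n i] res_id[of i] by simp

lemma res_add: "res (res m + n) = res (m + n)" and res_mult: "res (k * res m) = res (k * m)"
  unfolding res_eq_iff by (metis mod_add_left_eq res_mod, metis mod_mult_right_eq res_mod)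

lemma cyc_apply: "i \<in> {1..11} \<Longrightarrow> cyc i = res (i + 1)"
  unfolding atLeastAtMost_11 by (elim insertE) (simp_all add: perm_of_def rot_def res_def)

lemma cyc_pow: "i \<in> {1..11} \<Longrightarrow> (cyc ^^ n) i = res (i + n)"
proof (induction n)
  case 0
  then show ?case using res_id by simp
next
  case (Suc n)
  then have "(cyc ^^ Suc n) i = res (res (i + n) + 1)" using cyc_apply[OF res_range] by simp
  then show ?case using res_add[of "i + n" 1] by simp
qed

lemma cyc_pow_permutes: "(cyc ^^ n) permutes {1..11}"
proof (induction n)
  case 0
  show ?case using permutes_id[of "{1..11::nat}"] by (simp add: id_def)
next
  case (Suc n)
  then show ?case unfolding funpow.simps(2) by (rule permutes_compose[OF _ cyc_permutes])
qed

lemma cyc_pow_11_mult: "(cyc ^^ (11 * n)) = id"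
proof (rule permutes_eqI_on[OF cyc_pow_permutes permutes_id])
  fix x :: nat assume x: "x \<in> {1..11}"
  have "res (x + 11 * n) = res x" unfolding res_eq_iff by simp
  then show "(cyc ^^ (11 * n)) x = id x" using cyc_pow[OF x] res_id[OF x] by simp
qed

text \<open>
  Multiplication by \<open>k\<close> modulo 11. The normaliser in the symmetric group of the group generated by
  the 11-cycle consists of the maps \<open>x \<mapsto> k * x + b\<close>.
\<close>

definition mult_perm :: "nat \<Rightarrow> nat \<Rightarrow> nat" where
  "mult_perm k i = (if i \<in> {1..11} then res (k * i) else i)"

lemma mult_perm_aut:
  assumes "mult_perm k \<in> aut" "k \<in> {1..10}"
  shows "k \<in> {1, 3, 4, 5, 9}"
proof -
  have "list_all (\<lambda>B. zero_sum (map (\<lambda>i. pt ((k * i - 1) mod 11 + 1)) B) 0) block_list"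
    unfolding list_all_iff
  proof
    fix B assume B: "B \<in> set block_list"
    have "map (\<lambda>i. pt ((k * i - 1) mod 11 + 1)) B = map (\<lambda>i. pt (mult_perm k i)) B"
    proof (rule map_cong[OF refl])
      fix i assume "i \<in> set B"
      then have i: "i \<in> {1..11}" using block_dependent(1)[OF B] by blast
      then have "k * i \<ge> 1" using assms(2) by simp
      then have "k * i + 10 = k * i - 1 + 11" by simp
      then have "res (k * i) = (k * i - 1) mod 11 + 1" unfolding res_def by (metis mod_add_self2)
      then show "pt ((k * i - 1) mod 11 + 1) = pt (mult_perm k i)" using i by (simp add: mult_perm_def)
    qed
    then show "zero_sum (map (\<lambda>i. pt ((k * i - 1) mod 11 + 1)) B) 0"
      using aut_blocks[OF assms(1) B] by metis
  qed
  moreover have "k \<in> set [1..<11]" using assms(2) by auto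
  ultimately have "k \<in> set [1, 3, 4, 5, 9]" using mult_blocks unfolding list_all_iff by blast
  then show ?thesis by simp
qed

lemma mult_perm_comp: "mult_perm k \<circ> mult_perm l = mult_perm (k * l mod 11)"
proof
  fix i
  have "res (k * res (l * i)) = res (k * l mod 11 * i)"
    unfolding res_mult res_eq_iff by (simp add: mod_mult_left_eq mult.assoc)
  then show "(mult_perm k \<circ> mult_perm l) i = mult_perm (k * l mod 11) i"
    using res_range[of "l * i"] by (auto simp: mult_perm_def simp del: res_range)
qed

lemma mult_perm_fixes_11: "mult_perm k 11 = 11"
  by (simp add: mult_perm_def res_def mod_add_left_eq[symmetric, of "k * 11"])

lemma inj_mult_perm: "inj_on mult_perm {1..10}"
proof (rule inj_onI)
  fix k l assume kl: "k \<in> {1..10}" "l \<in> {1..10}" "mult_perm k = mult_perm l"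
  then have "mult_perm k 1 = mult_perm l 1" by simp
  then show "k = l" using kl(1,2) by (simp add: mult_perm_def res_eq_iff)
qed

lemma neg_inverse_mod_11: 
  assumes "e \<in> {1..10}" shows "\<exists>k\<in>{1..10}. e * (11 - k) mod 11 = (1::nat)"
proof -
  have "list_all (\<lambda>e. list_ex (\<lambda>k. e * (11 - k) mod 11 = (1::nat)) [1..<11]) [1..<11]" by code_simp
  moreover have "set [1..<11] = {1..10}" by auto
  ultimately show ?thesis using assms unfolding list_all_iff list_ex_iff by blast
qed

text \<open>
  The argument is Sylow's count of cosets. Let \<open>C\<close> be the subgroup of order 11 generated by the
  11-cycle. Its action on the cosets \<open>G / C\<close> has as many fixed points as its normaliser has
  cosets, so \<open>|G| / 11\<close> is congruent modulo 11 to the number of multipliers \<open>k\<close> contained in \<open>G\<close>. This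
  number is 1 or 5, and together with \<open>40\<close> dividing \<open>|G| / 11\<close>, a divisor of 720, it leaves 720 only.
\<close>

context
  fixes G :: "(nat \<Rightarrow> nat) set"
  assumes G_sub: "G \<subseteq> M11" and G_id: "id \<in> G" and G_comp: "\<And>p q. p \<in> G \<Longrightarrow> q \<in> G \<Longrightarrow> p \<circ> q \<in> G"
    and G_cyc: "cyc \<in> G"
begin

lemma G_permutes: "p \<in> G \<Longrightarrow> p permutes {1..11}"
  using G_sub M11_closed(1) by blast

lemma G_finite: "finite G"
  using G_sub card_M11 by (metis card.infinite finite_subset zero_neq_numeral)

lemma G_cyc_pow: "cyc ^^ n \<in> G"
proof (induction n)
  case 0
  then show ?case using G_id by (simp add: id_def)
next
  case (Suc n)
  then show ?case unfolding funpow.simps(2) using G_comp G_cyc by blast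
qed

lemma G_inv:
  assumes p: "p \<in> G"
  shows "inv' p \<in> G"
proof -
  have "inj_on ((\<circ>) p) G"
    using permutes_inj[OF G_permutes[OF p]] by (auto intro!: inj_onI dest: inj_compose simp: fun.inj_map_strong fun_eq_iff inj_eq)
  then have "(\<circ>) p ` G = G" using endo_inj_surj[OF G_finite] G_comp[OF p] by blast
  then obtain q where q: "q \<in> G" "id = p \<circ> q" using G_id by blast
  have "inv' p = inv' p \<circ> (p \<circ> q)" using q(2) by simp
  also have "\<dots> = q" using permutes_inv_o(2)[OF G_permutes[OF p]] by (simp add: comp_assoc[symmetric])
  finally show ?thesis using q(1) by simp
qed

lemma G_subgroup: "subgroup G (sym_group 11)"
proof (rule group.subgroupI[OF sym_group_is_group])
  show "G \<subseteq> carrier (sym_group 11)" using G_permutes by (auto simp: sym_group_carrier)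
  show "G \<noteq> {}" using G_id by blast
  show "inv\<^bsub>sym_group 11\<^esub> a \<in> G" if "a \<in> G" for a
    using that G_inv sym_group_inv_equality G_permutes sym_group_carrier by metis
  show "a \<otimes>\<^bsub>sym_group 11\<^esub> b \<in> G" if "a \<in> G" "b \<in> G" for a b
    using that G_comp by (simp only: sym_group_mult)
qed

lemma G_card_dvd: "card G dvd 7920"
proof -
  have "subgroup G (sym_group 11\<lparr>carrier := M11\<rparr>)"
    by (rule group.subgroup_incl[OF sym_group_is_group G_subgroup M11_subgroup G_sub])
  then have "card (rcosets\<^bsub>sym_group 11\<lparr>carrier := M11\<rparr>\<^esub> G) * card G = Coset.order (sym_group 11\<lparr>carrier := M11\<rparr>)"
    using group.lagrange subgroup.subgroup_is_group[OF M11_subgroup sym_group_is_group] by blast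
  then have "card (rcosets\<^bsub>sym_group 11\<lparr>carrier := M11\<rparr>\<^esub> G) * card G = 7920"
    by (simp add: Coset.order_def card_M11)
  then show ?thesis by (metis dvd_triv_right)
qed

definition G0 :: "(nat \<Rightarrow> nat) set" where "G0 = {x \<in> G. x 11 = 11}"

lemma G_card: "card G = 11 * card G0"
proof -
  have "bij_betw (\<lambda>(n, x). (cyc ^^ n) \<circ> x) ({..<11} \<times> G0) G"
    unfolding bij_betw_def
  proof
    show "inj_on (\<lambda>(n, x). (cyc ^^ n) \<circ> x) ({..<11} \<times> G0)"
    proof (rule inj_onI)
      fix u v assume uv: "u \<in> {..<11} \<times> G0" "v \<in> {..<11} \<times> G0"
        "(case u of (n, x) \<Rightarrow> (cyc ^^ n) \<circ> x) = (case v of (n, x) \<Rightarrow> (cyc ^^ n) \<circ> x)"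
      obtain n x m y where u: "u = (n, x)" and v: "v = (m, y)" by (cases u; cases v)
      have *: "n \<in> {..<11::nat}" "x \<in> G0" "m \<in> {..<11::nat}" "y \<in> G0" "(cyc ^^ n) \<circ> x = (cyc ^^ m) \<circ> y"
        using uv unfolding u v by simp_all
      then have "(cyc ^^ n) 11 = (cyc ^^ m) 11" by (metis (mono_tags, lifting) G0_def comp_apply mem_Collect_eq)
      then have "n mod 11 = m mod 11" by (simp add: cyc_pow res_eq_iff)
      then have nm: "n = m" using * by simp
      have "x a = y a" for a
        using fun_cong[OF *(5), of a] permutes_inj[OF cyc_pow_permutes[of n]] nm by (simp add: inj_eq)
      then show "u = v" using nm unfolding u v by auto
    qed
    show "(\<lambda>(n, x). (cyc ^^ n) \<circ> x) ` ({..<11} \<times> G0) = G"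
    proof
      show "(\<lambda>(n, x). (cyc ^^ n) \<circ> x) ` ({..<11} \<times> G0) \<subseteq> G"
        using G_comp G_cyc_pow by (auto simp: G0_def simp del: comp_apply)
      show "G \<subseteq> (\<lambda>(n, x). (cyc ^^ n) \<circ> x) ` ({..<11} \<times> G0)"
      proof
        fix g assume g: "g \<in> G"
        define n where "n = g 11 mod 11"
        define x where "x = (cyc ^^ (11 - n)) \<circ> g"
        have n: "n < 11" by (simp add: n_def)
        have g11: "g 11 \<in> {1..11}" using permutes_in_image[OF G_permutes[OF g], of 11] by simp
        have "x 11 = res (g 11 + (11 - n))" unfolding x_def using cyc_pow[OF g11] by simp
        also have "\<dots> = res 11" unfolding res_eq_iff n_def using mod_less_divisor[of 11 "g 11"] by presburger
        finally have "x 11 = 11" by (simp add: res_def)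
        then have "x \<in> G0" unfolding G0_def x_def using G_comp[OF G_cyc_pow g] by blast
        moreover have "(cyc ^^ n) \<circ> x = g"
        proof -
          have "(cyc ^^ n) \<circ> x = (cyc ^^ (11 * 1)) \<circ> g"
            unfolding x_def comp_assoc[symmetric] funpow_add[symmetric] using n by simp
          then show ?thesis unfolding cyc_pow_11_mult by simp
        qed
        ultimately show "g \<in> (\<lambda>(n, x). (cyc ^^ n) \<circ> x) ` ({..<11} \<times> G0)" using n by force
      qed
    qed
  qed
  then have "card G = card ({..<11::nat} \<times> G0)" by (rule bij_betw_same_card[symmetric])
  then show ?thesis unfolding card_cartesian_product by simp
qed

text \<open>
  Every coset \<open>x C\<close> has a unique representative fixing 11, so that \<open>G0\<close> stands for \<open>G / C\<close>. In these
  terms left multiplication by the cycle becomes \<open>turn\<close>: the power on the right restores the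
  fixed point 11.
\<close>

definition turn :: "(nat \<Rightarrow> nat) \<Rightarrow> nat \<Rightarrow> nat" where
  "turn x = cyc \<circ> x \<circ> (cyc ^^ (inv' x 10))"

lemma turn_G0:
  assumes x: "x \<in> G0"
  shows "turn x \<in> G0"
proof -
  have xG: "x \<in> G" "x permutes {1..11}" using x G_permutes by (auto simp: G0_def)
  have b: "inv' x 10 \<in> {1..11}" using permutes_in_image[OF permutes_inv[OF xG(2)], of 10] by simp
  have "(cyc ^^ (inv' x 10)) 11 = res (inv' x 10)" unfolding cyc_pow[of 11, simplified] res_eq_iff by simp
  then have "(cyc ^^ (inv' x 10)) 11 = inv' x 10" using res_id[OF b] by simp
  then have "turn x 11 = cyc 10" unfolding turn_def using permutes_inverses[OF xG(2)] by simp
  then have "turn x 11 = 11" by (simp add: cyc_apply res_def)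
  moreover have "turn x \<in> G" unfolding turn_def using G_comp G_cyc G_cyc_pow xG(1) by blast
  ultimately show ?thesis by (simp add: G0_def)
qed

lemma G0_shift_id:
  assumes "x \<in> G0" "x \<circ> (cyc ^^ e) \<in> G0" shows "cyc ^^ e = id"
proof -
  have "x ((cyc ^^ e) 11) = x 11" using assms by (simp add: G0_def)
  moreover have "inj x" using permutes_inj[OF G_permutes] assms(1) by (simp add: G0_def)
  ultimately have "(cyc ^^ e) 11 = 11" using injD by metis
  then have "e mod 11 = 0" using cyc_pow[of 11 e] res_eq_iff'[of 11 "11 + e"] by simp
  then obtain m where "e = 11 * m" by auto
  then show ?thesis using cyc_pow_11_mult by simp
qed

lemma turn_pow: "\<exists>e. (turn ^^ n) x = (cyc ^^ n) \<circ> x \<circ> (cyc ^^ e)"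
proof (induction n)
  case 0
  show ?case by (intro exI[of _ 0]) (simp add: id_def[symmetric])
next
  case (Suc n)
  then obtain e where e: "(turn ^^ n) x = (cyc ^^ n) \<circ> x \<circ> (cyc ^^ e)" by blast
  have "(turn ^^ Suc n) x = (cyc ^^ Suc n) \<circ> x \<circ> (cyc ^^ (e + inv' ((turn ^^ n) x) 10))"
    unfolding funpow.simps(2) comp_apply turn_def[of "(turn ^^ n) x"] funpow_add by (subst e) (simp add: fun_eq_iff)
  then show ?case by blast
qed

lemma turn_11: "x \<in> G0 \<Longrightarrow> (turn ^^ 11) x = x"
proof -
  assume x: "x \<in> G0"
  have "(turn ^^ n) x \<in> G0" for n using x turn_G0 by (induction n) auto
  moreover obtain e where e: "(turn ^^ 11) x = (cyc ^^ (11 * 1)) \<circ> x \<circ> (cyc ^^ e)" using turn_pow[of 11 x] by auto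
  moreover have "(cyc ^^ (11 * 1)) \<circ> x \<circ> (cyc ^^ e) = x \<circ> (cyc ^^ e)" unfolding cyc_pow_11_mult by simp
  ultimately show ?thesis using G0_shift_id[OF x, of e] by (metis comp_id)
qed

lemma turn_fixed:
  assumes x: "x \<in> G0" "turn x = x"
  shows "\<exists>k\<in>{1..10}. x = mult_perm k"
proof -
  have xG: "x \<in> G" "x permutes {1..11}" "x 11 = 11" using x G_permutes by (auto simp: G0_def)
  define e where "e = inv' x 10"
  have e: "e \<in> {1..11}" unfolding e_def using permutes_in_image[OF permutes_inv[OF xG(2)], of 10] by simp
  have eq: "cyc \<circ> x \<circ> (cyc ^^ e) = x" using x(2) by (simp add: turn_def e_def)
  have "e \<noteq> 11"
  proof
    assume "e = 11"
    then have "x 11 = 10" using permutes_inverses[OF xG(2)] e_def by metis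
    then show False using xG by simp
  qed
  then obtain k where k: "k \<in> {1..10}" "e * (11 - k) mod 11 = 1" using neg_inverse_mod_11[of e] e by auto
  \<comment> \<open>So \<open>x\<close> normalises the cyclic group, and \<open>x (i + e * n) = x i - n\<close> modulo 11.\<close>
  have pow: "(cyc ^^ n) \<circ> x \<circ> (cyc ^^ (e * n)) = x" for n
  proof (induction n)
    case 0
    show ?case by (simp add: id_def[symmetric])
  next
    case (Suc n)
    have "(cyc ^^ Suc n) \<circ> x \<circ> (cyc ^^ (e * Suc n)) = cyc \<circ> ((cyc ^^ n) \<circ> x \<circ> (cyc ^^ (e * n))) \<circ> (cyc ^^ e)"
      by (simp only: funpow.simps(2) comp_assoc mult_Suc_right add.commute[of e] funpow_add)
    then show ?case unfolding Suc eq .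
  qed
  have "x = mult_perm k"
  proof (rule ext)
    fix i
    show "x i = mult_perm k i"
    proof (cases "i \<in> {1..11}")
      case False
      then show ?thesis unfolding mult_perm_def using permutes_not_in[OF xG(2) False] by (simp only: if_False)
    next
      case i: True
      define n where "n = (11 - k) * i"
      have "e * n mod 11 = i mod 11"
        unfolding n_def mult.assoc[symmetric] using k(2) by (metis mod_mult_left_eq mult_1)
      then have "res (11 + e * n) = i" unfolding res_eq_iff'[OF i] by simp
      then have "(cyc ^^ (e * n)) 11 = i" using cyc_pow[of 11 "e * n"] by simp
      then have "(cyc ^^ n) (x i) = 11" using fun_cong[OF pow[of n], of 11] xG(3) by simp
      moreover have xi: "x i \<in> {1..11}" using permutes_in_image[OF xG(2)] i by blast
      ultimately have "(x i + n) mod 11 = 0" using cyc_pow[OF xi] res_eq_iff'[of 11 "x i + n"] by simp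
      then have "(x i + n + k * i) mod 11 = (k * i) mod 11" by (metis add_0 mod_add_left_eq)
      moreover have "n + k * i = 11 * i" unfolding n_def using k(1) by (simp add: add_mult_distrib[symmetric])
      ultimately have "x i mod 11 = (k * i) mod 11" by (simp add: add.assoc)
      then show ?thesis using res_eq_iff'[OF xi, of "k * i"] i by (simp add: mult_perm_def)
    qed
  qed
  then show ?thesis using k(1) by blast
qed

lemma turn_mult_perm:
  assumes k: "mult_perm k \<in> G"
  shows "turn (mult_perm k) = mult_perm k"
proof (rule permutes_eqI_on)
  have p: "mult_perm k permutes {1..11}" using G_permutes[OF k] .
  have G0: "mult_perm k \<in> G0" using k mult_perm_fixes_11 by (simp add: G0_def)
  show "turn (mult_perm k) permutes {1..11}" using turn_G0[OF G0] G_permutes by (simp add: G0_def)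
  show "mult_perm k permutes {1..11}" by fact
  define b where "b = inv' (mult_perm k) 10"
  have b: "b \<in> {1..11}" unfolding b_def using permutes_in_image[OF permutes_inv[OF p], of 10] by simp
  have "mult_perm k b = 10" unfolding b_def using permutes_inverses[OF p] by simp
  then have kb: "k * b mod 11 = 10" using b res_eq_iff'[of 10 "k * b"] by (simp add: mult_perm_def)
  fix i :: nat assume i: "i \<in> {1..11}"
  have "turn (mult_perm k) i = cyc (mult_perm k ((cyc ^^ b) i))" by (simp add: turn_def b_def)
  also have "\<dots> = res (k * (i + b) + 1)"
    using cyc_apply[OF res_range, of "k * (i + b)"] unfolding cyc_pow[OF i] mult_perm_def
    by (simp only: res_range if_True res_mult res_add)
  also have "\<dots> = res (k * i)"
  proof -
    have "(k * (i + b) + 1) mod 11 = (k * i + (k * b mod 11) + 1) mod 11"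
      using mod_add_right_eq[of "k * i + 1" "k * b" 11] by (simp add: ac_simps add_mult_distrib2)
    then show ?thesis unfolding res_eq_iff kb by simp
  qed
  finally show "turn (mult_perm k) i = mult_perm k i" using i by (simp add: mult_perm_def)
qed

lemma multipliers_card: "card {x \<in> G0. turn x = x} \<in> {1, 5}"
proof -
  define K where "K = {k \<in> {1..10}. mult_perm k \<in> G}"
  have "{x \<in> G0. turn x = x} = mult_perm ` K"
    using turn_fixed turn_mult_perm mult_perm_fixes_11 by (fastforce simp: K_def G0_def)
  then have c: "card {x \<in> G0. turn x = x} = card K"
    using card_image[OF inj_on_subset[OF inj_mult_perm]] by (simp add: K_def subset_iff)
  have K5: "K \<subseteq> {1, 3, 4, 5, 9}" using mult_perm_aut G_sub M11_subset_aut unfolding K_def by blast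
  have "mult_perm 1 = id" using res_id by (auto simp: mult_perm_def fun_eq_iff)
  then have K1: "1 \<in> K" using G_id by (simp add: K_def)
  have Km: "k * l mod 11 \<in> K" if "k \<in> K" "l \<in> K" for k l
  proof -
    have "mult_perm (k * l mod 11) \<in> G" using that G_comp[of "mult_perm k" "mult_perm l"] mult_perm_comp[of k l] by (simp add: K_def)
    moreover have "k * l mod 11 \<in> {1..10}" using that[THEN subsetD[OF K5]] by auto
    ultimately show ?thesis by (simp add: K_def)
  qed
  have "K = {1} \<or> K = {1, 3, 4, 5, 9}"
  proof (cases "K = {1}")
    case False
    then obtain k where k: "k \<in> K" "k \<in> {3, 4, 5, 9}" using K5 K1 by blast
    then have "{3, 4, 5, 9} \<subseteq> K"
      using Km[of k k] Km[of "k * k mod 11" k] Km[of "k * k mod 11 * k mod 11" k] by auto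
    then show ?thesis using K5 K1 by blast
  qed simp
  then show ?thesis unfolding c by auto
qed

lemma G_eq_M11:
  assumes "5 dvd card G" "8 dvd card G"
  shows "G = M11"
proof -
  define m where "m = card G0"
  obtain q where "7920 = card G * q" using G_card_dvd by (rule dvdE)
  then have q: "m * q = 720" unfolding G_card m_def[symmetric] mult.assoc by simp
  have "m mod 11 = card {x \<in> G0. turn x = x} mod 11"
    unfolding m_def
  proof (rule card_fixed_points_mod_prime)
    show "normalization_semidom_class.prime (11 :: nat)" by simp
    show "finite G0" using G_finite by (simp add: G0_def)
  qed (use turn_G0 turn_11 in auto)
  then have m: "m mod 11 = 1 \<or> m mod 11 = 5" using multipliers_card by auto
  have "5 dvd 11 * m" "8 dvd 11 * m" using assms by (simp_all add: G_card m_def)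
  moreover have "coprime 5 (11::nat)" "coprime 8 (11::nat)" "coprime 5 (8::nat)" by code_simp+
  ultimately have "5 * 8 dvd m" by (intro divides_mult) (simp_all add: coprime_dvd_mult_right_iff)
  then have "40 dvd m" by simp
  then obtain r where r: "m = 40 * r" by (auto elim: dvdE)
  then have rq: "r * q = 18" using q by (simp add: mult.commute)
  then have "r dvd 18" by (metis dvd_triv_left)
  moreover from this have "r \<le> 18" by (rule dvd_imp_le) simp
  ultimately have r18: "r \<in> set [0..<19]" "r dvd 18" by auto
  moreover have "list_all (\<lambda>r. r dvd 18 \<and> (40 * r mod 11 = 1 \<or> 40 * r mod 11 = 5) \<longrightarrow> r = (18::nat)) [0..<19]"
    by code_simp
  ultimately have "r = 18" using m r unfolding list_all_iff by blast
  then have "card G = card M11" using r card_M11 by (simp add: G_card m_def)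
  moreover have "finite M11" using card_M11 by (intro card_ge_0_finite) simp
  ultimately show ?thesis using G_sub by (intro card_subset_eq)
qed

end

section \<open>Additive polynomials in characteristic three\<close>

lemma field_of_card_3:
  assumes "CARD('a::field) = 3"
  shows "(3::'a) = 0" and "x = 0 \<or> x = 1 \<or> x = (-1::'a)"
proof -
  have "card (UNIV - {0, 1 :: 'a}) = 1" using assms by (subst card_Diff_subset) auto
  then obtain d :: 'a where "UNIV - {0, 1} = {d}" by (rule card_1_singletonE)
  then have d: "UNIV = {0, 1, d}" "d \<noteq> 0" "d \<noteq> 1" by blast+
  have all: "y = 0 \<or> y = 1 \<or> y = d" for y using d(1) by blast
  have "1 + 1 \<noteq> (0::'a)"
  proof
    assume "1 + 1 = (0::'a)"
    then have "d + 1 \<noteq> 0" using d(3) by (metis add_right_cancel)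
    then show False using all[of "d + 1"] d(2,3) by auto
  qed
  moreover have "1 + 1 \<noteq> (1::'a)"
  proof
    assume "1 + 1 = (1::'a)"
    then have "1 + 1 = 0 + (1::'a)" by (simp only: add_0_left)
    then have "1 = (0::'a)" by (rule add_right_imp_eq)
    then show False by simp
  qed
  ultimately have 2: "d = 1 + 1" using all[of "1 + 1"] by blast
  have d1: "d + 1 = 0" using all[of "d + 1"] d(2,3) by auto
  have "(3::'a) = (1 + 1) + 1" by simp
  then show "(3::'a) = 0" using d1 unfolding 2 by (rule trans)
  show "x = 0 \<or> x = 1 \<or> x = (-1::'a)" using all[of x] d1 by (auto simp: eq_neg_iff_add_eq_0)
qed

lemma char_3_simps:
  fixes x :: "'k::comm_ring_1"
  assumes "(3::'k) = 0"
  shows "(x + y) ^ 3 = x ^ 3 + y ^ 3" "(- x) ^ 3 = - (x ^ 3)" "(x - y) ^ 3 = x ^ 3 - y ^ 3"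
proof -
  have "(x + y) ^ 3 = x ^ 3 + y ^ 3 + 3 * (x ^ 2 * y + x * y ^ 2)"
    by (simp add: power2_eq_square power3_eq_cube algebra_simps)
  then show a: "(x + y) ^ 3 = x ^ 3 + y ^ 3" using assms by simp
  show "(- x) ^ 3 = - (x ^ 3)" by (simp add: power3_eq_cube)
  have "(x - y) ^ 3 = x ^ 3 - y ^ 3 - 3 * (x ^ 2 * y - x * y ^ 2)"
    by (simp add: power2_eq_square power3_eq_cube algebra_simps)
  then show "(x - y) ^ 3 = x ^ 3 - y ^ 3" using assms by simp
qed

lemma char_3_sum:
  fixes f :: "'i \<Rightarrow> 'k::comm_ring_1"
  assumes "(3::'k) = 0"
  shows "(sum f A) ^ 3 = (\<Sum>i\<in>A. f i ^ 3)"
  by (induction A rule: infinite_finite_induct) (simp_all add: char_3_simps[OF assms])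

lemma char_3_power:
  fixes x y :: "'k::comm_ring_1"
  assumes "(3::'k) = 0"
  shows "(x + y) ^ (3 ^ n) = x ^ (3 ^ n) + y ^ (3 ^ n)" "(- x) ^ (3 ^ n) = - (x ^ (3 ^ n))"
  by (induction n) (simp_all add: power_mult mult.commute[of 3] char_3_simps[OF assms])

text \<open>
  The zeros \<open>y\<close> of this additive polynomial of degree \<open>3 ^ 5\<close> in a field form a space of dimension
  at most five over the prime field; it is the source of the linear structure on the roots.
\<close>

definition additive_op :: "'k::comm_ring_1 \<Rightarrow> 'k \<Rightarrow> 'k" where
  "additive_op T y = y ^ 243 + T ^ 9 * y ^ 81 - T * y ^ 27 + T ^ 2 * y ^ 9 - y"

lemma additive_op_additive:
  fixes T :: "'k::comm_ring_1"
  assumes "(3::'k) = 0"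
  shows "additive_op T (x + y) = additive_op T x + additive_op T y" "additive_op T (- x) = - additive_op T x" "additive_op T 0 = 0"
  using char_3_power(1)[OF assms, of x y 5] char_3_power(1)[OF assms, of x y 4]
    char_3_power(1)[OF assms, of x y 3] char_3_power(1)[OF assms, of x y 2]
    char_3_power(2)[OF assms, of x 5] char_3_power(2)[OF assms, of x 4]
    char_3_power(2)[OF assms, of x 3] char_3_power(2)[OF assms, of x 2]
  by (simp_all add: additive_op_def algebra_simps)

text \<open>
  With \<open>y ^ 22 = 1 - T * y ^ 4\<close> the powers \<open>y ^ 27\<close>, \<open>y ^ 81\<close> and \<open>y ^ 243\<close> reduce in turn, and the terms left over
  add up to a multiple of 3. Note that \<open>y ^ 2\<close> is then a root of the trinomial with
  parameter \<open>T\<close>.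
\<close>

lemma additive_op_root:
  fixes T y :: "'k::comm_ring_1"
  assumes "(3::'k) = 0" and y: "y ^ 22 + T * y ^ 4 = 1"
  shows "additive_op T y = 0"
proof -
  have 22: "y ^ 22 = 1 - T * y ^ 4" using y by (simp add: algebra_simps)
  have 27: "y ^ 27 = y ^ 5 - T * y ^ 9"
  proof -
    have "y ^ 27 = y ^ 5 * y ^ 22" by (simp flip: power_add)
    then show ?thesis unfolding 22 by (simp add: algebra_simps flip: power_add)
  qed
  have 81: "y ^ 81 = y ^ 15 - T ^ 3 * y ^ 27"
  proof -
    have "y ^ 81 = (y ^ 27) ^ 3" by (simp flip: power_mult)
    also have "\<dots> = (y ^ 5 - T * y ^ 9) ^ 3" by (simp only: 27)
    also have "\<dots> = y ^ 15 - T ^ 3 * y ^ 27"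
      by (simp add: char_3_simps[OF assms(1)] power_mult_distrib flip: power_mult)
    finally show ?thesis .
  qed
  have 243: "y ^ 243 = y ^ 45 - T ^ 9 * y ^ 81"
  proof -
    have "y ^ 243 = (y ^ 81) ^ 3" by (simp flip: power_mult)
    also have "\<dots> = (y ^ 15 - T ^ 3 * y ^ 27) ^ 3" by (simp only: 81)
    also have "\<dots> = y ^ 45 - T ^ 9 * y ^ 81"
      by (simp add: char_3_simps[OF assms(1)] power_mult_distrib flip: power_mult)
    finally show ?thesis .
  qed
  have "y ^ 45 = y * (y ^ 22) ^ 2" by (simp flip: power_mult power_Suc)
  also have "\<dots> = y - 2 * (T * y ^ 5) + T ^ 2 * y ^ 9"
    unfolding 22 by (simp add: algebra_simps power_numeral_reduce)
  finally have 45: "y ^ 45 = y - 2 * (T * y ^ 5) + T ^ 2 * y ^ 9" .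
  have "additive_op T y = 3 * (T ^ 2 * y ^ 9 - T * y ^ 5)"
    unfolding additive_op_def 243 45 27 by (simp add: power2_eq_square algebra_simps)
  then show ?thesis using assms(1) by simp
qed

section \<open>The trinomial and its roots\<close>

definition trinomial :: "'k::comm_ring_1 \<Rightarrow> 'k poly" where
  "trinomial T = monom 1 11 + monom T 2 - 1"

lemma poly_trinomial: "poly (trinomial T) x = x ^ 11 + T * x ^ 2 - 1"
  by (simp add: trinomial_def poly_monom)

lemma trinomial_degree: "degree (trinomial (T :: 'k::field)) = 11" "trinomial T \<noteq> 0"
proof -
  have c: "coeff (trinomial T) n = (if n = 11 then 1 else if n = 2 then T else if n = 0 then -1 else 0)" for n
    by (auto simp: trinomial_def)
  have "degree (trinomial T) \<le> 11" by (rule degree_le) (simp add: c)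
  moreover have "coeff (trinomial T) 11 \<noteq> 0" by (simp add: c)
  ultimately show "degree (trinomial T) = 11" by (simp add: le_antisym le_degree)
  then show "trinomial T \<noteq> 0" by auto
qed

definition zeros :: "'k::comm_ring_1 \<Rightarrow> 'k set" where
  "zeros T = {x. x ^ 11 + T * x ^ 2 = 1}"

lemma zeros_eq: "zeros T = {x. poly (trinomial T) x = 0}"
  by (auto simp: zeros_def poly_trinomial)

lemma zeros_finite: "finite (zeros (T :: 'k::field))" "card (zeros T) \<le> 11"
  unfolding zeros_eq
  using poly_roots_finite[OF trinomial_degree(2)] card_poly_roots_bound[OF trinomial_degree(2)] trinomial_degree(1)
  by metis+

text \<open>
  At a multiple root \<open>x\<close> the derivative gives \<open>x ^ 11 + T * x ^ 2 = 0\<close>, whereas this is 1 at every root.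
  So there is no ramification at any value of \<open>T\<close>, and the parameter may be specialised freely.
\<close>

lemma zeros_card:
  fixes T :: "'k::alg_closed_field"
  assumes "(3::'k) = 0"
  shows "card (zeros T) = 11"
proof -
  let ?p = "trinomial T"
  have lead: "lead_coeff ?p = 1" using trinomial_degree(1)[of T] by (simp add: trinomial_def)
  obtain A where A: "size A = degree ?p" "?p = (\<Prod>x\<in>#A. [:- x, 1:])"
    using alg_closed_imp_factorization[OF trinomial_degree(2)[of T]] lead by auto
  have deriv: "pderiv ?p = monom 11 10 + monom (2 * T) 1"
    by (simp add: trinomial_def pderiv_diff pderiv_add pderiv_monom)
  have simple: "count A x \<le> 1" for x
  proof (rule ccontr)
    assume "\<not> count A x \<le> 1"
    then have "replicate_mset 2 x \<subseteq># A" by (simp add: count_le_replicate_mset_subset_eq[symmetric])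
    then obtain B where "A = replicate_mset 2 x + B" by (auto simp: subset_mset.le_iff_add)
    then have "?p = [:- x, 1:] * ([:- x, 1:] * (\<Prod>x\<in>#B. [:- x, 1:]))"
      using A(2) by (simp add: numeral_2_eq_2)
    then obtain q where q: "?p = [:- x, 1:] * ([:- x, 1:] * q)" by blast
    have p0: "poly ?p x = 0" unfolding q by simp
    have "poly [:- x, 1:] x = 0" by simp
    then have "poly (pderiv ?p) x = 0"
      unfolding q pderiv_mult poly_add poly_mult by (simp only: mult_zero_left mult_zero_right add_0)
    then have "11 * x ^ 10 + 2 * T * x = 0" unfolding deriv by (simp add: poly_monom)
    moreover have "(11::'k) = 2 + 3 * 3" by simp
    ultimately have "2 * (x ^ 10 + T * x) = 0" using assms by (simp add: algebra_simps)
    moreover have "(2::'k) \<noteq> 0"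
    proof
      assume "(2::'k) = 0"
      moreover have "(1::'k) = 3 - 2" by simp
      ultimately show False using assms by simp
    qed
    ultimately have "x ^ 10 + T * x = 0" by (metis mult_eq_0_iff)
    then have "x * (x ^ 10 + T * x) = 0" by simp
    then have "x ^ 11 + T * x ^ 2 = 0" by (simp add: algebra_simps power2_eq_square flip: power_Suc)
    then show False using p0 by (simp add: poly_trinomial)
  qed
  have "zeros T = set_mset A" unfolding zeros_eq A(2) by (auto simp: poly_prod_mset)
  moreover have "size A = card (set_mset A)"
    unfolding size_multiset_overloaded_eq
    using simple by (subst sum.cong[OF refl, of _ _ "\<lambda>_. 1"]) (auto intro: antisym simp: Suc_leI)
  ultimately show ?thesis using A(1) trinomial_degree(1)[of T] by simp
qed

section \<open>Roots as power series\<close>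

text \<open>
  The equation is linear in the parameter, so instead of lifting a root one solves for the
  parameter: near \<open>b\<close> it is a power series \<open>\<tau>\<close> in \<open>y - b\<close> with nonzero linear coefficient, and
  the inverse series expresses \<open>y\<close> by the parameter.
\<close>

lemma lift_root:
  fixes e b :: "'k::field"
  assumes "(3::'k) = 0" and b: "b ^ 22 + e * b ^ 4 = 1"
  shows "\<exists>y :: 'k fps. y ^ 22 + (fps_const e + fps_X) * y ^ 4 = 1 \<and> y $ 0 = b"
proof -
  have b0: "b \<noteq> 0" using b by auto
  define w where "w = fps_const b + fps_X"
  have w0: "w $ 0 = b" and w1: "w $ 1 = 1" by (simp_all add: w_def)
  have pow1: "(w ^ Suc n) $ 1 = of_nat (Suc n) * b ^ n" for n
  proof (induction n)
    case (Suc n)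
    have "(w ^ Suc (Suc n)) $ 1 = w $ 0 * (w ^ Suc n) $ 1 + w $ 1 * (w ^ Suc n) $ 0"
      by (subst power_Suc) (rule fps_mult_nth_1)
    then show ?case using Suc w0 w1 by (simp add: algebra_simps fps_power_zeroth)
  qed (use w1 in simp)
  \<comment> \<open>The parameter solved from \<open>w ^ 22 + (e + \<tau>) * w ^ 4 = 1\<close>, minus its value at \<open>b\<close>.\<close>
  define \<tau> where "\<tau> = (1 - w ^ 22) * inverse (w ^ 4) - fps_const e"
  have "w ^ 4 * inverse (w ^ 4) = 1" using b0 w0 by (intro inverse_mult_eq_1') (simp add: fps_power_zeroth)
  then have eq: "w ^ 4 * (\<tau> + fps_const e) = 1 - w ^ 22"
    unfolding \<tau>_def by (simp add: mult.left_commute)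
  have "b ^ 4 * (\<tau> $ 0 + e) = 1 - b ^ 22"
    using arg_cong[OF eq, of "\<lambda>f. f $ 0"] w0 by (simp add: fps_power_zeroth)
  then have "b ^ 4 * (\<tau> $ 0) = 1 - b ^ 22 - e * b ^ 4" by (simp add: algebra_simps)
  also have "\<dots> = 1 - (b ^ 22 + e * b ^ 4)" by simp
  finally have "b ^ 4 * (\<tau> $ 0) = 0" using b by simp
  then have t0: "\<tau> $ 0 = 0" using b0 by simp
  have "b ^ 4 * \<tau> $ 1 + (4 * b ^ 3) * e = - (22 * b ^ 21)"
    using arg_cong[OF eq, of "\<lambda>f. f $ 1"] pow1[of 3] pow1[of 21] w0 t0
    by (simp add: fps_mult_nth_1 fps_power_zeroth)
  moreover have "b * (b ^ 4 * \<tau> $ 1 + (4 * b ^ 3) * e) = (b * b ^ 4) * \<tau> $ 1 + 4 * (b * b ^ 3) * e"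
    by (simp add: algebra_simps)
  moreover have "b * (- (22 * b ^ 21)) = - (22 * (b * b ^ 21))" by simp
  moreover have "b * b ^ 4 = b ^ 5" "b * b ^ 3 = b ^ 4" "b * b ^ 21 = b ^ 22" by (simp_all flip: power_Suc)
  ultimately have "b ^ 5 * \<tau> $ 1 + 4 * b ^ 4 * e = - (22 * b ^ 22)" by metis
  then have "b ^ 5 * \<tau> $ 1 = - (22 * b ^ 22) - 4 * b ^ 4 * e" by (simp only: eq_diff_eq)
  also have "\<dots> = - (b ^ 22 + e * b ^ 4) - 3 * (7 * b ^ 22 + e * b ^ 4)"
    by (simp add: algebra_simps)
  finally have "b ^ 5 * \<tau> $ 1 = - (b ^ 22 + e * b ^ 4) - 3 * (7 * b ^ 22 + e * b ^ 4)" .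
  then have t1: "\<tau> $ 1 \<noteq> 0" using b assms(1) by auto
  define g where "g = fps_inv \<tau>"
  have g0: "g $ 0 = 0" by (simp add: g_def fps_inv_def)
  have tg: "\<tau> oo g = fps_X" unfolding g_def using fps_inv_right[OF t0 t1] .
  define y where "y = w oo g"
  have "(w ^ 4 * (\<tau> + fps_const e)) oo g = (1 - w ^ 22) oo g" using eq by simp
  then have "y ^ 4 * (fps_X + fps_const e) = 1 - y ^ 22"
    by (simp add: fps_compose_mult_distrib[OF g0] fps_compose_add_distrib fps_compose_sub_distrib
        fps_compose_power[OF g0, symmetric] tg y_def)
  then have "y ^ 22 + (fps_const e + fps_X) * y ^ 4 = 1" by (simp add: algebra_simps)
  moreover have "y $ 0 = b" by (simp add: y_def w0)
  ultimately show ?thesis by blast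
qed

text \<open>
  Apart from the linear term every term is divisible by \<open>y ^ 9\<close>, so a nonzero solution cannot have
  constant coefficient 0. Linear relations between roots may therefore be tested on constant coefficients.
\<close>

lemma additive_op_kernel_small:
  fixes y :: "'k::field fps"
  assumes "additive_op T y = 0" "y $ 0 = 0"
  shows "y = 0"
proof (rule ccontr)
  assume "y \<noteq> 0"
  have "y = y ^ 9 * (y ^ 234 + T ^ 9 * y ^ 72 - T * y ^ 18 + T ^ 2)"
    using assms(1) by (simp add: additive_op_def algebra_simps flip: power_add)
  then have "y * 1 = y * (y ^ 8 * (y ^ 234 + T ^ 9 * y ^ 72 - T * y ^ 18 + T ^ 2))"
    by (simp add: mult.assoc[symmetric] flip: power_Suc)
  then have "1 = y ^ 8 * (y ^ 234 + T ^ 9 * y ^ 72 - T * y ^ 18 + T ^ 2)" using \<open>y \<noteq> 0\<close> by (simp only: mult_cancel_left) simp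
  then have "1 $ 0 = (y ^ 8 * (y ^ 234 + T ^ 9 * y ^ 72 - T * y ^ 18 + T ^ 2)) $ 0" by simp
  then show False using assms(2) by (simp add: fps_power_zeroth)
qed

section \<open>The coefficientwise Frobenius map on Laurent series\<close>

text \<open>
  The automorphism of Laurent series that cubes coefficients and leaves the variable fixed. It
  plays the role of a Frobenius element of the Galois group.
\<close>

definition frob :: "'k::field fls \<Rightarrow> 'k fls" where
  "frob f = Abs_fls (\<lambda>n. (f $$ n) ^ 3)"

lemma frob_nth [simp]: "frob f $$ n = (f $$ n) ^ 3"
  unfolding frob_def by (rule nth_Abs_fls_lower_bound[of "fls_subdegree f"]) (simp add: fls_eq0_below_subdegree)

lemma frob_subdegree: "fls_subdegree (frob f) = fls_subdegree f"
proof (cases "f = 0")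
  case True
  then have "frob f = 0" by (intro fls_eqI) simp
  then show ?thesis using True by simp
next
  case False
  then show ?thesis by (intro fls_subdegree_eqI) (auto simp: fls_eq0_below_subdegree)
qed

lemma frob_hom:
  assumes "(3::'k::field) = 0"
  shows "hom_on UNIV (frob :: 'k fls \<Rightarrow> 'k fls)"
  unfolding hom_on_def
proof (intro conjI ballI)
  show "frob 1 = (1 :: 'k fls)" by (rule fls_eqI) simp
  fix f g :: "'k fls"
  show "frob (f + g) = frob f + frob g" by (rule fls_eqI) (simp add: char_3_simps[OF assms])
  show "frob (f * g) = frob f * frob g"
    by (rule fls_eqI) (simp add: fls_times_nth(2) frob_subdegree char_3_sum[OF assms] power_mult_distrib)
qed

lemma frob_fps: "frob (fps_to_fls g) = fps_to_fls (Abs_fps (\<lambda>n. (g $ n) ^ 3))"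
  by (rule fls_eqI) simp

lemma char_3_transfer:
  assumes "(3::'a::field) = 0"
  shows "(3::'a alg_closure) = 0" "(3::'a fps) = 0" "(3::'a fls) = 0"
proof -
  show "(3::'a alg_closure) = 0" using to_ac_numeral[of "num.Bit1 num.One", where 'a = 'a] assms by (metis to_ac_0)
  show "(3::'a fps) = 0" unfolding numeral_fps_const using assms by simp
  show "(3::'a fls) = 0" using fls_const_numeral[of "num.Bit1 num.One", where 'a = 'a] assms by (metis fls_const_0)
qed

text \<open>
  The parameter \<open>e + X\<close> in a neighbourhood of its specialisation \<open>e\<close>.
\<close>

definition tser :: "'k::field \<Rightarrow> 'k fls" where
  "tser e = fps_to_fls (fps_const e + fps_X)"

lemma series_root:
  fixes b e :: "'k::field"
  assumes "(3::'k) = 0" "b ^ 22 + e * b ^ 4 = 1"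
  shows "\<exists>y. (fps_to_fls y) ^ 22 + tser e * (fps_to_fls y) ^ 4 = 1 \<and> y $ 0 = b"
proof -
  obtain y :: "'k fps" where y: "y ^ 22 + (fps_const e + fps_X) * y ^ 4 = 1" "y $ 0 = b"
    using lift_root[OF assms] by blast
  have "fps_to_fls (y ^ 22 + (fps_const e + fps_X) * y ^ 4) = 1" unfolding y(1) by simp
  then have "(fps_to_fls y) ^ 22 + tser e * (fps_to_fls y) ^ 4 = 1"
    by (simp add: tser_def fls_times_fps_to_fls fps_to_fls_power)
  then show ?thesis using y(2) by blast
qed

lemma square_root_zeros:
  fixes y :: "'k::comm_ring_1"
  shows "y ^ 22 + T * y ^ 4 = 1 \<longleftrightarrow> y ^ 2 \<in> zeros T"
  by (simp add: zeros_def flip: power_mult)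

text \<open>
  The eleven constant coefficients are distinct, so lifting each of them already gives all the roots:
  they are power series, determined by their constant coefficients.
\<close>

lemma zeros_series:
  fixes e :: "'k::alg_closed_field"
  assumes "(3::'k) = 0"
  shows "bij_betw (\<lambda>z. z $$ 0) (zeros (tser e)) (zeros e)" "card (zeros (tser e)) = 11"
proof -
  have sub: "zeros e \<subseteq> (\<lambda>z. z $$ 0) ` zeros (tser e)"
  proof
    fix z assume z: "z \<in> zeros e"
    obtain b where b: "b ^ 2 = z" using nth_root_exists[of 2 z] by auto
    then obtain y where y: "(fps_to_fls y) ^ 22 + tser e * (fps_to_fls y) ^ 4 = 1" "y $ 0 = b"
      using series_root[OF assms, of b e] square_root_zeros[of b e] z by auto
    have "((fps_to_fls y) ^ 2) $$ 0 = z" using y(2) b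
      by (simp add: fps_power_zeroth flip: fps_to_fls_power)
    then show "z \<in> (\<lambda>z. z $$ 0) ` zeros (tser e)" using y(1) square_root_zeros by (metis image_eqI)
  qed
  have "11 \<le> card ((\<lambda>z. z $$ 0) ` zeros (tser e))"
    using card_mono[OF finite_imageI[OF zeros_finite(1)] sub] zeros_card[OF assms, of e] by simp
  moreover have "card ((\<lambda>z. z $$ 0) ` zeros (tser e)) \<le> card (zeros (tser e))"
    by (rule card_image_le[OF zeros_finite(1)])
  ultimately have c: "card ((\<lambda>z. z $$ 0) ` zeros (tser e)) = 11" "card (zeros (tser e)) = 11"
    using zeros_finite(2)[of "tser e"] by auto
  show "card (zeros (tser e)) = 11" by (rule c(2))
  have "zeros e = (\<lambda>z. z $$ 0) ` zeros (tser e)"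
    using c(1) zeros_card[OF assms, of e] by (intro card_subset_eq[OF _ sub]) (simp_all add: zeros_finite)
  then show "bij_betw (\<lambda>z. z $$ 0) (zeros (tser e)) (zeros e)"
    unfolding bij_betw_def using c by (auto intro: eq_card_imp_inj_on[OF zeros_finite(1)])
qed

section \<open>Embedding rational functions into Laurent series\<close>

lemma map_poly_to_ac:
  "map_poly to_ac (p + q) = map_poly to_ac p + map_poly to_ac q"
  "map_poly to_ac (p * q) = map_poly to_ac p * map_poly to_ac q"
  "map_poly to_ac p = 0 \<longleftrightarrow> p = 0"
proof -
  have E: "subfield_set (UNIV :: 'a set)" and h: "hom_on UNIV (to_ac :: 'a \<Rightarrow> _)"
    by (auto simp: subfield_set_def hom_on_def)
  have *: "p \<in> polys_on UNIV" for p :: "'a poly" by (simp add: polys_on_def)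
  show "map_poly to_ac (p + q) = map_poly to_ac p + map_poly to_ac q"
    "map_poly to_ac (p * q) = map_poly to_ac p * map_poly to_ac q"
    "map_poly to_ac p = 0 \<longleftrightarrow> p = 0"
    using map_poly_hom_on[OF E h * *] map_poly_hom_on_degree[OF E h *] by blast+
qed

text \<open>
  Taylor expansion of a polynomial at \<open>e\<close>.
\<close>

definition ev :: "'a::field \<Rightarrow> 'a poly \<Rightarrow> 'a alg_closure fls" where
  "ev e p = fps_to_fls (fps_of_poly (map_poly to_ac (pcompose p [:e, 1:])))"

lemma ev_hom:
  "ev e (p + q) = ev e p + ev e q" "ev e (p * q) = ev e p * ev e q" "ev e 1 = 1" "ev e p = 0 \<longleftrightarrow> p = 0"
  "ev e [:0, 1:] = tser (to_ac e)"
proof -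
  show "ev e (p + q) = ev e p + ev e q" "ev e (p * q) = ev e p * ev e q" "ev e 1 = 1"
    by (simp_all add: ev_def pcompose_add pcompose_mult pcompose_1 map_poly_to_ac fps_of_poly_add fps_of_poly_mult fls_times_fps_to_fls)
  have "ev e p = 0 \<longleftrightarrow> pcompose p [:e, 1:] = 0"
    unfolding ev_def using map_poly_to_ac(3) fps_of_poly_eq_iff[of _ 0] by simp
  also have "\<dots> \<longleftrightarrow> p = 0" by (auto intro: pcompose_eq_0)
  finally show "ev e p = 0 \<longleftrightarrow> p = 0" .
  show "ev e [:0, 1:] = tser (to_ac e)"
    by (simp add: ev_def tser_def pcompose_pCons map_poly_pCons fps_of_poly_pCons)
qed

text \<open>
  The extension of \<open>ev\<close> to quotients, with an arbitrary choice of numerator and denominator.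
\<close>

definition psi :: "'a::field \<Rightarrow> 'a poly fract \<Rightarrow> 'a alg_closure fls" where
  "psi e x = (let r = (SOME r. snd r \<noteq> 0 \<and> x = Fract (fst r) (snd r)) in ev e (fst r) / ev e (snd r))"

lemma psi_Fract:
  assumes "q \<noteq> 0"
  shows "psi e (Fract p q) = ev e p / ev e q"
proof -
  define r where "r = (SOME r. snd r \<noteq> 0 \<and> Fract p q = Fract (fst r) (snd r))"
  have "snd (p, q) \<noteq> 0 \<and> Fract p q = Fract (fst (p, q)) (snd (p, q))" using assms by simp
  then have r: "snd r \<noteq> 0" "Fract p q = Fract (fst r) (snd r)"
    unfolding r_def by (metis (mono_tags, lifting) someI_ex)+
  then have "p * snd r = fst r * q" using assms by (simp add: eq_fract)
  then have "ev e p * ev e (snd r) = ev e (fst r) * ev e q" by (metis ev_hom(2))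
  then show ?thesis using r(1) assms by (simp add: psi_def r_def[symmetric] Let_def frac_eq_eq ev_hom(4) del: fps_to_fls_eq_0_iff)
qed

lemma psi_hom: "hom_on UNIV (psi e)"
  unfolding hom_on_def
proof (intro conjI ballI)
  show "psi e 1 = 1" unfolding One_fract_def by (subst psi_Fract) (simp_all add: ev_hom(3))
  fix x y :: "'a poly fract"
  obtain p q where x: "x = Fract p q" "q \<noteq> 0" by (cases x) auto
  obtain r s where y: "y = Fract r s" "s \<noteq> 0" by (cases y) auto
  have qs: "q * s \<noteq> 0" "ev e q \<noteq> 0" "ev e s \<noteq> 0" using x y by (simp_all add: ev_hom(4))
  show "psi e (x + y) = psi e x + psi e y"
    using x y qs by (simp add: psi_Fract ev_hom(1,2) add_frac_eq)
  show "psi e (x * y) = psi e x * psi e y"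
    using x y qs by (simp add: psi_Fract ev_hom(2))
qed

lemma psi_ratfun_var: "psi e ratfun_var = tser (to_ac e)"
  unfolding ratfun_var_def by (subst psi_Fract) (simp_all add: ev_hom(3,5))

text \<open>
  The base field has three elements, so that cubing fixes the coefficients of Taylor expansions at
  its points.
\<close>

lemma frob_psi:
  fixes e :: "'a::field"
  assumes "CARD('a) = 3"
  shows "frob (psi e x) = psi e x"
proof -
  have cube: "c ^ 3 = c" for c :: 'a using field_of_card_3(2)[OF assms, of c] by (auto simp: power3_eq_cube)
  have 3: "(3 :: 'a alg_closure) = 0" using char_3_transfer(1)[OF field_of_card_3(1)[OF assms]] .
  have ev: "frob (ev e p) = ev e p" for p
  proof (rule fls_eqI)
    fix n
    show "frob (ev e p) $$ n = ev e p $$ n"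
      by (simp add: ev_def coeff_map_poly cube flip: to_ac_power)
  qed
  obtain p q where x: "x = Fract p q" "q \<noteq> 0" by (cases x) auto
  have U: "subfield_set (UNIV :: 'a alg_closure fls set)" by (simp add: subfield_set_def)
  show ?thesis using x hom_onD(6)[OF U frob_hom[OF 3]] by (simp add: psi_Fract ev)
qed

section \<open>The splitting field and its automorphisms\<close>

lemma a_inv_ring_of_type: "a_inv (ring_of_type_algebra :: 'k::field ring) x = - x"
proof -
  interpret R: field "ring_of_type_algebra :: 'k ring" by (rule field_from_type_algebra)
  show ?thesis by (rule R.minus_equality) (simp_all add: ring_of_type_algebra_def)
qed

lemma m_inv_ring_of_type:
  assumes "x \<noteq> 0" shows "m_inv (ring_of_type_algebra :: 'k::field ring) x = inverse x"
proof -
  interpret R: field "ring_of_type_algebra :: 'k ring" by (rule field_from_type_algebra)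
  show ?thesis using assms by (intro R.comm_inv_char) (simp_all add: ring_of_type_algebra_def)
qed

lemma generate_field_subfield:
  "subfield_set (generate_field (ring_of_type_algebra :: 'k::field ring) H)" (is "subfield_set ?L")
proof -
  let ?R = "ring_of_type_algebra :: 'k ring"
  have ops: "x \<oplus>\<^bsub>?R\<^esub> y = x + y" "x \<otimes>\<^bsub>?R\<^esub> y = x * y" "\<one>\<^bsub>?R\<^esub> = 1" "\<zero>\<^bsub>?R\<^esub> = 0" for x y
    by (simp_all add: ring_of_type_algebra_def)
  have 1: "1 \<in> ?L" using generate_field.one[of ?R H] by (simp add: ops)
  have a: "x + y \<in> ?L" if "x \<in> ?L" "y \<in> ?L" for x y using generate_field.eng_add[OF that] by (simp add: ops)
  have m: "x * y \<in> ?L" if "x \<in> ?L" "y \<in> ?L" for x y using generate_field.eng_mult[OF that] by (simp add: ops)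
  have n: "- x \<in> ?L" if "x \<in> ?L" for x using generate_field.a_inv[OF that] by (simp add: a_inv_ring_of_type)
  have 0: "0 \<in> ?L" using a[OF 1 n[OF 1]] by simp
  have i: "inverse x \<in> ?L" if "x \<in> ?L" for x
  proof (cases "x = 0")
    case False
    then show ?thesis using generate_field.m_inv[OF that] by (simp add: ops m_inv_ring_of_type)
  qed (simp add: 0)
  show ?thesis unfolding subfield_set_def
    using 1 m a[OF _ n] m[OF _ i] by (simp add: field_class.field_divide_inverse)
qed

lemma generate_field_minimal:
  assumes "subfield_set E" "H \<subseteq> E"
  shows "generate_field (ring_of_type_algebra :: 'k::field ring) H \<subseteq> E"
proof
  note E = subfield_setD[OF assms(1)]
  fix x assume "x \<in> generate_field (ring_of_type_algebra :: 'k ring) H"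
  then show "x \<in> E"
  proof (induction rule: generate_field.induct)
    case (a_inv h)
    then show ?case using E(7) by (simp add: a_inv_ring_of_type)
  next
    case (m_inv h)
    then show ?case using E(8) m_inv_ring_of_type[of h] by (simp add: ring_of_type_algebra_def)
  qed (use assms(2) E(2,3,5) in \<open>auto simp: ring_of_type_algebra_def\<close>)
qed

lemma carrier_splitting_field:
  "carrier (splitting_field p) = generate_field ring_of_type_algebra (range to_ac \<union> roots_ac p)"
  by (simp add: splitting_field_def)

lemma galois_group_iff:
  "\<sigma> \<in> carrier (galois_group p) \<longleftrightarrow>
    \<sigma> \<in> Bij (carrier (splitting_field p)) \<and> hom_on (carrier (splitting_field p)) \<sigma> \<and> (\<forall>a. \<sigma> (to_ac a) = to_ac a)"
proof -
  let ?L = "splitting_field p"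
  have ops: "x \<oplus>\<^bsub>?L\<^esub> y = x + y" "x \<otimes>\<^bsub>?L\<^esub> y = x * y" "\<one>\<^bsub>?L\<^esub> = 1" for x y
    by (simp_all add: splitting_field_def ring_of_type_algebra_def)
  have "\<sigma> \<in> carrier (galois_group p) \<longleftrightarrow> \<sigma> \<in> Bij (carrier ?L) \<and> \<sigma> \<in> ring_iso ?L ?L \<and> (\<forall>a. \<sigma> (to_ac a) = to_ac a)"
    by (simp add: galois_group_def Let_def)
  moreover have "\<sigma> \<in> ring_iso ?L ?L \<longleftrightarrow> hom_on (carrier ?L) \<sigma>" if "\<sigma> \<in> Bij (carrier ?L)"
    using that unfolding ring_iso_def ring_hom_def hom_on_def Bij_def
    by (auto simp: ops bij_betw_def)
  ultimately show ?thesis by blast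
qed

lemma map_poly_trinomial:
  assumes "g 0 = 0" "g 1 = 1" "g (-1) = (-1)"
  shows "map_poly g (trinomial T) = trinomial (g T)"
  by (rule poly_eqI) (auto simp: coeff_map_poly trinomial_def assms)

lemma roots_ac_trinomial: "roots_ac (trinomial t) = zeros (to_ac t)"
  unfolding roots_ac_def zeros_eq by (subst map_poly_trinomial) simp_all

lemma subfield_preimage:
  assumes "subfield_set L" "hom_on L h" "subfield_set E"
  shows "subfield_set {x \<in> L. h x \<in> E}"
  unfolding subfield_set_def
  using subfield_setD[OF assms(1)] subfield_setD[OF assms(3)] hom_onD[OF assms(1,2)] by auto

lemma hom_on_subset: "hom_on E \<phi> \<Longrightarrow> L \<subseteq> E \<Longrightarrow> hom_on L \<phi>"
  by (auto simp: hom_on_def)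

lemma hom_on_cong: "(\<And>x. x \<in> E \<Longrightarrow> \<phi> x = \<psi> x) \<Longrightarrow> subfield_set E \<Longrightarrow> hom_on E \<phi> \<Longrightarrow> hom_on E \<psi>"
  using subfield_setD[of E] by (auto simp: hom_on_def)

lemma hom_on_zeros:
  assumes "subfield_set L" "hom_on L h" "x \<in> L" "T \<in> L" "x \<in> zeros T"
  shows "h x \<in> zeros (h T)"
proof -
  note L = subfield_setD[OF assms(1)] and h = hom_onD[OF assms(1,2)]
  have "h (x ^ 11 + T * x ^ 2) = 1" using assms(5) h(2) by (simp add: zeros_def)
  then show ?thesis using assms(3,4) L h by (simp add: zeros_def)
qed

abbreviation split_carrier :: "'k::field poly \<Rightarrow> 'k alg_closure set" where
  "split_carrier p \<equiv> carrier (splitting_field p)"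

lemma split_carrier_facts:
  "subfield_set (split_carrier p)" "to_ac a \<in> split_carrier p" "r \<in> roots_ac p \<Longrightarrow> r \<in> split_carrier p"
  "subfield_set E \<Longrightarrow> range to_ac \<subseteq> E \<Longrightarrow> roots_ac p \<subseteq> E \<Longrightarrow> split_carrier p \<subseteq> E"
  unfolding carrier_splitting_field
  by (auto intro: generate_field_subfield generate_field.incl dest!: generate_field_minimal[of E "range to_ac \<union> roots_ac p"])

lemma galois_roots:
  assumes "\<sigma> \<in> carrier (galois_group (trinomial t))" "r \<in> roots_ac (trinomial t)"
  shows "\<sigma> r \<in> roots_ac (trinomial t)"
  using hom_on_zeros[OF split_carrier_facts(1) _ split_carrier_facts(3)[OF assms(2)] split_carrier_facts(2)[of t]]
    assms unfolding galois_group_iff roots_ac_trinomial by fastforce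

lemma galois_perm_permutes:
  assumes \<sigma>: "\<sigma> \<in> carrier (galois_group (trinomial t))"
  shows "restrict_id \<sigma> (roots_ac (trinomial t)) permutes roots_ac (trinomial t)"
proof (rule permutes_restrict_id)
  let ?R = "roots_ac (trinomial t)"
  have fin: "finite ?R" unfolding roots_ac_trinomial by (rule zeros_finite)
  have "inj_on \<sigma> ?R"
    using \<sigma> split_carrier_facts(3) unfolding galois_group_iff Bij_def bij_betw_def
    by (metis (no_types, lifting) Int_iff inj_on_subset mem_Collect_eq subsetI)
  moreover have "\<sigma> ` ?R \<subseteq> ?R" using galois_roots[OF \<sigma>] by blast
  ultimately show "bij_betw \<sigma> ?R ?R" using fin by (simp add: bij_betw_def endo_inj_surj)
qed

lemma galois_perms_closed:
  fixes t :: "'k::field"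
  defines "R \<equiv> roots_ac (trinomial t)" and "\<P> \<equiv> galois_perms (trinomial t)"
  shows "p \<in> \<P> \<Longrightarrow> p permutes R" "id \<in> \<P>" "p \<in> \<P> \<Longrightarrow> q \<in> \<P> \<Longrightarrow> p \<circ> q \<in> \<P>"
proof -
  let ?L = "split_carrier (trinomial t)" and ?G = "carrier (galois_group (trinomial t))"
  show "p \<in> \<P> \<Longrightarrow> p permutes R" unfolding \<P>_def R_def galois_perms_def using galois_perm_permutes by blast
  have RL: "r \<in> ?L" if "r \<in> R" for r using that split_carrier_facts(3) by (simp add: R_def)
  have "(\<lambda>x\<in>?L. x) \<in> ?G" unfolding galois_group_iff
    using id_Bij[of ?L] subfield_setD[OF split_carrier_facts(1)[of "trinomial t"]]
    by (simp add: hom_on_def split_carrier_facts(2))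
  moreover have "restrict_id (\<lambda>x\<in>?L. x) R = id" using RL by (auto simp: restrict_id_def fun_eq_iff)
  ultimately show "id \<in> \<P>" unfolding \<P>_def galois_perms_def R_def by (metis image_eqI)
  assume "p \<in> \<P>" "q \<in> \<P>"
  then obtain \<sigma> \<tau> where st: "\<sigma> \<in> ?G" "\<tau> \<in> ?G" "p = restrict_id \<sigma> R" "q = restrict_id \<tau> R"
    unfolding \<P>_def galois_perms_def R_def by blast
  have B: "\<sigma> \<in> Bij ?L" "\<tau> \<in> Bij ?L" "hom_on ?L \<sigma>" "hom_on ?L \<tau>" using st galois_group_iff by blast+
  have im: "\<tau> ` ?L = ?L" using B(2) by (simp add: Bij_def bij_betw_def)
  have "compose ?L \<sigma> \<tau> \<in> ?G" unfolding galois_group_iff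
  proof (intro conjI allI)
    show "compose ?L \<sigma> \<tau> \<in> Bij ?L" using B(1,2) by (rule compose_Bij)
    have "hom_on ?L (\<lambda>x. \<sigma> (\<tau> x))" using hom_on_comp[OF B(4)] B(3) im by simp
    then show "hom_on ?L (compose ?L \<sigma> \<tau>)"
      by (rule hom_on_cong[rotated 2]) (simp_all add: compose_def split_carrier_facts(1))
    show "compose ?L \<sigma> \<tau> (to_ac a) = to_ac a" for a
      using st(1,2) split_carrier_facts(2)[of a] unfolding galois_group_iff by (simp add: compose_def)
  qed
  moreover have "restrict_id (compose ?L \<sigma> \<tau>) R = p \<circ> q"
    using RL galois_roots[OF st(2)] st(3,4) by (auto simp: restrict_id_def fun_eq_iff compose_def R_def)
  ultimately show "p \<circ> q \<in> \<P>" unfolding \<P>_def galois_perms_def R_def by (metis image_eqI)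
qed

section \<open>Realising the splitting field by Laurent series\<close>

text \<open>
  An embedding of the splitting field into Laurent series that expands the variable at \<open>e\<close>.
\<close>

definition realises :: "'a::field \<Rightarrow> ('a poly fract alg_closure \<Rightarrow> 'a alg_closure fls) \<Rightarrow> bool" where
  "realises e \<Psi> \<longleftrightarrow> hom_on (split_carrier (trinomial ratfun_var)) \<Psi> \<and> (\<forall>x. \<Psi> (to_ac x) = psi e x) \<and>
     bij_betw \<Psi> (roots_ac (trinomial ratfun_var)) (zeros (tser (to_ac e)))"

lemma realisation_exists:
  fixes e :: "'a::field"
  assumes "CARD('a) = 3"
  shows "\<exists>\<Psi>. realises e \<Psi>"
proof -
  note 3 = field_of_card_3(1)[OF assms]
  let ?t = "ratfun_var :: 'a poly fract"
  let ?p = "trinomial (to_ac ?t)" and ?R = "roots_ac (trinomial ?t)" and ?L = "split_carrier (trinomial ?t)"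
  let ?E = "range (to_ac :: 'a poly fract \<Rightarrow> _)"
  have 3: "(3 :: 'a alg_closure) = 0" "(3 :: 'a poly fract) = 0"
  proof -
    show "(3 :: 'a alg_closure) = 0" by (rule char_3_transfer(1)[OF 3])
    have "(3 :: 'a poly) = 0" using 3 by (metis numeral_poly pCons_0_0)
    then have "(3 :: 'a poly fract) = Fract 0 1" by (metis of_nat_fract of_nat_numeral)
    then show "(3 :: 'a poly fract) = 0" by (simp add: Zero_fract_def)
  qed
  have to_ac_hom: "hom_on UNIV (to_ac :: 'a poly fract \<Rightarrow> _)" "subfield_set (UNIV :: 'a poly fract set)"
    by (auto simp: hom_on_def subfield_set_def)
  define \<phi> where "\<phi> x = psi e (of_ac x)" for x
  have \<phi>: "\<phi> (to_ac x) = psi e x" for x by (simp add: \<phi>_def)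
  have E: "subfield_set ?E" by (rule subfield_image[OF to_ac_hom(2,1)])
  have "hom_on ?E \<phi>"
    unfolding hom_on_def
    using psi_hom[of e] by (auto simp: \<phi> hom_on_def simp flip: to_ac_add to_ac_mult to_ac_1)
  note h = this
  have fin: "finite ?R" unfolding roots_ac_trinomial by (rule zeros_finite)
  have "\<exists>E' \<phi>'. subfield_set E' \<and> hom_on E' \<phi>' \<and> ?E \<subseteq> E' \<and> ?R \<subseteq> E' \<and> (\<forall>x\<in>?E. \<phi>' x = \<phi> x)"
  proof (rule hom_extend[OF E h fin])
    fix r assume r: "r \<in> ?R"
    have "map_poly \<phi> ?p = trinomial (\<phi> (to_ac ?t))"
      using hom_onD[OF E h] subfield_setD(2)[OF E] by (intro map_poly_trinomial) auto
    then have m: "map_poly \<phi> ?p = trinomial (tser (to_ac e))" by (simp add: \<phi> psi_ratfun_var)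
    have "?p \<in> polys_on ?E" using subfield_setD[OF E] by (auto simp: polys_on_def trinomial_def)
    moreover have "poly ?p r = 0" using r unfolding roots_ac_trinomial zeros_eq by simp
    moreover have "card {z. poly (map_poly \<phi> ?p) z = 0} = degree ?p"
      unfolding m zeros_eq[symmetric] trinomial_degree(1) by (rule zeros_series(2)[OF 3(1)])
    ultimately show "\<exists>p. p \<in> polys_on ?E \<and> p \<noteq> 0 \<and> poly p r = 0 \<and> card {z. poly (map_poly \<phi> p) z = 0} = degree p"
      using trinomial_degree(2) by blast
  qed
  then obtain E' \<Psi> where E': "subfield_set E'" "hom_on E' \<Psi>" "?E \<subseteq> E'" "?R \<subseteq> E'" "\<forall>x\<in>?E. \<Psi> x = \<phi> x" by blast
  have LE: "?L \<subseteq> E'" by (rule split_carrier_facts(4)[OF E'(1,3,4)])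
  have h': "hom_on ?L \<Psi>" using hom_on_subset[OF E'(2) LE] .
  have \<Psi>: "\<Psi> (to_ac x) = psi e x" for x using E'(5) \<phi> by simp
  have inj: "inj_on \<Psi> ?R" using hom_on_inj[OF E'(1,2)] E'(4) inj_on_subset by blast
  have sub: "\<Psi> ` ?R \<subseteq> zeros (tser (to_ac e))"
  proof
    fix z assume "z \<in> \<Psi> ` ?R"
    then obtain r where r: "r \<in> ?R" "z = \<Psi> r" by blast
    have "\<Psi> r \<in> zeros (\<Psi> (to_ac ?t))"
      using hom_on_zeros[OF E'(1,2), of r "to_ac ?t"] r E'(3,4) roots_ac_trinomial by blast
    then show "z \<in> zeros (tser (to_ac e))" using r(2) by (simp add: \<Psi> psi_ratfun_var)
  qed
  have "card (\<Psi> ` ?R) = 11" using card_image[OF inj] zeros_card[of "to_ac ?t"] char_3_transfer(1)[OF 3(2)]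
    by (simp add: roots_ac_trinomial)
  then have "\<Psi> ` ?R = zeros (tser (to_ac e))"
    using zeros_series(2)[OF 3(1), of "to_ac e"] by (intro card_subset_eq[OF zeros_finite(1) sub]) simp
  then show ?thesis unfolding realises_def using h' \<Psi> inj by (auto simp: bij_betw_def)
qed

text \<open>
  The roots generate the splitting field and \<open>\<Theta>\<close> permutes their images, so \<open>\<Theta>\<close> maps the image
  of the splitting field onto itself. Conjugation with \<open>\<Psi>\<close> makes it an automorphism over the rational
  functions. With \<open>frob\<close> in place of \<open>\<Theta>\<close> this produces elements of the Galois group with a known
  cycle structure.
\<close>

lemma automorphism_from_series:
  fixes e :: "'a::field"
  assumes \<Psi>: "realises e \<Psi>" and \<Theta>: "hom_on UNIV \<Theta>" and fix_base: "\<And>x. \<Theta> (psi e x) = psi e x"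
  shows "\<exists>p\<in>galois_perms (trinomial ratfun_var). \<forall>r\<in>roots_ac (trinomial ratfun_var). \<Psi> (p r) = \<Theta> (\<Psi> r)"
proof -
  let ?t = "ratfun_var :: 'a poly fract"
  let ?R = "roots_ac (trinomial ?t)" and ?L = "split_carrier (trinomial ?t)" and ?Z = "zeros (tser (to_ac e))"
  note L = split_carrier_facts[where p = "trinomial ?t"]
  have h: "hom_on ?L \<Psi>" and base: "\<Psi> (to_ac x) = psi e x" and bij: "bij_betw \<Psi> ?R ?Z" for x
    using \<Psi> by (auto simp: realises_def)
  have U: "subfield_set (UNIV :: 'a alg_closure fls set)" by (simp add: subfield_set_def)
  let ?N = "\<Psi> ` ?L"
  have N: "subfield_set ?N" by (rule subfield_image[OF L(1) h])
  have h2: "hom_on ?L (\<lambda>x. \<Theta> (\<Psi> x))" by (rule hom_on_comp[OF h hom_on_subset[OF \<Theta>]]) simp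
  have \<Theta>Z: "\<Theta> ` ?Z = ?Z"
  proof (rule endo_inj_surj[OF zeros_finite(1)])
    show "inj_on \<Theta> ?Z" using hom_on_inj[OF U \<Theta>] by (rule inj_on_subset) simp
    show "\<Theta> ` ?Z \<subseteq> ?Z"
      using hom_on_zeros[OF U \<Theta>, of _ "tser (to_ac e)"] fix_base[of ?t] by (auto simp: psi_ratfun_var)
  qed
  have ZN: "?Z \<subseteq> ?N" using bij L(3) unfolding bij_betw_def by blast
  have "?L \<subseteq> {x \<in> ?L. \<Theta> (\<Psi> x) \<in> ?N}"
  proof (rule L(4)[OF subfield_preimage[OF L(1) h2 N]])
    show "range to_ac \<subseteq> {x \<in> ?L. \<Theta> (\<Psi> x) \<in> ?N}"
      using L(2) fix_base base by (auto simp: image_iff) metis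
    show "?R \<subseteq> {x \<in> ?L. \<Theta> (\<Psi> x) \<in> ?N}" using L(3) \<Theta>Z ZN bij by (fastforce simp: bij_betw_def)
  qed
  then have into: "\<Theta> (\<Psi> x) \<in> ?N" if "x \<in> ?L" for x using that by blast
  have N2: "subfield_set ((\<lambda>x. \<Theta> (\<Psi> x)) ` ?L)" by (rule subfield_image[OF L(1) h2])
  have "?L \<subseteq> {x \<in> ?L. \<Psi> x \<in> (\<lambda>x. \<Theta> (\<Psi> x)) ` ?L}"
  proof (rule L(4)[OF subfield_preimage[OF L(1) h N2]])
    show "range to_ac \<subseteq> {x \<in> ?L. \<Psi> x \<in> (\<lambda>x. \<Theta> (\<Psi> x)) ` ?L}"
      using L(2) fix_base base by (auto simp: image_iff) metis
    show "?R \<subseteq> {x \<in> ?L. \<Psi> x \<in> (\<lambda>x. \<Theta> (\<Psi> x)) ` ?L}"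
    proof
      fix r assume r: "r \<in> ?R"
      then have "\<Psi> r \<in> \<Theta> ` (\<Psi> ` ?R)" using \<Theta>Z bij by (auto simp: bij_betw_def)
      then show "r \<in> {x \<in> ?L. \<Psi> x \<in> (\<lambda>x. \<Theta> (\<Psi> x)) ` ?L}" using L(3) r by blast
    qed
  qed
  then have onto: "\<Psi> x \<in> (\<lambda>x. \<Theta> (\<Psi> x)) ` ?L" if "x \<in> ?L" for x using that by blast
  have injP: "inj_on \<Psi> ?L" by (rule hom_on_inj[OF L(1) h])
  define \<sigma> where "\<sigma> = (\<lambda>x\<in>?L. inv_into ?L \<Psi> (\<Theta> (\<Psi> x)))"
  have \<sigma>: "\<Psi> (\<sigma> x) = \<Theta> (\<Psi> x)" "\<sigma> x \<in> ?L" if "x \<in> ?L" for x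
    using that into[OF that] by (simp_all add: \<sigma>_def f_inv_into_f inv_into_into)
  have "\<sigma> \<in> carrier (galois_group (trinomial ?t))"
    unfolding galois_group_iff
  proof (intro conjI allI)
    have "inj_on \<sigma> ?L"
    proof (rule inj_onI)
      fix x y assume xy: "x \<in> ?L" "y \<in> ?L" "\<sigma> x = \<sigma> y"
      then have "\<Theta> (\<Psi> x) = \<Theta> (\<Psi> y)" using \<sigma>(1) by metis
      then show "x = y" using inj_onD[OF hom_on_inj[OF L(1) h2]] xy by blast
    qed
    moreover have "\<sigma> ` ?L = ?L"
    proof
      show "\<sigma> ` ?L \<subseteq> ?L" using \<sigma>(2) by blast
      show "?L \<subseteq> \<sigma> ` ?L"
      proof
        fix y assume y: "y \<in> ?L"
        then obtain x where x: "x \<in> ?L" "\<Psi> y = \<Theta> (\<Psi> x)" using onto by blast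
        then have "\<sigma> x = y" using \<sigma>[OF x(1)] inj_onD[OF injP, of "\<sigma> x" y] y by simp
        then show "y \<in> \<sigma> ` ?L" using x(1) by blast
      qed
    qed
    ultimately show "\<sigma> \<in> Bij ?L" by (simp add: Bij_def bij_betw_def \<sigma>_def)
    have "hom_on ?L (\<lambda>x. inv_into ?L \<Psi> (\<Theta> (\<Psi> x)))"
      by (rule hom_on_comp[OF h2 hom_on_subset[OF hom_on_inv[OF L(1) h]]]) (use into in blast)
    then show "hom_on ?L \<sigma>" by (rule hom_on_cong[rotated 2]) (simp_all add: \<sigma>_def L(1))
    show "\<sigma> (to_ac a) = to_ac a" for a
      using L(2)[of a] base[of a] fix_base[of a] inv_into_f_f[OF injP L(2)[of a]] by (simp add: \<sigma>_def)
  qed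
  then have "restrict_id \<sigma> ?R \<in> galois_perms (trinomial ?t)" by (simp add: galois_perms_def)
  moreover have "\<forall>r\<in>?R. \<Psi> (restrict_id \<sigma> ?R r) = \<Theta> (\<Psi> r)" using \<sigma>(1) L(3) by simp
  ultimately show ?thesis by blast
qed

fun val :: "f3 \<Rightarrow> 'k::comm_ring_1" where
  "val Z = 0" | "val P = 1" | "val N = -1"

fun mul3 :: "f3 \<Rightarrow> f3 \<Rightarrow> f3" where
  "mul3 Z y = Z" | "mul3 P y = y" | "mul3 N y = - y"

lemma val_hom:
  assumes "(3::'k::comm_ring_1) = 0"
  shows "val (x + y) = val x + (val y :: 'k)" "val (- x) = - (val x :: 'k)" "val (mul3 x y) = val x * (val y :: 'k)"
proof -
  have "(2::'k) = 3 - 1" by simp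
  then have 2: "(2::'k) = - 1" using assms by simp
  show "val (x + y) = val x + (val y :: 'k)" 
    by (cases x; cases y) (simp_all add: 2)
  show "val (- x) = - (val x :: 'k)" by (cases x) simp_all
  then show "val (mul3 x y) = val x * (val y :: 'k)" by (cases x; cases y) simp_all
qed

lemma val_inj:
  assumes "(3::'k::field) = 0" "(val x :: 'k) = val y"
  shows "x = y"
proof -
  have "(1::'k) \<noteq> - 1"
  proof
    assume "(1::'k) = - 1"
    then have "(1::'k) + 1 = 0" by (metis add.left_inverse)
    moreover have "(3::'k) = (1 + 1) + 1" by simp
    ultimately show False using assms(1) by simp
  qed
  then show ?thesis using assms(2) by (cases x; cases y) (auto dest: sym)
qed

lemma val_cube: "(val x :: 'k::comm_ring_1) ^ 3 = val x"
  by (cases x) simp_all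

fun lin :: "(nat \<Rightarrow> 'k::comm_ring_1) \<Rightarrow> vec \<Rightarrow> 'k" where
  "lin u (a, b, c, d, e) = val a * u 0 + val b * u 1 + val c * u 2 + val d * u 3 + val e * u 4"

lemma lin_hom:
  assumes "(3::'k::comm_ring_1) = 0"
  shows "lin u (v + w) = lin u v + (lin u w :: 'k)" "lin u (- v) = - (lin u v :: 'k)" "lin u 0 = (0 :: 'k)"
proof -
  obtain a b c d e where v: "v = (a, b, c, d, e)" by (cases v) auto
  obtain a' b' c' d' e' where w: "w = (a', b', c', d', e')" by (cases w) auto
  show "lin u (v + w) = lin u v + (lin u w :: 'k)" "lin u (- v) = - (lin u v :: 'k)" "lin u 0 = (0 :: 'k)"
    by (simp_all add: v w val_hom[OF assms] algebra_simps zero_prod_def zero_f3_def)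
qed

lemma lin_sum:
  assumes "(3::'k::comm_ring_1) = 0"
  shows "lin u (sum f A) = (\<Sum>i\<in>A. lin u (f i) :: 'k)"
  by (induction A rule: infinite_finite_induct) (simp_all add: lin_hom[OF assms])

section \<open>Coordinates of the Frobenius conjugates\<close>

text \<open>
  The linear recurrence of the iterated cubes has the characteristic polynomial
  \<open>X ^ 5 + X ^ 4 - X ^ 3 + X ^ 2 - 1\<close> of the points. As this divides \<open>X ^ 11 - 1\<close>, the sequence has
  period 11.
\<close>

lemma conjugates_eq_points:
  fixes \<beta> :: "'k::comm_ring_1"
  assumes 3: "(3::'k) = 0" and \<beta>: "\<beta> ^ 22 + \<beta> ^ 4 = 1" and i: "i \<in> {1..11}"
  defines "\<gamma> \<equiv> \<lambda>i. \<beta> ^ (3 ^ i)"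
  shows "\<gamma> i = lin \<gamma> (pt i)" "\<gamma> 11 = \<gamma> 0"
proof -
  have "additive_op 1 \<beta> = 0" using additive_op_root[OF 3, of \<beta> 1] \<beta> by simp
  then have "\<beta> ^ 243 = \<beta> - \<beta> ^ 9 + \<beta> ^ 27 - \<beta> ^ 81" by (simp add: additive_op_def algebra_simps)
  then have *: "(\<beta> ^ 243) ^ (3 ^ n) = (\<beta> - \<beta> ^ 9 + \<beta> ^ 27 - \<beta> ^ 81) ^ (3 ^ n)" for n by simp
  have rec: "\<gamma> (n + 5) = \<gamma> n - \<gamma> (n + 2) + \<gamma> (n + 3) - \<gamma> (n + 4)" for n
  proof -
    have sub: "(x - y) ^ (3 ^ n) = x ^ (3 ^ n) - y ^ (3 ^ n)" for x y :: 'k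
      using char_3_power(1)[OF 3, of x "- y"] char_3_power(2)[OF 3, of y] by simp
    have "\<gamma> (n + k) = (\<beta> ^ (3 ^ k)) ^ (3 ^ n)" for k by (simp add: \<gamma>_def power_add mult.commute flip: power_mult)
    from this[of 5] this[of 2] this[of 3] this[of 4] show ?thesis using *[of n]
      by (simp add: sub char_3_power(1)[OF 3] \<gamma>_def)
  qed
  have three: "3 * x = 0" for x :: 'k using 3 by simp
  have r5: "\<gamma> 5 = \<gamma> 0 - \<gamma> 2 + \<gamma> 3 - \<gamma> 4" using rec[of 0] by (simp add: eval_nat_numeral)
  have g5: "\<gamma> 5 = \<gamma> 0 - \<gamma> 2 + \<gamma> 3 - \<gamma> 4"
    unfolding r5  by (simp add: algebra_simps)
  have r6: "\<gamma> 6 = \<gamma> 1 - \<gamma> 3 + \<gamma> 4 - \<gamma> 5" using rec[of 1] by (simp add: eval_nat_numeral)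
  have "\<gamma> 6 = (- \<gamma> 0 + \<gamma> 1 + \<gamma> 2 + \<gamma> 3 - \<gamma> 4) + 3 * (- \<gamma> 3 + \<gamma> 4)"
    unfolding r6 g5 by (simp add: algebra_simps)
  then have g6: "\<gamma> 6 = - \<gamma> 0 + \<gamma> 1 + \<gamma> 2 + \<gamma> 3 - \<gamma> 4" unfolding three by simp
  have r7: "\<gamma> 7 = \<gamma> 2 - \<gamma> 4 + \<gamma> 5 - \<gamma> 6" using rec[of 2] by (simp add: eval_nat_numeral)
  have "\<gamma> 7 = (- \<gamma> 0 - \<gamma> 1 - \<gamma> 2 - \<gamma> 4) + 3 * (\<gamma> 0)"
    unfolding r7 g5 g6 by (simp add: algebra_simps)
  then have g7: "\<gamma> 7 = - \<gamma> 0 - \<gamma> 1 - \<gamma> 2 - \<gamma> 4" unfolding three by simp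
  have r8: "\<gamma> 8 = \<gamma> 3 - \<gamma> 5 + \<gamma> 6 - \<gamma> 7" using rec[of 3] by (simp add: eval_nat_numeral)
  have "\<gamma> 8 = (- \<gamma> 0 - \<gamma> 1 + \<gamma> 3 + \<gamma> 4) + 3 * (\<gamma> 1 + \<gamma> 2)"
    unfolding r8 g5 g6 g7 by (simp add: algebra_simps)
  then have g8: "\<gamma> 8 = - \<gamma> 0 - \<gamma> 1 + \<gamma> 3 + \<gamma> 4" unfolding three by simp
  have r9: "\<gamma> 9 = \<gamma> 4 - \<gamma> 6 + \<gamma> 7 - \<gamma> 8" using rec[of 4] by (simp add: eval_nat_numeral)
  have "\<gamma> 9 = (\<gamma> 0 - \<gamma> 1 + \<gamma> 2 + \<gamma> 3) + 3 * (- \<gamma> 2 - \<gamma> 3)"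
    unfolding r9 g6 g7 g8 by (simp add: algebra_simps)
  then have g9: "\<gamma> 9 = \<gamma> 0 - \<gamma> 1 + \<gamma> 2 + \<gamma> 3" unfolding three by simp
  have r10: "\<gamma> 10 = \<gamma> 5 - \<gamma> 7 + \<gamma> 8 - \<gamma> 9" using rec[of 5] by (simp add: eval_nat_numeral)
  have g10: "\<gamma> 10 = \<gamma> 1 - \<gamma> 2 + \<gamma> 3 + \<gamma> 4"
    unfolding r10 g5 g7 g8 g9 by (simp add: algebra_simps)
  have r11: "\<gamma> 11 = \<gamma> 6 - \<gamma> 8 + \<gamma> 9 - \<gamma> 10" using rec[of 6] by (simp add: eval_nat_numeral)
  have "\<gamma> 11 = (\<gamma> 0) + 3 * (\<gamma> 2 - \<gamma> 4)"
    unfolding r11 g6 g8 g9 g10 by (simp add: algebra_simps)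
  then have g11: "\<gamma> 11 = \<gamma> 0" unfolding three by simp
  show "\<gamma> 11 = \<gamma> 0" by (rule g11)
  show "\<gamma> i = lin \<gamma> (pt i)"
    using i unfolding atLeastAtMost_11
    by (elim insertE) (simp_all add: pt_def points_def g5 g6 g7 g8 g9 g10 g11)
qed

section \<open>Independence of five consecutive conjugates\<close>

text \<open>
  The polynomial \<open>p\<close> acts on \<open>\<beta>\<close> with the cubing map in place of its variable.
\<close>

definition act :: "'a::field alg_closure \<Rightarrow> 'a poly \<Rightarrow> 'a alg_closure" where
  "act \<beta> p = fold_coeffs (\<lambda>c s. to_ac c * \<beta> + s ^ 3) p 0"

lemma act_pCons: "act \<beta> (pCons c p) = to_ac c * \<beta> + (act \<beta> p) ^ 3"
  by (cases "p = 0 \<and> c = 0") (auto simp: act_def fold_coeffs_pCons_not_0_0_eq fold_coeffs_pCons_coeff_not_0_eq)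

lemma act_0: "act \<beta> 0 = 0"
  by (simp add: act_def)

lemma act_hom:
  fixes \<beta> :: "'a::field alg_closure"
  assumes "CARD('a) = 3"
  shows "act \<beta> (p + q) = act \<beta> p + act \<beta> q" "act \<beta> (smult c p) = to_ac c * act \<beta> p"
    "act \<beta> p = 0 \<Longrightarrow> act \<beta> (q * p) = 0"
proof -
  have 3: "(3 :: 'a alg_closure) = 0" using char_3_transfer(1)[OF field_of_card_3(1)[OF assms]] .
  have cube: "(to_ac c :: 'a alg_closure) ^ 3 = to_ac c" for c
    using field_of_card_3(2)[OF assms, of c] by (auto simp: power3_eq_cube)
  show add: "act \<beta> (p + q) = act \<beta> p + act \<beta> q" for p q
    by (induction p q rule: poly_induct2) (simp_all add: act_0 act_pCons char_3_simps[OF 3] algebra_simps)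
  show sm: "act \<beta> (smult c p) = to_ac c * act \<beta> p" for c p
    by (induction p) (simp_all add: act_0 act_pCons power_mult_distrib cube algebra_simps)
  show "act \<beta> p = 0 \<Longrightarrow> act \<beta> (q * p) = 0"
    by (induction q) (simp_all add: act_0 act_pCons add sm)
qed

text \<open>
  The characteristic polynomial of the recurrence.
\<close>

definition hpoly :: "'a::field poly" where "hpoly = [:-1, 0, 1, -1, 1, 1:]"

text \<open>
  The coefficients \<open>g0, g1, g2\<close> and \<open>k0, ..., k3\<close> belong to a quadratic and a cubic factor; the early
  conditions on constant and leading coefficients prune the search.
\<close>

lemma no_quadratic_factor_check:
  "list_all (\<lambda>g0. list_all (\<lambda>k0. mul3 g0 k0 = N \<longrightarrow>
     list_all (\<lambda>g2. list_all (\<lambda>k3. mul3 g2 k3 = P \<longrightarrow>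
       list_all (\<lambda>g1. list_all (\<lambda>k1. mul3 g0 k1 + mul3 g1 k0 = Z \<longrightarrow>
         list_all (\<lambda>k2. \<not> (mul3 g1 k3 + mul3 g2 k2 = P \<and> mul3 g0 k2 + mul3 g1 k1 + mul3 g2 k0 = P
           \<and> mul3 g0 k3 + mul3 g1 k2 + mul3 g2 k1 = N)) [Z, P, N]) [Z, P, N]) [Z, P, N]) [Z, P, N]) [Z, P, N])
    [Z, P, N]) [Z, P, N]"
  by code_simp

lemma hpoly_no_small_factor:
  fixes g k :: "'a::field poly"
  assumes "CARD('a) = 3" "hpoly = g * k"
  shows "degree g \<noteq> 1" "degree g \<noteq> 2"
proof -
  note 3 = field_of_card_3(1)[OF assms(1)]
  have g0: "g \<noteq> 0" "k \<noteq> 0" using assms(2) by (auto simp: hpoly_def)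
  show "degree g \<noteq> 1"
  proof
    assume "degree g = 1"
    then obtain x where x: "poly g x = 0"
    proof -
      assume d: "degree g = 1" and t: "\<And>x. poly g x = 0 \<Longrightarrow> thesis"
      then have "coeff g 1 \<noteq> 0" by (metis leading_coeff_0_iff degree_0 zero_neq_one)
      moreover have "poly g (- coeff g 0 / coeff g 1) = coeff g 0 + coeff g 1 * (- coeff g 0 / coeff g 1)"
        unfolding poly_altdef d by simp
      ultimately show ?thesis using t by simp
    qed
    then have "poly hpoly x = 0" unfolding assms(2) by simp
    then have "poly hpoly (0::'a) = 0 \<or> poly hpoly (1::'a) = 0 \<or> poly hpoly (- 1 :: 'a) = 0"
      using field_of_card_3(2)[OF assms(1), of x] by auto
    then show False by (simp add: hpoly_def)
  qed
  show "degree g \<noteq> 2"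
  proof
    assume dg: "degree g = 2"
    have "degree (hpoly :: 'a poly) = 5" by (simp add: hpoly_def)
    then have dk: "degree k = 3" using dg Polynomial.degree_mult_eq[OF g0] unfolding assms(2) by simp
    have ex: "\<exists>s. val s = c" for c :: 'a
      using field_of_card_3(2)[OF assms(1), of c] val.simps by metis
    define G where "G i = (SOME s. val s = coeff g i)" for i
    define K where "K i = (SOME s. val s = coeff k i)" for i
    have G: "val (G i) = coeff g i" and K: "val (K i) = coeff k i" for i
      unfolding G_def K_def by (rule someI_ex[OF ex])+
    have z: "coeff g i = 0" if "i > 2" for i using that dg by (simp add: coeff_eq_0)
    have zk: "coeff k i = 0" if "i > 3" for i using that dk by (simp add: coeff_eq_0)
    have c: "coeff (hpoly :: 'a poly) n = (\<Sum>i\<le>n. coeff g i * coeff k (n - i))" for n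
      unfolding assms(2) coeff_mult ..
    have h: "coeff (hpoly :: 'a poly) 0 = -1" "coeff (hpoly :: 'a poly) 1 = 0" "coeff (hpoly :: 'a poly) 2 = 1"
      "coeff (hpoly :: 'a poly) 3 = -1" "coeff (hpoly :: 'a poly) 4 = 1" "coeff (hpoly :: 'a poly) 5 = 1"
      by (simp_all add: hpoly_def numeral_eq_Suc)
    have e0: "mul3 (G 0) (K 0) = N" by (rule val_inj[OF 3]) (use c[of 0] h(1) in \<open>simp add: val_hom[OF 3] G K\<close>)
    have e1: "mul3 (G 0) (K 1) + mul3 (G 1) (K 0) = Z"
      by (rule val_inj[OF 3]) (use c[of 1] h(2) in \<open>simp add: val_hom[OF 3] G K\<close>)
    have e2: "mul3 (G 0) (K 2) + mul3 (G 1) (K 1) + mul3 (G 2) (K 0) = P"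
      by (rule val_inj[OF 3]) (use c[of 2] h(3) in \<open>simp add: val_hom[OF 3] G K numeral_eq_Suc\<close>)
    have e3: "mul3 (G 0) (K 3) + mul3 (G 1) (K 2) + mul3 (G 2) (K 1) = N"
      by (rule val_inj[OF 3]) (use c[of 3] h(4) z zk in \<open>simp add: val_hom[OF 3] G K numeral_eq_Suc\<close>)
    have e4: "mul3 (G 1) (K 3) + mul3 (G 2) (K 2) = P"
      by (rule val_inj[OF 3]) (use c[of 4] h(5) z zk in \<open>simp add: val_hom[OF 3] G K numeral_eq_Suc\<close>)
    have e5: "mul3 (G 2) (K 3) = P"
      by (rule val_inj[OF 3]) (use c[of 5] h(6) z zk in \<open>simp add: val_hom[OF 3] G K numeral_eq_Suc\<close>)
    have m: "x \<in> set [Z, P, N]" for x by (cases x) simp_all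
    show False using no_quadratic_factor_check m e0 e1 e2 e3 e4 e5 unfolding list_all_iff by blast
  qed
qed

text \<open>
  The polynomials annihilating \<open>\<beta>\<close> form an ideal that contains \<open>hpoly\<close>. As this is irreducible,
  an annihilator of degree at most four would force \<open>\<beta> = 0\<close>.
\<close>

lemma conjugates_independent:
  fixes \<beta> :: "'a::field alg_closure"
  assumes card: "CARD('a) = 3" and \<beta>: "\<beta> ^ 22 + \<beta> ^ 4 = 1" and v: "lin (\<lambda>i. \<beta> ^ (3 ^ i)) v = 0"
  shows "v = 0"
proof (rule ccontr)
  assume "v \<noteq> 0"
  note 3 = char_3_transfer(1)[OF field_of_card_3(1)[OF card]]
  have \<beta>0: "\<beta> \<noteq> 0" using \<beta> by auto
  obtain a b c d e where v_eq: "v = (a, b, c, d, e)" by (cases v) auto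
  define p where "p = [:val a, val b, val c, val d, val e :: 'a:]"
  have tv: "to_ac (val x :: 'a) = val x" for x by (cases x) simp_all
  have powers: "((x ^ 3) ^ 3) = x ^ 9" "(x ^ 9) ^ 3 = x ^ 27" "(x ^ 27) ^ 3 = x ^ 81" for x :: "'a alg_closure"
    by (simp_all flip: power_mult)
  have "act \<beta> p = lin (\<lambda>i. \<beta> ^ (3 ^ i)) v"
    unfolding p_def v_eq
    by (simp add: act_pCons act_0 tv char_3_simps[OF 3] power_mult_distrib val_cube powers)
  then have ap: "act \<beta> p = 0" using v by simp
  have p0: "p \<noteq> 0"
  proof
    assume "p = 0"
    then have "val a = (val Z :: 'a)" "val b = (val Z :: 'a)" "val c = (val Z :: 'a)" "val d = (val Z :: 'a)" "val e = (val Z :: 'a)"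
      by (simp_all add: p_def)
    then have "v = 0" using val_inj[OF field_of_card_3(1)[OF card]] by (simp add: v_eq zero_prod_def zero_f3_def)
    then show False using \<open>v \<noteq> 0\<close> by simp
  qed
  have dp: "degree p \<le> 4" unfolding p_def by (simp add: degree_pCons_eq_if)
  obtain m where m: "m \<noteq> 0" "act \<beta> m = 0" and mmin: "\<And>q. q \<noteq> 0 \<Longrightarrow> act \<beta> q = 0 \<Longrightarrow> degree m \<le> degree q"
    using minimal_poly_exists[of "\<lambda>q. act \<beta> q = 0"] p0 ap by blast
  have dm: "degree m \<le> 4" using mmin[OF p0 ap] dp by simp
  have "additive_op 1 \<beta> = 0" using additive_op_root[OF 3, of \<beta> 1] \<beta> by simp
  moreover have "act \<beta> hpoly = additive_op 1 \<beta>"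
    unfolding hpoly_def additive_op_def
    by (simp add: act_pCons act_0 char_3_simps[OF 3] power_mult_distrib flip: power_mult)
  ultimately have ah: "act \<beta> hpoly = 0" by simp
  have U: "subfield_set (UNIV :: 'a set)" by (simp add: subfield_set_def)
  obtain q r where qr: "hpoly = q * m + r" "r = 0 \<or> degree r < degree m"
    using polys_on_division[OF U, of hpoly m] m(1) by (auto simp: polys_on_def)
  have "act \<beta> r = 0" using ah unfolding qr(1) by (simp add: act_hom[OF card] m(2))
  then have "r = 0" using mmin[of r] qr(2) by (metis linorder_not_le)
  then have h: "hpoly = q * m" using qr(1) by simp
  have "degree (hpoly :: 'a poly) = 5" by (simp add: hpoly_def)
  moreover have "q \<noteq> 0" using h by (auto simp: hpoly_def)
  ultimately have "degree q + degree m = 5" using Polynomial.degree_mult_eq[of q m] m(1) unfolding h by simp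
  moreover have "degree m \<noteq> 0"
  proof
    assume "degree m = 0"
    then obtain c where c: "m = [:c:]" by (metis degree_eq_zeroE)
    then have "to_ac c * \<beta> = 0" using m(2) by (simp add: act_pCons act_0)
    then show False using c m(1) \<beta>0 by simp
  qed
  moreover have "degree m \<noteq> 1" "degree m \<noteq> 2" using hpoly_no_small_factor[OF card, of m q] h by (simp_all add: mult.commute)
  moreover have "degree q \<noteq> 1" "degree q \<noteq> 2" using hpoly_no_small_factor[OF card h] by simp_all
  ultimately show False using dm by presburger
qed

section \<open>Elements of orders five and eight\<close>

lemma prime_power_dvd_card:
  assumes G: "subgroup G (sym_group 11)" and x: "x \<in> G" "x ^^ (q ^ Suc k) = id" "x ^^ (q ^ k) \<noteq> id"
    and q: "normalization_semidom_class.prime (q :: nat)"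
  shows "q ^ Suc k dvd card G"
proof -
  let ?H = "sym_group 11\<lparr>carrier := G\<rparr>"
  interpret H: group ?H by (rule subgroup.subgroup_is_group[OF G sym_group_is_group])
  have pow: "x [^]\<^bsub>?H\<^esub> n = x ^^ n" for n :: nat
  proof (induction n)
    case 0
    then show ?case by (simp add: sym_group_def id_def)
  next
    case (Suc n)
    then show ?case unfolding H.nat_pow_Suc funpow_Suc_right by (simp add: sym_group_def)
  qed
  have one: "\<one>\<^bsub>?H\<^esub> = id" by (simp add: sym_group_def)
  have xc: "x \<in> carrier ?H" using x by simp
  have "H.ord x dvd q ^ Suc k" using H.pow_eq_id[OF xc, of "q ^ Suc k"] pow one x(2) by metis
  then obtain i where i: "i \<le> Suc k" "H.ord x = q ^ i" using divides_primepow_nat[OF q] by blast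
  have "\<not> H.ord x dvd q ^ k" using H.pow_eq_id[OF xc, of "q ^ k"] pow one x(3) by metis
  then have "i = Suc k" using i le_imp_power_dvd[of i k q] by (metis le_SucE)
  then show ?thesis using H.ord_dvd_group_order[OF xc] i(2) by (simp add: Coset.order_def)
qed

lemma fps_kernel:
  fixes g :: "'k::field fps"
  assumes "additive_op (tser e) (fps_to_fls g) = 0" "g $ 0 = 0"
  shows "g = 0"
proof (rule additive_op_kernel_small[OF _ assms(2)])
  have "additive_op (tser e) (fps_to_fls g) = fps_to_fls (additive_op (fps_const e + fps_X) g)"
    by (simp add: additive_op_def tser_def fls_times_fps_to_fls fps_to_fls_power)
  then show "additive_op (fps_const e + fps_X) g = 0" using assms(1) by simp
qed

lemma points_independent_pairs:
  "list_all (\<lambda>i. list_all (\<lambda>j. i = j \<or> \<not> zero_sum [pt i, pt j] 0) [1..<12]) [1..<12]"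
  by code_simp

lemma not_dependent_pair:
  assumes "i \<in> {1..11}" "j \<in> {1..11}" "i \<noteq> j"
  shows "\<not> dependent {i, j}"
proof -
  have "i \<in> set [1..<12]" "j \<in> set [1..<12]" using assms by auto
  then have "\<not> zero_sum [pt i, pt j] 0" using points_independent_pairs assms(3) unfolding list_all_iff by blast
  then show ?thesis using dependent_iff_zero_sum[of "[i, j]"] assms(3) by simp
qed

text \<open>
  The Frobenius element at the specialisation \<open>e\<close>: it acts on the roots as cubing acts on the roots
  of the specialised trinomial.
\<close>

lemma frobenius_element:
  fixes e :: "'a::field"
  assumes card: "CARD('a) = 3"
  shows "\<exists>p\<in>galois_perms (trinomial (ratfun_var :: 'a poly fract)).
    \<forall>n. (p ^^ n = id) = (\<forall>z\<in>zeros (to_ac e). z ^ (3 ^ n) = z)"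
proof -
  let ?R = "roots_ac (trinomial (ratfun_var :: 'a poly fract))"
  note 3 = char_3_transfer(1)[OF field_of_card_3(1)[OF card]]
  obtain \<Psi> where \<Psi>: "realises e \<Psi>" using realisation_exists[OF card] by blast
  obtain p where p: "p \<in> galois_perms (trinomial ratfun_var)" "\<forall>r\<in>?R. \<Psi> (p r) = frob (\<Psi> r)"
    using automorphism_from_series[OF \<Psi> frob_hom[OF 3] frob_psi[OF card]] by blast
  have pp: "p permutes ?R" using galois_perms_closed(1)[OF p(1)] .
  have bij: "bij_betw \<Psi> ?R (zeros (tser (to_ac e)))" using \<Psi> by (simp add: realises_def)
  have bij2: "bij_betw (\<lambda>r. \<Psi> r $$ 0) ?R (zeros (to_ac e))"
    using bij_betw_trans[OF bij zeros_series(1)[OF 3]] by (simp add: comp_def)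
  have pR: "(p ^^ n) r \<in> ?R" if "r \<in> ?R" for n r using that permutes_in_image[OF pp] by (induction n) auto
  have pow: "\<Psi> ((p ^^ n) r) $$ 0 = (\<Psi> r $$ 0) ^ (3 ^ n)" if "r \<in> ?R" for n r
  proof (induction n)
    case (Suc n)
    have "\<Psi> ((p ^^ Suc n) r) $$ 0 = (\<Psi> ((p ^^ n) r) $$ 0) ^ 3" using p(2) pR[OF that, of n] by simp
    then show ?case using Suc by (simp flip: power_mult) (simp add: mult.commute)
  qed simp
  have "(p ^^ n = id) = (\<forall>z\<in>zeros (to_ac e). z ^ (3 ^ n) = z)" for n
  proof -
    have "p ^^ n = id \<longleftrightarrow> (\<forall>r\<in>?R. (p ^^ n) r = r)"
    proof
      assume *: "\<forall>r\<in>?R. (p ^^ n) r = r"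
      have "(p ^^ n) r = r" if "r \<notin> ?R" for r using that permutes_not_in[OF pp] by (induction n) auto
      then show "p ^^ n = id" using * by (auto simp: fun_eq_iff)
    qed simp
    also have "\<dots> \<longleftrightarrow> (\<forall>r\<in>?R. \<Psi> ((p ^^ n) r) $$ 0 = \<Psi> r $$ 0)" 
      using inj_on_eq_iff[OF bij_betw_imp_inj_on[OF bij2] pR] by simp
    also have "\<dots> \<longleftrightarrow> (\<forall>r\<in>?R. (\<Psi> r $$ 0) ^ (3 ^ n) = \<Psi> r $$ 0)" using pow by simp
    also have "\<dots> \<longleftrightarrow> (\<forall>z\<in>zeros (to_ac e). z ^ (3 ^ n) = z)"
      unfolding bij_betw_imp_surj_on[OF bij2, symmetric] by simp
    finally show ?thesis .
  qed
  then show ?thesis using p(1) by blast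
qed

text \<open>
  At \<open>e = 0\<close> the roots are the eleventh roots of unity, and 3 has order 5 modulo 11.
\<close>

lemma order_5_element:
  assumes card: "CARD('a::field) = 3"
  shows "\<exists>p\<in>galois_perms (trinomial (ratfun_var :: 'a poly fract)). p ^^ 5 = id \<and> p \<noteq> id"
proof -
  note 3 = char_3_transfer(1)[OF field_of_card_3(1)[OF card]]
  obtain p where p: "p \<in> galois_perms (trinomial (ratfun_var :: 'a poly fract))"
    "\<And>n. (p ^^ n = id) = (\<forall>z\<in>zeros (to_ac (0::'a)). z ^ (3 ^ n) = z)"
    using frobenius_element[OF card, of 0] by blast
  have z: "z ^ 11 = 1" if "z \<in> zeros (to_ac (0::'a))" for z using that by (simp add: zeros_def)
  have "p ^^ 5 = id" unfolding p(2)
  proof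
    fix z assume "z \<in> zeros (to_ac (0::'a))"
    then have "(z ^ 11) ^ 22 * z = z" using z by simp
    then show "z ^ (3 ^ 5) = z" by (simp flip: power_mult power_Suc2)
  qed
  moreover have "p ^^ 1 \<noteq> id" unfolding p(2)
  proof
    assume all: "\<forall>z\<in>zeros (to_ac (0::'a)). z ^ (3 ^ 1) = z"
    have "zeros (to_ac (0::'a)) \<subseteq> {1}"
    proof
      fix z assume zz: "z \<in> zeros (to_ac (0::'a))"
      then have z0: "z \<noteq> 0" using z by fastforce
      have "z * z ^ 2 = z * 1" using all zz by (simp add: power3_eq_cube power2_eq_square mult.assoc)
      then have z2: "z ^ 2 = 1" using z0 by (simp only: mult_cancel_left) simp
      have "z ^ 11 = (z ^ 2) ^ 5 * z" by (simp flip: power_mult power_Suc2)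
      then show "z \<in> {1}" using z[OF zz] z2 by simp
    qed
    then have "card (zeros (to_ac (0::'a))) \<le> card {1 :: 'a alg_closure}" by (intro card_mono) auto
    then show False using zeros_card[OF 3, of "to_ac (0::'a)"] by simp
  qed
  ultimately show ?thesis using p(1) by auto
qed

text \<open>
  At \<open>e = -1\<close> the recurrence of the iterated cubes has the characteristic polynomial
  \<open>(X + 1) * (X ^ 2 + 1) * (X ^ 2 + X - 1)\<close>, which divides \<open>X ^ 8 - 1\<close>. That the fourth power is not the
  identity follows from the degree of \<open>z ^ 81 - z\<close> reduced by \<open>z ^ 11 = z ^ 2 + 1\<close>.
\<close>

lemma order_8_element:
  assumes card: "CARD('a::field) = 3"
  shows "\<exists>p\<in>galois_perms (trinomial (ratfun_var :: 'a poly fract)). p ^^ 8 = id \<and> p ^^ 4 \<noteq> id"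
proof -
  note 3 = char_3_transfer(1)[OF field_of_card_3(1)[OF card]]
  let ?Z = "zeros (- 1 :: 'a alg_closure)"
  obtain p where p: "p \<in> galois_perms (trinomial (ratfun_var :: 'a poly fract))"
    "\<And>n. (p ^^ n = id) = (\<forall>z\<in>?Z. z ^ (3 ^ n) = z)"
    using frobenius_element[OF card, of "- 1"] by auto
  have three: "3 * x = 0" for x :: "'a alg_closure" using 3 by simp
  have "p ^^ 8 = id" unfolding p(2)
  proof
    fix z assume z: "z \<in> ?Z"
    obtain \<beta> where \<beta>: "\<beta> ^ 2 = z" using nth_root_exists[of 2 z] by auto
    then have "\<beta> ^ 22 + (- 1) * \<beta> ^ 4 = 1" using square_root_zeros z by blast
    then have "additive_op (- 1) \<beta> = 0" by (rule additive_op_root[OF 3])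
    then have "\<beta> ^ 243 = \<beta> - \<beta> ^ 9 - \<beta> ^ 27 + \<beta> ^ 81" by (simp add: additive_op_def algebra_simps)
    then have *: "(\<beta> ^ 243) ^ (3 ^ n) = (\<beta> - \<beta> ^ 9 - \<beta> ^ 27 + \<beta> ^ 81) ^ (3 ^ n)" for n by simp
    define \<gamma> where "\<gamma> i = \<beta> ^ (3 ^ i)" for i :: nat
    have rec: "\<gamma> (n + 5) = \<gamma> n - \<gamma> (n + 2) - \<gamma> (n + 3) + \<gamma> (n + 4)" for n
    proof -
      have sub: "(x - y) ^ (3 ^ n) = x ^ (3 ^ n) - y ^ (3 ^ n)" for x y :: "'a alg_closure"
        using char_3_power(1)[OF 3, of x "- y"] char_3_power(2)[OF 3, of y] by simp
      have "\<gamma> (n + k) = (\<beta> ^ (3 ^ k)) ^ (3 ^ n)" for k by (simp add: \<gamma>_def power_add mult.commute flip: power_mult)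
      from this[of 5] this[of 2] this[of 3] this[of 4] show ?thesis using *[of n]
        by (simp add: sub char_3_power(1)[OF 3] \<gamma>_def)
    qed
    have r5: "\<gamma> 5 = \<gamma> 0 - \<gamma> 2 - \<gamma> 3 + \<gamma> 4" using rec[of 0] by (simp add: eval_nat_numeral)
    have r6: "\<gamma> 6 = \<gamma> 1 - \<gamma> 3 - \<gamma> 4 + \<gamma> 5" using rec[of 1] by (simp add: eval_nat_numeral)
    have r7: "\<gamma> 7 = \<gamma> 2 - \<gamma> 4 - \<gamma> 5 + \<gamma> 6" using rec[of 2] by (simp add: eval_nat_numeral)
    have r8: "\<gamma> 8 = \<gamma> 3 - \<gamma> 5 - \<gamma> 6 + \<gamma> 7" using rec[of 3] by (simp add: eval_nat_numeral)
    have "\<gamma> 8 = \<gamma> 0 + 3 * (\<gamma> 2 + \<gamma> 3 - \<gamma> 4 - \<gamma> 0)"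
      unfolding r8 r7 r6 r5 by (simp add: algebra_simps)
    then have "\<beta> ^ (3 ^ 8) = \<beta>" unfolding three by (simp add: \<gamma>_def)
    then have "(\<beta> ^ (3 ^ 8)) ^ 2 = \<beta> ^ 2" by simp
    then show "z ^ (3 ^ 8) = z" unfolding \<beta>[symmetric] by (simp flip: power_mult)
  qed
  moreover have "p ^^ 4 \<noteq> id" unfolding p(2)
  proof
    assume all: "\<forall>z\<in>?Z. z ^ (3 ^ 4) = z"
    \<comment> \<open>The remainder of \<open>z ^ 81 - z\<close>; it would have eleven roots.\<close>
    define q where "q = monom (- 1 :: 'a alg_closure) 10 + monom 1 9 + monom 2 7 + monom 1 6 + monom 1 5 + monom 1 4 - monom 1 3 - monom 2 1"
    have "coeff q 10 = - 1" by (simp add: q_def)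
    then have q0: "q \<noteq> 0" by auto
    have dq: "degree q \<le> 10" by (rule degree_le) (simp add: q_def)
    have "?Z \<subseteq> {x. poly q x = 0}"
    proof
      fix z assume z: "z \<in> ?Z"
      then have 11: "z ^ 11 = z ^ 2 + 1" by (simp add: zeros_def algebra_simps)
      have 27: "z ^ 27 = z ^ 9 + 2 * z ^ 7 + z ^ 5"
      proof -
        have "z ^ 27 = z ^ 5 * (z ^ 11 * z ^ 11)" by (simp flip: power_add)
        then show ?thesis unfolding 11 by (simp add: algebra_simps flip: power_add)
      qed
      have 15: "z ^ 15 = z ^ 6 + z ^ 4"
      proof -
        have "z ^ 15 = z ^ 4 * z ^ 11" by (simp flip: power_add)
        then show ?thesis unfolding 11 by (simp add: algebra_simps flip: power_add)
      qed
      have 21: "z ^ 21 = z ^ 3 + z + z ^ 10"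
      proof -
        have "z ^ 21 = z ^ 10 + z * z ^ 11"
        proof -
          have "z ^ 21 = z ^ 10 * z ^ 11" by (simp flip: power_add)
          then have "z ^ 21 = z ^ 10 + z ^ 10 * z ^ 2" unfolding 11 by (simp add: algebra_simps)
          then show ?thesis by (simp flip: power_add power_Suc)
        qed
        then show ?thesis unfolding 11 by (simp add: algebra_simps power2_eq_square power3_eq_cube)
      qed
      have "z ^ 81 = (z ^ 27) ^ 3" by (simp flip: power_mult)
      also have "\<dots> = (z ^ 9 + 2 * z ^ 7 + z ^ 5) ^ 3" by (simp only: 27)
      also have "\<dots> = z ^ 27 + 8 * z ^ 21 + z ^ 15"
        by (simp add: char_3_simps[OF 3] power_mult_distrib flip: power_mult)
      also have "\<dots> = z ^ 27 - z ^ 21 + z ^ 15 + 3 * (3 * z ^ 21)" by simp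
      also have "\<dots> = z ^ 27 - z ^ 21 + z ^ 15" unfolding three by simp
      also have "\<dots> - z = poly q z"
        unfolding 27 21 15 by (simp add: q_def poly_monom algebra_simps)
      finally have "poly q z = z ^ 81 - z" by simp
      then show "z \<in> {x. poly q x = 0}" using all z by simp
    qed
    then have "card ?Z \<le> card {x. poly q x = 0}" by (rule card_mono[OF poly_roots_finite[OF q0]])
    also have "\<dots> \<le> degree q" by (rule card_poly_roots_bound[OF q0])
    finally show False using dq zeros_card[OF 3, of "- 1"] by simp
  qed
  ultimately show ?thesis using p(1) by blast
qed

section \<open>The Galois group on labelled roots\<close>

text \<open>
  The labels come from the specialisation \<open>e = 1\<close>. One square root \<open>y\<close> of a root and its
  images \<open>b i\<close> under powers of \<open>frob\<close> give labels to the roots \<open>a i = (b i) ^ 2\<close> for which \<open>frob\<close> is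
  the 11-cycle, and relations between the \<open>b i\<close> are relations between the points.
\<close>

lemma galois_perms_M11:
  assumes card: "CARD('a::field) = 3"
  defines "\<P> \<equiv> galois_perms (trinomial (ratfun_var :: 'a poly fract))"
    and "R \<equiv> roots_ac (trinomial (ratfun_var :: 'a poly fract))"
  shows "\<exists>\<phi>. bij_betw \<phi> R {1..11} \<and> map_permutation R \<phi> ` \<P> = M11"
proof -
  let ?L = "split_carrier (trinomial (ratfun_var :: 'a poly fract))"
  note 3 = char_3_transfer(1)[OF field_of_card_3(1)[OF card]]
  note three_fls = char_3_transfer(3)[OF 3]
  note L = split_carrier_facts[where p = "trinomial (ratfun_var :: 'a poly fract)"]
  define T where "T = tser (1 :: 'a alg_closure)"
  have U: "subfield_set (UNIV :: 'a alg_closure fls set)" by (simp add: subfield_set_def)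
  note frob = hom_onD[OF U frob_hom[OF 3], simplified]
  obtain \<Psi> where \<Psi>: "realises (1::'a) \<Psi>" using realisation_exists[OF card] by blast
  have h: "hom_on ?L \<Psi>" and base: "\<Psi> (to_ac x) = psi 1 x" and bij: "bij_betw \<Psi> R (zeros T)" for x
    using \<Psi> by (auto simp: realises_def R_def T_def)
  have frobT: "frob T = T" using frob_psi[OF card, of 1 ratfun_var] by (simp add: psi_ratfun_var T_def)

  obtain \<beta> :: "'a alg_closure" where \<beta>: "\<beta> ^ 22 + \<beta> ^ 4 = 1"
  proof -
    have "zeros (1 :: 'a alg_closure) \<noteq> {}" using zeros_card[OF 3, of 1] by auto
    then obtain z :: "'a alg_closure" where z: "z \<in> zeros 1" by blast
    obtain b where "b ^ 2 = z" using nth_root_exists[of 2 z] by auto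
    then show thesis using that[of b] square_root_zeros[of b 1] z by auto
  qed
  define \<gamma> where "\<gamma> = (\<lambda>i. \<beta> ^ (3 ^ i))"
  obtain y where y: "(fps_to_fls y) ^ 22 + T * (fps_to_fls y) ^ 4 = 1" "y $ 0 = \<beta>"
    using series_root[OF 3, of \<beta> 1] \<beta> unfolding T_def by auto
  define b where "b i = (frob ^^ i) (fps_to_fls y)" for i :: nat
  define a where "a i = (b i) ^ 2" for i
  have b_eq: "(b i) ^ 22 + T * (b i) ^ 4 = 1" for i
  proof (induction i)
    case (Suc i)
    have "frob ((b i) ^ 22 + T * (b i) ^ 4) = 1" using Suc frob(2) by simp
    then show ?case using frob frobT by (simp add: b_def)
  qed (simp add: b_def y)
  have b_series: "\<exists>g. b i = fps_to_fls g" for i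
    by (induction i) (auto simp: b_def frob_fps)
  have b_const: "b i $$ 0 = \<gamma> i" for i
    by (induction i) (simp_all add: b_def \<gamma>_def y power_mult[symmetric] mult.commute)
  have a_zero: "a i \<in> zeros T" for i unfolding a_def using b_eq square_root_zeros by blast

  have points: "\<gamma> i = lin \<gamma> (pt i)" if "i \<in> {1..11}" for i
    using conjugates_eq_points(1)[OF 3 \<beta> that] unfolding \<gamma>_def .
  define ssum where "ssum s A = (\<Sum>i\<in>A. if s i then b i else - b i)" for s A
  have ssum_const: "ssum s A $$ 0 = lin \<gamma> (signed_sum s A)" if "A \<subseteq> {1..11}" for s A
  proof -
    have "ssum s A $$ 0 = (\<Sum>i\<in>A. if s i then \<gamma> i else - \<gamma> i)"
      unfolding ssum_def fls_nth_sum by (intro sum.cong) (simp_all add: b_const)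
    also have "\<dots> = (\<Sum>i\<in>A. lin \<gamma> (if s i then pt i else - pt i))"
      using points that by (intro sum.cong) (auto simp: lin_hom[OF 3])
    finally show ?thesis unfolding signed_sum_def lin_sum[OF 3] .
  qed
  have ssum_zero: "ssum s A = 0 \<longleftrightarrow> signed_sum s A = 0" if A: "A \<subseteq> {1..11}" for s A
  proof
    assume "ssum s A = 0"
    then have "lin \<gamma> (signed_sum s A) = 0" using ssum_const[OF A, of s] by simp
    then show "signed_sum s A = 0" using conjugates_independent[OF card \<beta>] by (simp add: \<gamma>_def)
  next
    assume "signed_sum s A = 0"
    then have c: "ssum s A $$ 0 = 0" using ssum_const[OF A, of s] lin_hom(3)[OF 3] by simp
    have "finite A" using A finite_subset by blast
    then have "additive_op T (ssum s A) = 0 \<and> (\<exists>g. ssum s A = fps_to_fls g)"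
    proof (induction A rule: finite_induct)
      case empty
      show ?case by (auto simp: ssum_def additive_op_additive[OF three_fls] intro: exI[of _ 0])
    next
      case (insert i F)
      obtain g k where gk: "ssum s F = fps_to_fls g" "b i = fps_to_fls k" using insert.IH b_series by blast
      have eq: "ssum s (insert i F) = (if s i then b i else - b i) + ssum s F"
        using insert.hyps by (simp add: ssum_def)
      have "additive_op T (if s i then b i else - b i) = 0"
        using additive_op_root[OF three_fls b_eq] additive_op_additive(2)[OF three_fls] by simp
      then have "additive_op T (ssum s (insert i F)) = 0"
        unfolding eq additive_op_additive(1)[OF three_fls] using insert.IH by simp
      moreover have "ssum s (insert i F) = fps_to_fls ((if s i then k else - k) + g)"
        unfolding eq by (simp add: gk)
      ultimately show ?case by blast
    qed
    then obtain g where g: "additive_op T (fps_to_fls g) = 0" "ssum s A = fps_to_fls g" by metis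
    then have "g = 0" using fps_kernel[of 1 g] c by (simp add: T_def)
    then show "ssum s A = 0" using g(2) by simp
  qed

  \<comment> \<open>Equal squares would give a relation between two points.\<close>
  have a_inj: "inj_on a {1..11}"
  proof (rule inj_onI, rule ccontr)
    fix i j :: nat assume ij: "i \<in> {1..11}" "j \<in> {1..11}" "a i = a j" "i \<noteq> j"
    then have "b i = b j \<or> b i = - b j" unfolding a_def power2_eq_iff by blast
    then have "ssum (\<lambda>k. k = i) {i, j} = 0 \<or> ssum (\<lambda>_. True) {i, j} = 0"
      using ij(4) by (auto simp: ssum_def)
    then have "dependent {i, j}" using ssum_zero[of "{i, j}"] ij(1,2) unfolding dependent_def by blast
    then show False using not_dependent_pair ij by blast
  qed
  have a_bij: "bij_betw a {1..11} (zeros T)"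
  proof -
    have "a ` {1..11} = zeros T"
      using card_image[OF a_inj] zeros_series(2)[OF 3, of 1] a_zero
      by (intro card_subset_eq) (auto simp: zeros_finite T_def)
    then show ?thesis using a_inj by (simp add: bij_betw_def)
  qed
  have frob_a: "frob (a i) = a (cyc i)" if i: "i \<in> {1..11}" for i
  proof -
    have s: "frob (a i) = a (Suc i)" by (simp add: a_def b_def frob)
    show ?thesis
    proof (cases "i = 11")
      case False
      then have "cyc i = Suc i" using cyc_apply[OF i] res_id[of "i + 1"] i by simp
      then show ?thesis using s by simp
    next
      case True
      \<comment> \<open>The labels close up to a cycle because the iterated cubes of \<open>\<beta>\<close> have period 11.\<close>
      have "a 12 $$ 0 = a 1 $$ 0"
      proof -
        have "\<gamma> 12 = (\<gamma> 11) ^ 3" "\<gamma> 1 = (\<gamma> 0) ^ 3" by (simp_all add: \<gamma>_def flip: power_mult)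
        moreover have "\<gamma> 11 = \<gamma> 0" using conjugates_eq_points(2)[OF 3 \<beta>, of 1] unfolding \<gamma>_def by simp
        ultimately have "\<gamma> 12 = \<gamma> 1" by simp
        moreover have "a j $$ 0 = (\<gamma> j) ^ 2" for j
        proof -
          obtain g where g: "b j = fps_to_fls g" using b_series by blast
          then have "a j $$ 0 = (g $ 0) ^ 2" by (simp add: a_def fps_power_zeroth flip: fps_to_fls_power)
          then show ?thesis using b_const[of j] g by simp
        qed
        ultimately show ?thesis by simp
      qed
      then have "a 12 = a 1"
        using inj_onD[OF bij_betw_imp_inj_on[OF zeros_series(1)[OF 3, of 1]]] a_zero by (simp add: T_def)
      then show ?thesis using s True cyc_apply[of 11] by (simp add: res_def)
    qed
  qed

  define \<phi> where "\<phi> r = inv_into {1..11} a (\<Psi> r)" for r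
  have \<phi>: "bij_betw \<phi> R {1..11}"
    using bij_betw_trans[OF bij bij_betw_inv_into[OF a_bij]] unfolding \<phi>_def comp_def .
  have a\<phi>: "a (\<phi> r) = \<Psi> r" if "r \<in> R" for r
    unfolding \<phi>_def using bij that a_bij by (intro f_inv_into_f) (auto simp: bij_betw_def)
  define M where "M = map_permutation R \<phi>"
  have M_apply: "M p (\<phi> r) = \<phi> (p r)" if "r \<in> R" for p r
    unfolding M_def using map_permutation_apply[OF bij_betw_imp_inj_on[OF \<phi>] that] .
  note P = galois_perms_closed[where t = "ratfun_var :: 'a poly fract", folded \<P>_def R_def]
  have M_permutes: "M p permutes {1..11}" if "p \<in> \<P>" for p
    unfolding M_def using map_permutation_permutes[OF \<phi> P(1)[OF that]] .
  have M_a: "a (M p i) = \<Psi> (p (inv_into R \<phi> i))" "inv_into R \<phi> i \<in> R" "\<Psi> (inv_into R \<phi> i) = a i"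
    if p: "p \<in> \<P>" and i: "i \<in> {1..11}" for p i
  proof -
    have im: "i \<in> \<phi> ` R" using \<phi> i by (simp add: bij_betw_def)
    show r: "inv_into R \<phi> i \<in> R" using im by (rule inv_into_into)
    have f: "\<phi> (inv_into R \<phi> i) = i" using im by (rule f_inv_into_f)
    show "\<Psi> (inv_into R \<phi> i) = a i" using a\<phi>[OF r] f by simp
    have "p (inv_into R \<phi> i) \<in> R" using permutes_in_image[OF P(1)[OF p]] r by blast
    then show "a (M p i) = \<Psi> (p (inv_into R \<phi> i))" using M_apply[OF r, of p] f a\<phi> by metis
  qed
  have M_comp: "M (p \<circ> q) = M p \<circ> M q" if pq: "p \<in> \<P>" "q \<in> \<P>" for p q
  proof (rule permutes_eqI_on[OF M_permutes[OF P(3)[OF pq]] permutes_compose[OF M_permutes M_permutes]])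
    fix i :: nat assume "i \<in> {1..11}"
    then obtain r where r: "r \<in> R" "i = \<phi> r" using bij_betw_imp_surj_on[OF \<phi>] by blast
    have "q r \<in> R" using permutes_in_image[OF P(1)[OF pq(2)]] r(1) by blast
    then show "M (p \<circ> q) i = (M p \<circ> M q) i" using r M_apply by simp
  qed (use pq in auto)
  have M_id: "M id = id" unfolding M_def by (rule map_permutation_id'[OF bij_betw_imp_inj_on[OF \<phi>]])
  have M_pow: "M (p ^^ n) = M p ^^ n \<and> p ^^ n \<in> \<P>" if p: "p \<in> \<P>" for p n
  proof (induction n)
    case 0
    show ?case using M_id P(2) by (simp add: id_def)
  next
    case (Suc n)
    then show ?case unfolding funpow.simps(2) using M_comp[OF p] P(3)[OF p] by metis
  qed
  have M_inj: "p = id" if p: "p \<in> \<P>" "M p = id" for p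
  proof (rule permutes_eqI_on[OF P(1)[OF p(1)] permutes_id])
    fix r assume r: "r \<in> R"
    then have "p r \<in> R" using permutes_in_image[OF P(1)[OF p(1)]] by blast
    moreover have "\<phi> (p r) = \<phi> r" using M_apply[OF r, of p] p(2) by simp
    ultimately show "p r = id r" using inj_onD[OF bij_betw_imp_inj_on[OF \<phi>]] r by simp
  qed

  define G where "G = M ` \<P>"
  have G_aut: "G \<subseteq> aut"
  proof
    fix \<pi> assume "\<pi> \<in> G"
    then obtain p where p: "p \<in> \<P>" "\<pi> = M p" by (auto simp: G_def)
    obtain \<sigma> where \<sigma>: "\<sigma> \<in> carrier (galois_group (trinomial (ratfun_var :: 'a poly fract)))" "p = restrict_id \<sigma> R"
      using p(1) unfolding \<P>_def galois_perms_def R_def by blast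
    have \<sigma>L: "\<sigma> ` ?L = ?L" "hom_on ?L \<sigma>" using \<sigma>(1) unfolding galois_group_iff Bij_def bij_betw_def by blast+
    let ?N = "\<Psi> ` ?L"
    \<comment> \<open>The square roots \<open>b i\<close> need not be images of elements of the splitting field, so \<open>\<sigma>\<close> is first
      transported to a map \<open>\<theta>\<close> on series and then extended to them.\<close>
    define \<theta> where "\<theta> x = \<Psi> (\<sigma> (inv_into ?L \<Psi> x))" for x
    have inj: "inj_on \<Psi> ?L" by (rule hom_on_inj[OF L(1) h])
    have N: "subfield_set ?N" by (rule subfield_image[OF L(1) h])
    have im: "inv_into ?L \<Psi> ` ?N = ?L" using inj by simp
    then have im2: "(\<lambda>x. \<sigma> (inv_into ?L \<Psi> x)) ` ?N = ?L" using \<sigma>L(1) by (metis image_image)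
    have "hom_on ?N (\<lambda>x. \<sigma> (inv_into ?L \<Psi> x))"
      by (rule hom_on_comp[OF hom_on_inv[OF L(1) h]]) (unfold im, rule \<sigma>L(2))
    then have \<theta>: "hom_on ?N \<theta>"
      unfolding \<theta>_def by (rule hom_on_comp) (unfold im2, rule h)
    have \<pi>p: "\<pi> permutes {1..11}" using M_permutes p by simp
    have \<theta>a: "\<theta> (a i) = a (\<pi> i)" "a i \<in> ?N" if i: "i \<in> {1..11}" for i
    proof -
      note m = M_a[OF p(1) i]
      have rL: "inv_into R \<phi> i \<in> ?L" using m(2) L(3) by (simp add: R_def)
      then have "inv_into ?L \<Psi> (a i) = inv_into R \<phi> i" using inv_into_f_f[OF inj rL] m(3) by simp
      then show "\<theta> (a i) = a (\<pi> i)" unfolding \<theta>_def using m(1,2) \<sigma>(2) p(2) by simp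
      show "a i \<in> ?N" using m(3) rL by (metis imageI)
    qed
    have two: "(2 :: 'a alg_closure fls) \<noteq> 0"
    proof
      assume "(2 :: 'a alg_closure fls) = 0"
      moreover have "(1 :: 'a alg_closure fls) = 3 - 2" by simp
      ultimately show False using three_fls by simp
    qed
    have "\<exists>E \<theta>'. subfield_set E \<and> hom_on E \<theta>' \<and> ?N \<subseteq> E \<and> b ` {1..11} \<subseteq> E \<and> (\<forall>x\<in>?N. \<theta>' x = \<theta> x)"
    proof (rule hom_extend[OF N \<theta>])
      show "finite (b ` {1..11})" by simp
      fix x assume "x \<in> b ` {1..11}"
      then obtain i where i: "i \<in> {1..11}" "x = b i" by blast
      define q where "q = [:- a i, 0, 1:]"
      note N' = subfield_setD[OF N] and t = hom_onD[OF N \<theta>]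
      have "q \<in> polys_on ?N" using \<theta>a(2)[OF i(1)] N' by (auto simp: q_def polys_on_def coeff_pCons split: nat.splits)
      moreover have "q \<noteq> 0" "poly q x = 0" by (simp_all add: q_def i(2) a_def power2_eq_square)
      moreover have "card {z. poly (map_poly \<theta> q) z = 0} = degree q"
      proof -
        have "map_poly \<theta> q = [:- a (\<pi> i), 0, 1:]"
          using t \<theta>a[OF i(1)] by (simp add: q_def map_poly_pCons)
        then have "{z. poly (map_poly \<theta> q) z = 0} = {z. z ^ 2 = (b (\<pi> i)) ^ 2}"
          by (auto simp: a_def power2_eq_square)
        also have "\<dots> = {b (\<pi> i), - b (\<pi> i)}" by (auto simp: power2_eq_iff)
        also have "card \<dots> = 2"
        proof -
          have "b (\<pi> i) \<noteq> 0" using b_eq[of "\<pi> i"] by auto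
          then have "2 * b (\<pi> i) \<noteq> 0" using two by simp
          then have "b (\<pi> i) + b (\<pi> i) \<noteq> 0" unfolding mult_2 .
          then have "b (\<pi> i) \<noteq> - b (\<pi> i)" unfolding eq_neg_iff_add_eq_0 .
          then show ?thesis by simp
        qed
        finally show ?thesis by (simp add: q_def)
      qed
      ultimately show "\<exists>q. q \<in> polys_on ?N \<and> q \<noteq> 0 \<and> poly q x = 0 \<and> card {z. poly (map_poly \<theta> q) z = 0} = degree q"
        by blast
    qed
    then obtain E \<theta>' where E: "subfield_set E" "hom_on E \<theta>'" "?N \<subseteq> E" "b ` {1..11} \<subseteq> E" "\<forall>x\<in>?N. \<theta>' x = \<theta> x"
      by blast
    note E' = subfield_setD[OF E(1)] and t = hom_onD[OF E(1,2)]
    \<comment> \<open>The extension respects squares, hence permutes the \<open>b i\<close> up to signs only.\<close>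
    have sign: "\<exists>u. \<theta>' (b i) = (if u then b (\<pi> i) else - b (\<pi> i))" if i: "i \<in> {1..11}" for i
    proof -
      have "b i \<in> E" using E(4) i by blast
      then have "(\<theta>' (b i)) ^ 2 = \<theta>' (a i)" unfolding a_def by (rule t(8)[symmetric])
      also have "\<dots> = a (\<pi> i)" using bspec[OF E(5) \<theta>a(2)[OF i]] \<theta>a(1)[OF i] by simp
      finally have "(\<theta>' (b i)) ^ 2 = (b (\<pi> i)) ^ 2" by (simp add: a_def)
      then show ?thesis unfolding power2_eq_iff by (metis (full_types))
    qed
    then obtain u where u: "\<And>i. i \<in> {1..11} \<Longrightarrow> \<theta>' (b i) = (if u i then b (\<pi> i) else - b (\<pi> i))" by metis
    show "\<pi> \<in> aut" unfolding aut_def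
    proof (clarify, intro conjI allI impI \<pi>p)
      fix A :: "nat set" assume A: "A \<subseteq> {1..11}" "card A = 5" "dependent A"
      obtain s where s: "signed_sum s A = 0" using A(3) by (auto simp: dependent_def)
      have bE: "b i \<in> E" if "i \<in> A" for i using that A(1) E(4) by blast
      have "\<theta>' (ssum s A) = (\<Sum>i\<in>A. \<theta>' (if s i then b i else - b i))"
        unfolding ssum_def by (rule hom_on_sum[OF E(1,2)]) (use bE E' in auto)
      also have "\<dots> = (\<Sum>i\<in>A. if s i = u i then b (\<pi> i) else - b (\<pi> i))"
        by (rule sum.cong[OF refl]) (use u A(1) t(7) bE in auto)
      also have "\<dots> = ssum (\<lambda>j. s (inv' \<pi> j) = u (inv' \<pi> j)) (\<pi> ` A)"
        unfolding ssum_def using permutes_inj_on[OF \<pi>p, of A] permutes_inverses(2)[OF \<pi>p]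
        by (simp add: sum.reindex)
      finally have "ssum (\<lambda>j. s (inv' \<pi> j) = u (inv' \<pi> j)) (\<pi> ` A) = 0"
        using ssum_zero[OF A(1), of s] s t(1) by simp
      moreover have "\<pi> ` A \<subseteq> {1..11}" using A(1) permutes_image[OF \<pi>p] by blast
      ultimately show "dependent (\<pi> ` A)" using ssum_zero unfolding dependent_def by blast
    qed
  qed

  have G1: "G \<subseteq> M11" using G_aut aut_eq_M11 by simp
  have G2: "id \<in> G" using M_id P(2) unfolding G_def by (metis imageI)
  have G3: "p \<circ> q \<in> G" if "p \<in> G" "q \<in> G" for p q
    using that M_comp P(3) unfolding G_def by (metis (no_types, lifting) imageE imageI)
  have G4: "cyc \<in> G"
  proof -
    obtain p where p: "p \<in> \<P>" "\<forall>r\<in>R. \<Psi> (p r) = frob (\<Psi> r)"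
      using automorphism_from_series[OF \<Psi> frob_hom[OF 3] frob_psi[OF card]] unfolding \<P>_def R_def by blast
    have "M p = cyc"
    proof (rule permutes_eqI_on[OF M_permutes[OF p(1)] cyc_permutes])
      fix i :: nat assume i: "i \<in> {1..11}"
      have "a (M p i) = a (cyc i)" using M_a[OF p(1) i] p(2) frob_a[OF i] by simp
      moreover have "M p i \<in> {1..11}" "cyc i \<in> {1..11}"
        using permutes_in_image[OF M_permutes[OF p(1)]] permutes_in_image[OF cyc_permutes] i by blast+
      ultimately show "M p i = cyc i" using inj_onD[OF a_inj] by blast
    qed
    then show ?thesis using imageI[OF p(1), of M] unfolding G_def by simp
  qed
  have sub: "subgroup G (sym_group 11)" by (rule G_subgroup[OF G1 G2 G3 G4])
  have M_pow_id: "M p ^^ n = id \<longleftrightarrow> p ^^ n = id" if "p \<in> \<P>" for p n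
    using M_pow[OF that, of n] M_inj M_id by metis
  have d5: "5 dvd card G"
  proof -
    obtain p where p: "p \<in> \<P>" "p ^^ 5 = id" "p \<noteq> id" using order_5_element[OF card] unfolding \<P>_def by blast
    have "M p ^^ (5 ^ Suc 0) = id" "M p ^^ (5 ^ 0) \<noteq> id"
      using M_pow_id[OF p(1), of 5] M_pow_id[OF p(1), of 1] p(2,3) by simp_all
    moreover have "M p \<in> G" using p(1) by (simp add: G_def)
    ultimately have "5 ^ Suc 0 dvd card G" by (intro prime_power_dvd_card[OF sub]) simp_all
    then show ?thesis by simp
  qed
  have d8: "8 dvd card G"
  proof -
    obtain p where p: "p \<in> \<P>" "p ^^ 8 = id" "p ^^ 4 \<noteq> id" using order_8_element[OF card] unfolding \<P>_def by blast
    have "M p ^^ (2 ^ Suc 2) = id" "M p ^^ (2 ^ 2) \<noteq> id"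
      using M_pow_id[OF p(1), of 8] M_pow_id[OF p(1), of 4] p(2,3) by simp_all
    moreover have "M p \<in> G" using p(1) by (simp add: G_def)
    ultimately have "2 ^ Suc 2 dvd card G" by (intro prime_power_dvd_card[OF sub]) simp_all
    then show ?thesis by simp
  qed
  have "G = M11" by (rule G_eq_M11[OF G1 G2 G3 G4 d5 d8])
  then show ?thesis using \<phi> unfolding G_def M_def by blast
qed

theorem mainTheorem2:
  fixes t :: "'a::field poly fract"
    and f :: "'a poly fract poly"
  assumes "CARD('a) = 3"
    and "t = ratfun_var"
    and "f = monom 1 11 + monom t 2 - 1"
  shows "perm_isomorphic (roots_ac f) (galois_perms f) {1..11} M11"
  unfolding perm_isomorphic_def assms(2,3) trinomial_def[symmetric]
  by (rule galois_perms_M11[OF assms(1)])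

end
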